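(* Let $D\subset\mathbb{C}^3$ be the vanishing locus of $F_{B,5}=xy^4+y^3z+z^3$, let $E,V,W$ be the basis of logarithmic vector fields and $\alpha,\beta,\gamma$ the dual basis of logarithmic $1$-forms given in the context. Let $H$ be a connected complex reductive group with Lie algebra $\mathfrak{h}$, and let $\nabla=d+\omega$ be a flat connection on a (holomorphic, trivialized) principal $H$-bundle over $\mathbb{C}^3$ with logarithmic singularities along $D$. There exists a holomorphic gauge transformation which brings the connection into the form $$\nabla=d+(S+N)\otimes\alpha+\Big(B-\tfrac{32}{3}xN\Big)\otimes\beta+(C-4yN)\otimes\gamma,$$ where $S\in\mathfrak{h}$ is a semisimple element, $N:\mathbb{C}^3\to\mathfrak{h}$ is a holomorphic family of nilpotent elements, and $B,C:\mathbb{C}^3\to\mathfrak{h}$ are holomorphic maps. Furthermore, these data satisfy \begin{enumerate} \item $E(B)=B+[B,S]$, \item $E(C)=2C+[C,S]$, \item $E(N)=[N,S]$, \item $V(N)=[N,B]$, \item $W(N)=[N,C]$, \item $V(C)-W(B)=24zS+6yB-40xC-[B,C]$. \end{enumerate}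
   Context: Logarithmic vector fields along $D$ are holomorphic vector fields preserving the reduced ideal of $D$; they form the sheaf $T_{\mathbb{C}^3}(-\log D)$, which here is free with basis $$E=x\partial_x+2y\partial_y+3z\partial_z,\quad V=2y\partial_x+(-24xy+2z)\partial_y+(-2y^2-32xz)\partial_z,\quad W=3z\partial_x-9y^2\partial_y-12yz\partial_z.$$ They satisfy $[E,V]=V$, $[E,W]=2W$, $[V,W]=24zE+6yV-40xW$. The dual basis of logarithmic $1$-forms (the dual sheaf $\Omega^1_{\mathbb{C}^3}(\log D)$) is $\alpha,\beta,\gamma$ (dual to $E,V,W$ respectively). A connection with logarithmic singularities along $D$ on the trivial principal $H$-bundle is $\nabla=d+\omega$ with $\omega=A\otimes\alpha+B\otimes\beta+C\otimes\gamma$ for holomorphic maps $A,B,C:\mathbb{C}^3\to\mathfrak{h}$. It is flat if $d\omega+\frac12[\omega,\omega]=0$. A gauge transformation is a holomorphic map $h:\mathbb{C}^3\to H$, acting by $\omega\mapsto \mathrm{Ad}_h(\omega)+(dh)h^{-1}$. Bracket convention: Lie algebras of Lie groups are defined by right-invariant vector fields, so the bracket $[X,Y]$ on $\mathfrak{h}$ is the negative of the usual one; for matrix groups $[X,Y]=-(XY-YX)$. For a vector field $Z$ and an $\mathfrak{h}$-valued function $f$, $Z(f)$ denotes the derivative of $f$ along $Z$. *)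

theory Defs
  imports "HOL-Analysis.Analysis" "HOL-Algebra.Coset"
begin

section \<open>Complex reductive groups and their Lie algebras\<close>

text \<open>
  A complex reductive group is a linear algebraic group, i.e. a Zariski-closed subgroup of some
  $GL_n(\mathbb{C})$, with trivial unipotent radical. Here $n$ is the cardinality of the
  index type.
\<close>

definition GL :: "(complex^'n^'n) monoid" where
  "GL = \<lparr>carrier = {g. invertible g}, monoid.mult = (**), one = mat 1\<rparr>"

inductive polynomial_map :: "(complex^'n^'n \<Rightarrow> complex) \<Rightarrow> bool" where
  const: "polynomial_map (\<lambda>M. c)"
| entry: "polynomial_map (\<lambda>M. M $ i $ j)"
| add: "polynomial_map f \<Longrightarrow> polynomial_map g \<Longrightarrow> polynomial_map (\<lambda>M. f M + g M)"
| mult: "polynomial_map f \<Longrightarrow> polynomial_map g \<Longrightarrow> polynomial_map (\<lambda>M. f M * g M)"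

definition algebraic_group :: "(complex^'n^'n) set \<Rightarrow> bool" where
  "algebraic_group H \<longleftrightarrow> subgroup H GL \<and>
     (\<exists>P. (\<forall>f\<in>P. polynomial_map f) \<and> H = {g \<in> carrier GL. \<forall>f\<in>P. f g = 0})"

definition nilpotent_matrix :: "complex^'n^'n \<Rightarrow> bool" where
  "nilpotent_matrix M \<longleftrightarrow> (\<exists>k. (((**) M) ^^ k) (mat 1) = 0)"

definition semisimple_matrix :: "complex^'n^'n \<Rightarrow> bool" where
  "semisimple_matrix M \<longleftrightarrow>
     (\<exists>P :: complex^'n^'n. invertible P \<and> (\<forall>i j. i \<noteq> j \<longrightarrow> (P ** M ** matrix_inv P) $ i $ j = 0))"

definition unipotent_matrix :: "complex^'n^'n \<Rightarrow> bool" where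
  "unipotent_matrix g \<longleftrightarrow> nilpotent_matrix (g - mat 1)"

text \<open>
  For algebraic groups over $\mathbb{C}$, connectedness in the Zariski and in the Euclidean
  topology agree; \<^const>\<open>connected\<close> is the latter.
\<close>

definition connected_reductive_group :: "(complex^'n^'n) set \<Rightarrow> bool" where
  "connected_reductive_group H \<longleftrightarrow> algebraic_group H \<and> connected H \<and>
     (\<forall>U. algebraic_group U \<and> connected U \<and> U \<lhd> (GL\<lparr>carrier := H\<rparr>) \<and> (\<forall>g\<in>U. unipotent_matrix g)
        \<longrightarrow> U = {mat 1})"

text \<open>
  The tangent space at the identity, as the set of velocities of curves in the group. (For a closed
  subgroup of $GL_n$, differentiability of the curve at $0$ already suffices.)
\<close>

definition lie_algebra :: "(complex^'n^'n) set \<Rightarrow> (complex^'n^'n) set" where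
  "lie_algebra H = {X. \<exists>c :: real \<Rightarrow> complex^'n^'n.
     (\<forall>t. c t \<in> H) \<and> c 0 = mat 1 \<and> (c has_vector_derivative X) (at 0)}"

text \<open>
  The bracket is that of right-invariant vector fields, the negative of the matrix commutator.
\<close>

definition bracket :: "complex^'n^'n \<Rightarrow> complex^'n^'n \<Rightarrow> complex^'n^'n" where
  "bracket X Y = - (X ** Y - Y ** X)"

definition cscale :: "complex \<Rightarrow> complex^'n^'n \<Rightarrow> complex^'n^'n"  (infixr \<open>*\<^sub>C\<close> 75) where
  "c *\<^sub>C M = (\<chi> i j. c * M $ i $ j)"


section \<open>Logarithmic vector fields and forms\<close>

definition F_B5 :: "complex^3 \<Rightarrow> complex" where
  "F_B5 p = p$1 * (p$2)^4 + (p$2)^3 * p$3 + (p$3)^3"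

definition divisor :: "(complex^3) set" where
  "divisor = {p. F_B5 p = 0}"

definition E_vf :: "complex^3 \<Rightarrow> complex^3" where
  "E_vf p = vector [p$1, 2 * p$2, 3 * p$3]"

definition V_vf :: "complex^3 \<Rightarrow> complex^3" where
  "V_vf p = vector [2 * p$2, - 24 * p$1 * p$2 + 2 * p$3, - 2 * (p$2)^2 - 32 * p$1 * p$3]"

definition W_vf :: "complex^3 \<Rightarrow> complex^3" where
  "W_vf p = vector [3 * p$3, - 9 * (p$2)^2, - 12 * p$2 * p$3]"

text \<open>The matrix whose columns are $E$, $V$, $W$.\<close>

definition log_frame :: "complex^3 \<Rightarrow> complex^3^3" where
  "log_frame p = transpose (vector [E_vf p, V_vf p, W_vf p])"

text \<open>
  The dual basis. Logarithmic forms are holomorphic on the complement of the divisor, where the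
  frame is invertible (\<open>det_log_frame\<close> below); a form is represented by its values there, and its
  values at points of the divisor carry no meaning.
\<close>

definition alpha :: "complex^3 \<Rightarrow> complex^3 \<Rightarrow> complex" where
  "alpha p u = (matrix_inv (log_frame p) *v u) $ 1"

definition beta :: "complex^3 \<Rightarrow> complex^3 \<Rightarrow> complex" where
  "beta p u = (matrix_inv (log_frame p) *v u) $ 2"

definition gamma :: "complex^3 \<Rightarrow> complex^3 \<Rightarrow> complex" where
  "gamma p u = (matrix_inv (log_frame p) *v u) $ 3"

definition deriv_along ::
  "(complex^3 \<Rightarrow> complex^3) \<Rightarrow> (complex^3 \<Rightarrow> 'a::real_normed_vector) \<Rightarrow> complex^3 \<Rightarrow> 'a" where
  "deriv_along Z f p = frechet_derivative f (at p) (Z p)"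

lemma det_log_frame: "det (log_frame p) = - 18 * F_B5 p"
  unfolding log_frame_def det_transpose
  by (simp add: det_3 E_vf_def V_vf_def W_vf_def F_B5_def algebra_simps power2_eq_square
      power3_eq_cube power4_eq_xxxx)

lemma dual_basis:
  assumes "p \<notin> divisor"
  shows "alpha p (E_vf p) = 1" "alpha p (V_vf p) = 0" "alpha p (W_vf p) = 0"
    and "beta p (E_vf p) = 0" "beta p (V_vf p) = 1" "beta p (W_vf p) = 0"
    and "gamma p (E_vf p) = 0" "gamma p (V_vf p) = 0" "gamma p (W_vf p) = 1"
proof -
  let ?M = "log_frame p"
  have "invertible ?M"
    using assms by (simp add: invertible_det_nz det_log_frame divisor_def)
  then have *: "matrix_inv ?M *v (?M *v u) = u" for u
    using someI_ex[of "\<lambda>A'. ?M ** A' = mat 1 \<and> A' ** ?M = mat 1"]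
    by (simp add: matrix_vector_mul_assoc matrix_inv_def invertible_def)
  have "E_vf p = ?M *v axis 1 1" "V_vf p = ?M *v axis 2 1" "W_vf p = ?M *v axis 3 1"
    by (simp_all add: log_frame_def matrix_vector_mult_def transpose_def sum_3 axis_def vec_eq_iff
        forall_3)
  then have E: "matrix_inv ?M *v E_vf p = axis 1 1"
    and V: "matrix_inv ?M *v V_vf p = axis 2 1"
    and W: "matrix_inv ?M *v W_vf p = axis 3 1"
    by (simp_all only: *)
  show "alpha p (E_vf p) = 1" "alpha p (V_vf p) = 0" "alpha p (W_vf p) = 0"
    "beta p (E_vf p) = 0" "beta p (V_vf p) = 1" "beta p (W_vf p) = 0"
    "gamma p (E_vf p) = 0" "gamma p (V_vf p) = 0" "gamma p (W_vf p) = 1"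
    by (simp_all add: alpha_def beta_def gamma_def E V W axis_def)
qed

text \<open>$E$, $V$, $W$ preserve the ideal generated by $F$, hence are logarithmic.\<close>

lemma log_vector_fields:
  "deriv_along E_vf F_B5 p = 9 * F_B5 p"
  "deriv_along V_vf F_B5 p = - 96 * p$1 * F_B5 p"
  "deriv_along W_vf F_B5 p = - 36 * p$2 * F_B5 p"
proof -
  have "(F_B5 has_derivative (\<lambda>u. (p$2)^4 * u$1 + (4 * p$1 * (p$2)^3 + 3 * (p$2)^2 * p$3) * u$2
      + ((p$2)^3 + 3 * (p$3)^2) * u$3)) (at p)"
    unfolding F_B5_def
    by (auto intro!: derivative_eq_intros bounded_linear.has_derivative[OF bounded_linear_vec_nth]
        simp: fun_eq_iff algebra_simps)
  then have d: "frechet_derivative F_B5 (at p) =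
      (\<lambda>u. (p$2)^4 * u$1 + (4 * p$1 * (p$2)^3 + 3 * (p$2)^2 * p$3) * u$2
        + ((p$2)^3 + 3 * (p$3)^2) * u$3)"
    by (rule frechet_derivative_at[symmetric])
  show "deriv_along E_vf F_B5 p = 9 * F_B5 p"
    "deriv_along V_vf F_B5 p = - 96 * p$1 * F_B5 p"
    "deriv_along W_vf F_B5 p = - 36 * p$2 * F_B5 p"
    unfolding deriv_along_def d E_vf_def V_vf_def W_vf_def F_B5_def vector_3 by algebra+
qed


section \<open>Logarithmic connections\<close>

text \<open>
  Holomorphic maps from $\mathbb{C}^3$ into a subset of the matrix space: everywhere differentiable
  with complex-linear derivative.
\<close>

definition holomorphic_into :: "(complex^'n^'n) set \<Rightarrow> (complex^3 \<Rightarrow> complex^'n^'n) \<Rightarrow> bool" where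
  "holomorphic_into T f \<longleftrightarrow> (\<forall>p. f p \<in> T) \<and>
     (\<forall>p. \<exists>f'. (f has_derivative f') (at p) \<and> (\<forall>c v. f' (c *s v) = c *\<^sub>C f' v))"

text \<open>Matrix-valued 1-forms: the value at a point \<open>p\<close> on a tangent vector \<open>u\<close> is \<open>\<omega> p u\<close>.\<close>

type_synonym 'm form1 = "complex^3 \<Rightarrow> complex^3 \<Rightarrow> 'm"

definition log_form ::
  "(complex^3 \<Rightarrow> complex^'n^'n) \<Rightarrow> (complex^3 \<Rightarrow> complex^'n^'n) \<Rightarrow> (complex^3 \<Rightarrow> complex^'n^'n)
    \<Rightarrow> (complex^'n^'n) form1" where
  "log_form A B C p u = alpha p u *\<^sub>C A p + beta p u *\<^sub>C B p + gamma p u *\<^sub>C C p"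

definition same_form :: "(complex^'n^'n) form1 \<Rightarrow> (complex^'n^'n) form1 \<Rightarrow> bool" where
  "same_form \<omega> \<eta> \<longleftrightarrow> (\<forall>p. p \<notin> divisor \<longrightarrow> \<omega> p = \<eta> p)"

definition log_connection :: "(complex^'n^'n) set \<Rightarrow> (complex^'n^'n) form1 \<Rightarrow> bool" where
  "log_connection H \<omega> \<longleftrightarrow> (\<exists>A B C.
     holomorphic_into (lie_algebra H) A \<and> holomorphic_into (lie_algebra H) B \<and>
     holomorphic_into (lie_algebra H) C \<and> same_form \<omega> (log_form A B C))"

text \<open>
  The exterior derivative, with tangent vectors \<open>u\<close>, \<open>v\<close> extended to (commuting) constant vector
  fields.
\<close>

definition ext_deriv ::
  "(complex^'n^'n) form1 \<Rightarrow> complex^3 \<Rightarrow> complex^3 \<Rightarrow> complex^3 \<Rightarrow> complex^'n^'n" where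
  "ext_deriv \<omega> p u v =
     frechet_derivative (\<lambda>q. \<omega> q v) (at p) u - frechet_derivative (\<lambda>q. \<omega> q u) (at p) v"

definition form_bracket ::
  "(complex^'n^'n) form1 \<Rightarrow> (complex^'n^'n) form1
    \<Rightarrow> complex^3 \<Rightarrow> complex^3 \<Rightarrow> complex^3 \<Rightarrow> complex^'n^'n" where
  "form_bracket \<omega> \<eta> p u v = bracket (\<omega> p u) (\<eta> p v) - bracket (\<omega> p v) (\<eta> p u)"

definition flat_connection :: "(complex^'n^'n) form1 \<Rightarrow> bool" where
  "flat_connection \<omega> \<longleftrightarrow> (\<forall>p u v. p \<notin> divisor \<longrightarrow>
     ext_deriv \<omega> p u v + (1/2) *\<^sub>C form_bracket \<omega> \<omega> p u v = 0)"

text \<open>The gauge action $\omega \mapsto \mathrm{Ad}_h(\omega) + (dh)h^{-1}$.\<close>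

definition gauge_action ::
  "(complex^3 \<Rightarrow> complex^'n^'n) \<Rightarrow> (complex^'n^'n) form1 \<Rightarrow> (complex^'n^'n) form1" where
  "gauge_action h \<omega> p u = h p ** \<omega> p u ** matrix_inv (h p)
     + frechet_derivative h (at p) u ** matrix_inv (h p)"

end

theory Submission
  imports Defs "HOL-Complex_Analysis.Complex_Analysis"
    "HOL-Computational_Algebra.Fundamental_Theorem_Algebra"
    "HOL-Computational_Algebra.Polynomial_Factorial" "HOL-Computational_Algebra.Field_as_Ring"
begin

text \<open>
  On the orbits \<open>(t x, t^2 y, t^3 z)\<close> of \<open>E\<close> the \<open>E\<close>-component of the connection is an equation with a
  regular singularity at \<open>t = 0\<close>, and weighted Taylor expansion plays the role of the power series
  of Poincare--Dulac theory. Write \<open>A 0 = S + N0\<close> for the Jordan decomposition, which stays in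
  \<open>lie_algebra H\<close> because \<open>H\<close> is algebraic. Finitely many gauge transformations bring the
  coefficients of \<open>A\<close> of weight below some bound into the eigenspaces \<open>[S, A_k] = k A_k\<close>. Beyond that
  bound nothing resonates: the equation \<open>E h = Y h - h A\<close>, with \<open>Y\<close> the truncation of \<open>A\<close>, has a
  convergent power series solution. That \<open>h\<close> takes values in \<open>H\<close> follows from a Gronwall estimate for the distance
  to \<open>H\<close> along orbits, since \<open>h - 1\<close> vanishes at \<open>t = 0\<close> to a higher order than solutions can grow.
  This gives \<open>A = S + N\<close> with \<open>[S, N] = E N\<close>; so \<open>N\<close> is conjugated along orbits and nilpotent like \<open>N0\<close>.
  The remaining equations are the flatness equations in the frame \<open>E\<close>, \<open>V\<close>, \<open>W\<close>, each split into its
  components with respect to a semisimple and a commuting nilpotent operator.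
\<close>

text \<open>One inequality, \<open>norm (Y1 0) + norm (Y2 0) < real k0\<close>, does two jobs. It
  keeps the operators \<open>k Z - (Y1 0 Z - Z Y2 0)\<close> with \<open>k \<ge> k0\<close>
  invertible, so that resonances occur only in finitely many weights, and it puts the order of
  contact with the identity above the growth rate in the Gronwall estimate. Membership in
  \<open>H\<close> is the delicate point throughout, since \<open>lie_algebra\<close> supplies only
  velocities at one instant of real curves. For \<open>A 0\<close> the one-parameter group is an
  exponential polynomial in a real time \<open>t\<close>. The functions \<open>exp (l t)\<close>
  with different \<open>l\<close> are independent over the polynomials, so the time in the
  exponentials and the time in the polynomial factors can be replaced by unrelated complex numbers.
  This puts \<open>S\<close>, \<open>N0\<close> and all their complex multiples into
  \<open>lie_algebra H\<close>. The multiples of \<open>x N\<close> and \<open>y N\<close> in the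
  final form absorb the term \<open>24 z N\<close> that the third flatness equation would otherwise
  contain: they have the weights of \<open>B\<close> and \<open>C\<close>, and their constants make
  all contributions of \<open>N\<close> alone cancel.\<close>

no_notation fps_nth (infixl \<open>$\<close> 75)

section \<open>Holomorphic functions of several variables\<close>

definition ec :: "real \<Rightarrow> complex" where
  "ec t = exp (2 * of_real pi * \<i> * of_real t)"

lemma ec_nonzero [simp]: "ec t \<noteq> 0"
  by (simp add: ec_def)

lemma continuous_on_ec [continuous_intros]:
  "continuous_on A f \<Longrightarrow> continuous_on A (\<lambda>x. ec (f x))"
  unfolding ec_def by (intro continuous_intros)

text \<open>Cauchy's formula on the circle of radius 1 around \<open>w\<close>, parametrised by
  \<open>ec\<close>. The domain of integration does not depend on \<open>w\<close> or
  \<open>g\<close>, so continuity and holomorphy in further parameters pass from a function to its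
  derivatives and Taylor coefficients.\<close>

lemma Taylor_coefficient_has_integral:
  assumes "g holomorphic_on UNIV"
  shows "((\<lambda>t. g (w + ec t) * inverse (ec t ^ k)) has_integral ((deriv ^^ k) g w / fact k)) {0..1}"
proof -
  have "((\<lambda>u. g u / (u - w) ^ Suc k) has_contour_integral
      (2 * pi * \<i>) / fact k * (deriv ^^ k) g w) (circlepath w 1)"
    by (rule Cauchy_has_contour_integral_higher_derivative_circlepath)
      (use assms in \<open>auto intro: holomorphic_on_imp_continuous_on holomorphic_on_subset\<close>)
  then have "((\<lambda>t. g (w + ec t) / ec t ^ Suc k * (2 * pi * \<i> * ec t)) has_integral
      (2 * pi * \<i>) / fact k * (deriv ^^ k) g w) {0..1}"
    unfolding has_contour_integral_def
    by (rule has_integral_eq[rotated])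
      (simp add: vector_derivative_circlepath01, simp add: circlepath ec_def)
  from has_integral_mult_right[OF this, of "inverse (2 * pi * \<i>)"]
  show ?thesis
    by (simp add: field_simps)
qed

lemma continuous_on_case_prod:
  assumes "continuous_on UNIV (\<lambda>(x, y). F x y)" "continuous_on A f" "continuous_on A g"
  shows "continuous_on A (\<lambda>x. F (f x) (g x))"
  using continuous_on_compose2[OF assms(1), of A "\<lambda>x. (f x, g x)"] assms(2,3)
  by (simp add: continuous_on_Pair)

lemma continuous_on_integral_unit:
  fixes f :: "'a::topological_space \<Rightarrow> real \<Rightarrow> complex"
  assumes "continuous_on UNIV (\<lambda>(x, t). f x t)"
  shows "continuous_on UNIV (\<lambda>x. integral {0..1} (f x))"
  using integral_continuous_on_param[of UNIV 0 "1::real" f] continuous_on_subset[OF assms]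
  by simp

lemma deriv_eq_integral:
  assumes "g holomorphic_on UNIV"
  shows "deriv g w = integral {0..1} (\<lambda>t. g (w + ec t) * inverse (ec t))"
  using integral_unique[OF Taylor_coefficient_has_integral[OF assms, of w 1]] by simp

lemma continuous_on_deriv_param:
  fixes F :: "'a::topological_space \<Rightarrow> complex \<Rightarrow> complex"
  assumes c: "continuous_on UNIV (\<lambda>(x, z). F x z)" and h: "\<And>x. F x holomorphic_on UNIV"
  shows "continuous_on UNIV (\<lambda>(x, z). deriv (F x) z)"
proof -
  have "continuous_on UNIV (\<lambda>y. integral {0..1}
      (\<lambda>t. F (fst y) (snd y + ec t) * inverse (ec t)))"
    unfolding case_prod_unfold
    by (rule continuous_on_integral_unit)
      (auto intro!: continuous_intros continuous_on_case_prod[OF c] simp: case_prod_unfold)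
  then show ?thesis
    by (simp add: deriv_eq_integral[OF h] case_prod_unfold)
qed

text \<open>Leibniz's rule asks for a jointly continuous derivative; the Cauchy integral of the
  derivative provides it from joint continuity of \<open>F\<close>.\<close>

lemma has_field_derivative_integral_unit:
  fixes F :: "complex \<Rightarrow> real \<Rightarrow> complex"
  assumes c: "continuous_on UNIV (\<lambda>(z, t). F z t)"
    and h: "\<And>t. (\<lambda>z. F z t) holomorphic_on UNIV"
  shows "((\<lambda>z. integral {0..1} (F z)) has_field_derivative
    integral {0..1} (\<lambda>t. deriv (\<lambda>z. F z t) w)) (at w)"
proof -
  have "continuous_on UNIV (\<lambda>(t, z). F z t)"
    by (auto intro!: continuous_intros continuous_on_case_prod[OF c] simp: case_prod_unfold)
  then have c1: "continuous_on UNIV (\<lambda>(t, z). deriv (\<lambda>z. F z t) z)"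
    by (rule continuous_on_deriv_param) (rule h)
  have c2: "continuous_on UNIV (\<lambda>(z, t). deriv (\<lambda>z. F z t) z)"
    by (auto intro!: continuous_intros continuous_on_case_prod[OF c1] simp: case_prod_unfold)
  have i: "F z integrable_on {0..1}" for z
    by (intro integrable_continuous_interval
        continuous_on_case_prod[OF c] continuous_intros)
  have "((\<lambda>z. F z t) has_field_derivative deriv (\<lambda>z. F z t) z) (at z)" for z t
    using h[of t] by (simp add: holomorphic_derivI)
  from leibniz_rule_field_derivative[of UNIV 0 1 F "\<lambda>z t. deriv (\<lambda>z. F z t) z" w] this i
    continuous_on_subset[OF c2]
  show ?thesis by simp
qed

lemma holomorphic_on_integral_unit:
  fixes F :: "complex \<Rightarrow> real \<Rightarrow> complex"
  assumes "continuous_on UNIV (\<lambda>(z, t). F z t)" "\<And>t. (\<lambda>z. F z t) holomorphic_on UNIV"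
  shows "(\<lambda>z. integral {0..1} (F z)) holomorphic_on UNIV"
  using has_field_derivative_integral_unit[OF assms] by (subst holomorphic_on_open) auto

text \<open>Holomorphy is tested on complex lines so that sums, products and limits reduce to one
  variable. \<open>hol_has_derivative\<close> and \<open>holI\<close> identify this with complex
  Frechet differentiability.\<close>

definition hol :: "(complex^'m \<Rightarrow> complex) \<Rightarrow> bool" where
  "hol f \<longleftrightarrow> continuous_on UNIV f \<and> (\<forall>p v. (\<lambda>z. f (p + z *s v)) holomorphic_on UNIV)"

definition pd :: "complex^'m \<Rightarrow> (complex^'m \<Rightarrow> complex) \<Rightarrow> complex^'m \<Rightarrow> complex" where
  "pd v f p = deriv (\<lambda>z. f (p + z *s v)) 0"

lemma norm_vector_scalar_mult: "norm (c *s v) = norm c * norm v" for v :: "complex^'m"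
  by (simp add: norm_vec_def L2_set_right_distrib norm_mult)

lemma continuous_on_vector_scalar_mult [continuous_intros]:
  fixes f :: "'a::topological_space \<Rightarrow> complex" and g :: "'a \<Rightarrow> complex^'m"
  shows "continuous_on A f \<Longrightarrow> continuous_on A g \<Longrightarrow> continuous_on A (\<lambda>x. f x *s g x)"
  unfolding vector_scalar_mult_def by (intro continuous_intros)

lemma hol_continuous: "hol f \<Longrightarrow> continuous_on A f"
  by (auto simp: hol_def intro: continuous_on_subset)

lemma hol_continuous_compose:
  "hol f \<Longrightarrow> continuous_on A g \<Longrightarrow> continuous_on A (\<lambda>x. f (g x))"
  by (rule continuous_on_compose2[OF hol_continuous[of f UNIV]]) auto

lemma hol_line: "hol f \<Longrightarrow> (\<lambda>z. f (p + z *s v)) holomorphic_on A"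
  by (auto simp: hol_def intro: holomorphic_on_subset)

lemma hol_const [simp]: "hol (\<lambda>p. c)"
  by (simp add: hol_def)

lemma hol_coord [simp]: "hol (\<lambda>p. p $ i)"
  by (auto simp: hol_def intro!: continuous_intros holomorphic_intros)

lemma hol_add [intro]: "hol f \<Longrightarrow> hol g \<Longrightarrow> hol (\<lambda>p. f p + g p)"
  and hol_diff [intro]: "hol f \<Longrightarrow> hol g \<Longrightarrow> hol (\<lambda>p. f p - g p)"
  and hol_mult [intro]: "hol f \<Longrightarrow> hol g \<Longrightarrow> hol (\<lambda>p. f p * g p)"
  and hol_minus [intro]: "hol f \<Longrightarrow> hol (\<lambda>p. - f p)"
  by (auto simp: hol_def intro!: continuous_intros holomorphic_intros)

lemma hol_power [intro]: "hol f \<Longrightarrow> hol (\<lambda>p. f p ^ n)"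
  by (auto simp: hol_def intro!: continuous_intros holomorphic_intros)

lemma hol_sum [intro]: "(\<And>i. i \<in> I \<Longrightarrow> hol (f i)) \<Longrightarrow> hol (\<lambda>p. \<Sum>i\<in>I. f i p)"
  by (auto simp: hol_def intro!: continuous_intros holomorphic_intros)

lemma has_field_derivative_line:
  assumes "hol f"
  shows "((\<lambda>z. f (p + z *s v)) has_field_derivative pd v f (p + z *s v)) (at z)"
proof -
  have "((\<lambda>y. f ((p + z *s v) + y *s v)) has_field_derivative pd v f (p + z *s v)) (at 0)"
    unfolding pd_def by (rule holomorphic_derivI[OF hol_line[OF assms, of _ _ UNIV]]) auto
  then have "((\<lambda>y. f (p + (z + y) *s v)) has_field_derivative pd v f (p + z *s v)) (at 0)"
    by (simp add: algebra_simps)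
  then show ?thesis
    using DERIV_shift[of "\<lambda>y. f (p + y *s v)" _ 0 z] by (simp add: add.commute)
qed

lemma pd_eq_integral:
  "hol f \<Longrightarrow> pd v f p = integral {0..1} (\<lambda>t. f (p + ec t *s v) * inverse (ec t))"
  unfolding pd_def by (subst deriv_eq_integral) (auto intro: hol_line)

lemma continuous_on_pd:
  assumes "hol f"
  shows "continuous_on UNIV (\<lambda>(v, p). pd v f p)"
  unfolding pd_eq_integral[OF assms] case_prod_unfold
  by (rule continuous_on_integral_unit)
    (auto simp: case_prod_unfold intro!: continuous_intros hol_continuous_compose[OF assms])

lemma hol_pd [intro]:
  assumes "hol f"
  shows "hol (pd v f)"
  unfolding hol_def
proof (intro conjI allI)
  show "continuous_on UNIV (pd v f)"
    by (intro continuous_on_case_prod[OF continuous_on_pd[OF assms]] continuous_intros)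
next
  fix p w
  have "(\<lambda>z. f ((p + ec t *s v) + z *s w)) holomorphic_on UNIV" for t
    using assms by (rule hol_line)
  then show "(\<lambda>z. pd v f (p + z *s w)) holomorphic_on UNIV"
    unfolding pd_eq_integral[OF assms]
    by (intro holomorphic_on_integral_unit)
      (auto simp: case_prod_unfold algebra_simps intro!: continuous_intros hol_continuous_compose[OF assms] holomorphic_intros)
qed

text \<open>Differentiating the Cauchy integral of \<open>pd w f\<close> along \<open>v\<close>
  under the integral sign produces the Cauchy integral of \<open>pd w (pd v f)\<close>.\<close>

lemma pd_commute:
  assumes "hol f"
  shows "pd v (pd w f) p = pd w (pd v f) p"
proof -
  have l: "(\<lambda>z. f ((p + ec t *s w) + z *s v)) holomorphic_on UNIV" for t
    using assms by (rule hol_line)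
  have "((\<lambda>z. integral {0..1} (\<lambda>t. f ((p + ec t *s w) + z *s v) * inverse (ec t)))
      has_field_derivative integral {0..1}
        (\<lambda>t. deriv (\<lambda>z. f ((p + ec t *s w) + z *s v) * inverse (ec t)) 0)) (at 0)"
    by (rule has_field_derivative_integral_unit)
      (auto simp: case_prod_unfold intro!: continuous_intros hol_continuous_compose[OF assms] holomorphic_intros l)
  moreover have "deriv (\<lambda>z. f ((p + ec t *s w) + z *s v) * inverse (ec t)) 0
      = pd v f (p + ec t *s w) * inverse (ec t)" for t
    by (subst deriv_mult) (use l[of t] in
      \<open>auto simp: pd_def holomorphic_on_imp_differentiable_at\<close>)
  ultimately have "((\<lambda>z. pd w f (p + z *s v)) has_field_derivative pd w (pd v f) p) (at 0)"
    by (simp add: pd_eq_integral[OF assms, of w] pd_eq_integral[OF hol_pd[OF assms], of w]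
        algebra_simps)
  then show ?thesis
    unfolding pd_def[of v "pd w f"] by (rule DERIV_imp_deriv)
qed

lemma pd_scale: "hol f \<Longrightarrow> pd (c *s v) f p = c * pd v f p"
proof -
  assume f: "hol f"
  have "((\<lambda>z. f (p + (c * z) *s v)) has_field_derivative c * pd v f p) (at 0)"
    by (rule DERIV_cong, rule DERIV_chain2[where f="\<lambda>z. f (p + z *s v)"],
        rule has_field_derivative_line[OF f]) (auto intro!: derivative_eq_intros)
  then show ?thesis
    unfolding pd_def[of "c *s v"]
    by (intro DERIV_imp_deriv) (simp add: vector_scalar_mult_def mult_ac)
qed

text \<open>The increment of \<open>f\<close> along \<open>z (v + w)\<close> is split at
  \<open>p + z v\<close>. The part in direction \<open>v\<close> tends to \<open>pd v f p\<close> at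
  once; in direction \<open>w\<close> a mean value bound compares the increment with
  \<open>z pd w f p\<close>, and continuity of \<open>pd w f\<close> near \<open>p\<close> controls
  the error.\<close>

lemma pd_add:
  assumes "hol f"
  shows "pd (v + w) f p = pd v f p + pd w f p"
proof -
  have "((\<lambda>z. (f (p + z *s v + z *s w) - f (p + z *s v)) / z) \<longlongrightarrow> pd w f p) (at 0)"
  proof (rule LIM_I)
    fix r :: real assume r: "r > 0"
    have "continuous_on UNIV (\<lambda>(z, b). pd w f (p + z *s v + b *s w))"
      by (auto simp: case_prod_unfold intro!: continuous_intros hol_continuous_compose[OF hol_pd[OF assms]])
    then have "isCont (\<lambda>(z, b). pd w f (p + z *s v + b *s w)) (0, 0)"
      by (simp add: continuous_on_eq_continuous_at)
    then obtain d where d: "d > 0" "\<And>y. dist y (0, 0) < d \<Longrightarrow>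
        dist (pd w f (p + fst y *s v + snd y *s w)) (pd w f p) < r / 2"
      using half_gt_zero[OF r] unfolding continuous_at_eps_delta case_prod_unfold
      by (metis add.right_neutral fst_conv snd_conv vector_smult_lzero)
    show "\<exists>s>0. \<forall>x. x \<noteq> 0 \<and> norm (x - 0) < s \<longrightarrow>
      norm ((f (p + x *s v + x *s w) - f (p + x *s v)) / x - pd w f p) < r"
    proof (intro exI[of _ "d / 2"] conjI allI impI)
      fix z :: complex assume z: "z \<noteq> 0 \<and> norm (z - 0) < d / 2"
      have "norm ((f (p + z *s v + z *s w) - z * pd w f p)
          - (f (p + z *s v + 0 *s w) - 0 * pd w f p)) \<le> r / 2 * norm (z - 0)"
      proof (rule field_differentiable_bound[of "cball 0 (norm z)"
            "\<lambda>b. f (p + z *s v + b *s w) - b * pd w f p"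
            "\<lambda>b. pd w f (p + z *s v + b *s w) - pd w f p"])
        fix b assume b: "b \<in> cball (0::complex) (norm z)"
        show "((\<lambda>b. f (p + z *s v + b *s w) - b * pd w f p) has_field_derivative
            pd w f (p + z *s v + b *s w) - pd w f p) (at b within cball 0 (norm z))"
          by (rule DERIV_diff[OF DERIV_subset[OF has_field_derivative_line[OF assms]]])
            (auto intro!: derivative_eq_intros)
        have "dist (z, b) (0, 0) \<le> norm z + norm b"
          using norm_Pair_le[of z b] by (simp add: dist_norm)
        also have "\<dots> < d" using z b by (auto simp: dist_norm)
        finally show "norm (pd w f (p + z *s v + b *s w) - pd w f p) \<le> r / 2"
          using d(2)[of "(z, b)"] by (simp add: dist_norm)
      qed auto
      moreover have "(a - z * c) - (b - 0 * c) = z * ((a - b) / z - c)" for a b c :: complex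
        using z by (simp add: divide_simps algebra_simps)
      ultimately have "norm (z * ((f (p + z *s v + z *s w) - f (p + z *s v)) / z - pd w f p))
          \<le> r / 2 * norm z"
        by simp
      then have "norm ((f (p + z *s v + z *s w) - f (p + z *s v)) / z - pd w f p) \<le> r / 2"
        using z unfolding norm_mult
        by (metis mult.commute mult_le_cancel_left_pos zero_less_norm_iff)
      then show "norm ((f (p + z *s v + z *s w) - f (p + z *s v)) / z - pd w f p) < r"
        using r by linarith
    qed (use d in auto)
  qed
  moreover have "((\<lambda>z. (f (p + z *s v) - f p) / z) \<longlongrightarrow> pd v f p) (at 0)"
    using has_field_derivative_line[OF assms, of p v 0]
    by (simp add: has_field_derivative_iff)
  ultimately have "((\<lambda>z. (f (p + z *s v + z *s w) - f (p + z *s v)) / z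
      + (f (p + z *s v) - f p) / z) \<longlongrightarrow> pd w f p + pd v f p) (at 0)"
    by (rule tendsto_add)
  moreover have "((\<lambda>z. (f (p + z *s (v + w)) - f p) / z) \<longlongrightarrow> pd (v + w) f p) (at 0)"
    using has_field_derivative_line[OF assms, of p "v + w" 0]
    by (simp add: has_field_derivative_iff)
  ultimately show ?thesis
    using LIM_unique[of "\<lambda>z. (f (p + z *s (v + w)) - f p) / z" _ 0]
    by (simp add: add_divide_distrib[symmetric] vector_add_ldistrib add.commute add.left_commute)
qed

lemma pd_0_left [simp]: "pd 0 f p = 0"
  by (simp add: pd_def)

lemma pd_sum_left:
  "hol f \<Longrightarrow> pd (\<Sum>i\<in>I. v i) f p = (\<Sum>i\<in>I. pd (v i) f p)"
  by (induction I rule: infinite_finite_induct) (auto simp: pd_add)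

lemma pd_expand: "hol f \<Longrightarrow> pd v f p = (\<Sum>i\<in>UNIV. v $ i * pd (axis i 1) f p)"
  by (subst basis_expansion[symmetric, of v]) (simp add: pd_sum_left pd_scale)

text \<open>Osgood's lemma: continuity and holomorphy on complex lines give Frechet differentiability.\<close>

lemma hol_has_derivative:
  assumes f: "hol f"
  shows "(f has_derivative (\<lambda>v. pd v f p)) (at p)"
  unfolding has_derivative_at_alt
proof (intro conjI allI impI)
  show "bounded_linear (\<lambda>v. pd v f p)"
    by (subst ext[OF pd_expand[OF f]], intro bounded_linear_sum bounded_linear_compose[OF bounded_linear_mult_left]
        bounded_linear_vec_nth)
next
  fix e :: real assume e: "e > 0"
  let ?c = "real CARD('a)"
  have "\<exists>d>0. \<forall>q. dist q p < d \<longrightarrow> dist (pd (axis i 1) f q) (pd (axis i 1) f p) < e / ?c" for i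
    using hol_continuous[OF hol_pd[OF f, of "axis i 1"], of UNIV] e
    by (simp add: continuous_on_eq_continuous_at continuous_at_eps_delta)
  then obtain d where d: "\<And>i. d i > 0"
    "\<And>i q. dist q p < d i \<Longrightarrow> dist (pd (axis i 1) f q) (pd (axis i 1) f p) < e / ?c"
    by metis
  define D where "D = Min (range d)"
  have D: "D > 0" "\<And>i. D \<le> d i"
    unfolding D_def using d(1) by (auto simp: Min_gr_iff)
  have near: "norm (pd v f q - pd v f p) \<le> e * norm v" if "dist q p < D" for v q
  proof -
    have "norm (pd v f q - pd v f p)
        = norm (\<Sum>i\<in>UNIV. v $ i * (pd (axis i 1) f q - pd (axis i 1) f p))"
      by (simp add: pd_expand[OF f, of v] sum_subtractf[symmetric] algebra_simps)
    also have "\<dots> \<le> (\<Sum>i\<in>(UNIV::'a set). norm v * (e / ?c))"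
    proof (rule sum_norm_le)
      fix i
      have "norm (pd (axis i 1) f q - pd (axis i 1) f p) \<le> e / ?c"
        using d(2)[of q i] that D(2)[of i] by (simp add: dist_norm less_imp_le)
      then show "norm (v $ i * (pd (axis i 1) f q - pd (axis i 1) f p)) \<le> norm v * (e / ?c)"
        unfolding norm_mult by (intro mult_mono) (auto simp: Finite_Cartesian_Product.norm_nth_le)
    qed
    also have "\<dots> = e * norm v" by simp
    finally show ?thesis .
  qed
  show "\<exists>d>0. \<forall>y. norm (y - p) < d \<longrightarrow> norm (f y - f p - pd (y - p) f p) \<le> e * norm (y - p)"
  proof (intro exI[of _ D] conjI allI impI)
    fix y assume y: "norm (y - p) < D"
    define v where "v = y - p"
    have "norm ((f (p + 1 *s v) - 1 * pd v f p) - (f (p + 0 *s v) - 0 * pd v f p))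
        \<le> (e * norm v) * norm (1 - (0::complex))"
    proof (rule field_differentiable_bound[of "cball 0 1" "\<lambda>z. f (p + z *s v) - z * pd v f p"
          "\<lambda>z. pd v f (p + z *s v) - pd v f p"])
      fix z assume z: "z \<in> cball (0::complex) 1"
      show "((\<lambda>z. f (p + z *s v) - z * pd v f p) has_field_derivative
          pd v f (p + z *s v) - pd v f p) (at z within cball 0 1)"
        by (rule DERIV_diff[OF DERIV_subset[OF has_field_derivative_line[OF f]]])
          (auto intro!: derivative_eq_intros)
      have "norm (z *s v) = norm z * norm v"
        by (rule norm_vector_scalar_mult)
      also have "\<dots> \<le> 1 * norm v"
        using z by (intro mult_right_mono) auto
      finally have "dist (p + z *s v) p < D"
        using y by (simp add: dist_norm v_def)
      then show "norm (pd v f (p + z *s v) - pd v f p) \<le> e * norm v"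
        by (rule near)
    qed auto
    then show "norm (f y - f p - pd (y - p) f p) \<le> e * norm (y - p)"
      by (simp add: v_def algebra_simps)
  qed (rule D)
qed

lemma holI:
  assumes "\<And>p. \<exists>f'. (f has_derivative f') (at p) \<and> (\<forall>c v. f' (c *s v) = c * f' v)"
  shows "hol f"
  unfolding hol_def
proof (intro conjI allI)
  show "continuous_on UNIV f"
    using assms by (meson continuous_at_imp_continuous_on has_derivative_continuous)
next
  fix p v
  have "\<exists>d. ((\<lambda>z. f (p + z *s v)) has_field_derivative d) (at z)" for z
  proof -
    obtain f' where f': "(f has_derivative f') (at (p + z *s v))" "\<And>c v. f' (c *s v) = c * f' v"
      using assms by metis
    have l: "bounded_linear (\<lambda>z. z *s v)"
      by (auto simp: linear_conv_bounded_linear[symmetric] algebra_simps vec_eq_iff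
          intro!: linearI)
    have "((\<lambda>z. f (p + z *s v)) has_derivative (\<lambda>h. f' (h *s v))) (at z)"
      by (rule has_derivative_compose[of "\<lambda>z. p + z *s v" "\<lambda>h. h *s v" z UNIV f f'])
        (use f' in \<open>auto intro!: derivative_eq_intros bounded_linear.has_derivative[OF l]\<close>)
    then show ?thesis
      unfolding has_field_derivative_def f'(2) by (auto simp: mult.commute[of _ "f' v"])
  qed
  then show "(\<lambda>z. f (p + z *s v)) holomorphic_on UNIV"
    by (subst holomorphic_on_open) auto
qed

lemma pd_unique:
  assumes "hol f" "(f has_derivative f') (at p)"
  shows "pd v f p = f' v"
  using has_derivative_unique[OF hol_has_derivative[OF assms(1)] assms(2)] by metis

lemma pd_const [simp]: "pd v (\<lambda>p. c) p = 0"
  by (simp add: pd_def)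

lemma pd_coord [simp]: "pd v (\<lambda>p. p $ i) p = v $ i"
  by (rule pd_unique) (auto intro: bounded_linear_imp_has_derivative bounded_linear_vec_nth)

lemma pd_plus: "hol f \<Longrightarrow> hol g \<Longrightarrow> pd v (\<lambda>p. f p + g p) p = pd v f p + pd v g p"
  by (rule pd_unique[OF hol_add has_derivative_add[OF hol_has_derivative hol_has_derivative]])

lemma pd_diff: "hol f \<Longrightarrow> hol g \<Longrightarrow> pd v (\<lambda>p. f p - g p) p = pd v f p - pd v g p"
  by (rule pd_unique[OF hol_diff has_derivative_diff[OF hol_has_derivative hol_has_derivative]])

lemma pd_mult: "hol f \<Longrightarrow> hol g \<Longrightarrow> pd v (\<lambda>p. f p * g p) p = pd v f p * g p + f p * pd v g p"
  by (subst pd_unique[OF hol_mult has_derivative_mult[OF hol_has_derivative hol_has_derivative]])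
    simp_all

lemma pd_sum:
  "(\<And>i. i \<in> I \<Longrightarrow> hol (f i)) \<Longrightarrow> pd v (\<lambda>p. \<Sum>i\<in>I. f i p) p = (\<Sum>i\<in>I. pd v (f i) p)"
  by (rule pd_unique[OF hol_sum has_derivative_sum[OF hol_has_derivative]])

lemma hol_suminf:
  assumes f: "\<And>k. hol (f k)"
    and M: "\<And>r. \<exists>M. summable M \<and> (\<forall>k. \<forall>p\<in>cball 0 r. norm (f k p) \<le> M k)"
  shows "hol (\<lambda>p. \<Sum>k. f k p)"
proof -
  have u: "uniform_limit (cball 0 r) (\<lambda>n p. \<Sum>k<n. f k p) (\<lambda>p. \<Sum>k. f k p) sequentially" for r
  proof -
    obtain M where "summable M" "\<And>k p. p \<in> cball 0 r \<Longrightarrow> norm (f k p) \<le> M k"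
      using assms(2)[of r] by metis
    then show ?thesis by (intro Weierstrass_m_test)
  qed
  have "continuous_on (cball 0 r) (\<lambda>p. \<Sum>k. f k p)" for r
    by (rule uniform_limit_theorem[OF _ u])
      (auto intro!: always_eventually continuous_on_sum hol_continuous f)
  then have "isCont (\<lambda>p. \<Sum>k. f k p) p" for p
    by (rule continuous_on_interior[of "cball 0 (norm p + 1)"]) simp
  then have c: "continuous_on UNIV (\<lambda>p. \<Sum>k. f k p)"
    by (simp add: continuous_at_imp_continuous_on)
  have "(\<lambda>z. \<Sum>k. f k (p + z *s v)) holomorphic_on ball 0 R" for p v R
  proof -
    define r where "r = norm p + R * norm v"
    have "p + z *s v \<in> cball 0 r" if "z \<in> cball 0 R" for z
    proof -
      have "norm (z *s v) = norm z * norm v"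
        by (rule norm_vector_scalar_mult)
      then have "norm (z *s v) \<le> R * norm v"
        using that by (auto intro: mult_right_mono)
      then show ?thesis
        using norm_triangle_ineq[of p "z *s v"] by (simp add: r_def)
    qed
    then have "uniform_limit (cball 0 R) (\<lambda>n z. \<Sum>k<n. f k (p + z *s v))
        (\<lambda>z. \<Sum>k. f k (p + z *s v)) sequentially"
      by (intro uniform_limit_compose'[OF u[of r]]) auto
    moreover have "(\<lambda>z. \<Sum>k<n. f k (p + z *s v)) holomorphic_on A" for n A
      by (intro holomorphic_on_sum hol_line f)
    ultimately show ?thesis
      using holomorphic_uniform_limit[of 0 R "\<lambda>n z. \<Sum>k<n. f k (p + z *s v)" sequentially
          "\<lambda>z. \<Sum>k. f k (p + z *s v)"]
      by (auto simp: holomorphic_on_imp_continuous_on)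
  qed
  then have "(\<lambda>z. \<Sum>k. f k (p + z *s v)) holomorphic_on (\<Union>R\<in>UNIV. ball 0 R)" for p v
    by (intro holomorphic_on_UN_open) auto
  moreover have "(\<Union>R\<in>UNIV. ball (0::complex) R) = UNIV"
    using gt_ex by fastforce
  ultimately show ?thesis
    using c by (auto simp: hol_def)
qed

section \<open>Weighted Taylor coefficients\<close>

definition dil :: "complex \<Rightarrow> complex^3 \<Rightarrow> complex^3" where
  "dil t p = vector [t * p$1, t^2 * p$2, t^3 * p$3]"

lemma dil_nth [simp]: "dil t p $ 1 = t * p$1" "dil t p $ 2 = t^2 * p$2" "dil t p $ 3 = t^3 * p$3"
  by (simp_all add: dil_def)

lemma dil_dil [simp]: "dil s (dil t p) = dil (s * t) p"
  and dil_1 [simp]: "dil 1 p = p"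
  and dil_0 [simp]: "dil 0 p = 0"
  and dil_at_0 [simp]: "dil t 0 = 0"
  by (simp_all add: vec_eq_iff forall_3 power_mult_distrib)

lemma dil_line: "dil t (p + z *s v) = dil t p + z *s dil t v"
  by (simp add: vec_eq_iff forall_3 algebra_simps)

lemma continuous_on_dil [continuous_intros]:
  assumes "continuous_on A f" "continuous_on A g"
  shows "continuous_on A (\<lambda>x. dil (f x) (g x))"
proof -
  have "dil (f x) (g x) = (\<chi> i. if i = 1 then f x * g x $ 1 else
      if i = 2 then f x ^ 2 * g x $ 2 else f x ^ 3 * g x $ 3)" for x
    by (simp add: vec_eq_iff forall_3)
  moreover have "continuous_on A (\<lambda>x. \<chi> i::3. if i = 1 then f x * g x $ 1 else
      if i = 2 then f x ^ 2 * g x $ 2 else f x ^ 3 * g x $ 3)"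
  proof (rule continuous_on_vec_lambda)
    fix i :: 3
    show "continuous_on A (\<lambda>x. if i = 1 then f x * g x $ 1 else
      if i = 2 then f x ^ 2 * g x $ 2 else f x ^ 3 * g x $ 3)"
      by (cases "i = 1"; cases "i = 2") (simp_all add: assms continuous_intros)
  qed
  ultimately show ?thesis by simp
qed

lemma has_field_derivative_dil:
  assumes "hol f"
  shows "((\<lambda>t. f (dil t p)) has_field_derivative
    pd (vector [p$1, 2 * t * p$2, 3 * t^2 * p$3]) f (dil t p)) (at t)"
proof -
  define d :: "complex^3" where "d = vector [p$1, 2 * t * p$2, 3 * t^2 * p$3]"
  have l: "bounded_linear (\<lambda>z::complex. z *s (v::complex^3))" for v
    by (auto simp: linear_conv_bounded_linear[symmetric] algebra_simps vec_eq_iff intro!: linearI)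
  have s: "((\<lambda>t. c t *s v) has_derivative (\<lambda>h. c' h *s v)) (at t)"
    if "(c has_derivative c') (at t)" for c c' and v :: "complex^3"
    using bounded_linear.has_derivative[OF l that] .
  have "((\<lambda>t. t *s axis (1::3) (p$1) + t^2 *s axis 2 (p$2) + t^3 *s axis 3 (p$3)) has_derivative
      (\<lambda>h. h *s axis 1 (p$1) + (2 * t * h) *s axis 2 (p$2) + (3 * t^2 * h) *s axis 3 (p$3))) (at t)"
    by (intro has_derivative_add s) (auto intro!: derivative_eq_intros simp: power2_eq_square)
  moreover have "(\<lambda>t. t *s axis (1::3) (p$1) + t^2 *s axis 2 (p$2) + t^3 *s axis 3 (p$3)) = (\<lambda>t. dil t p)"
    by (simp add: fun_eq_iff vec_eq_iff forall_3 axis_def)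
  moreover have "(\<lambda>h. h *s axis (1::3) (p$1) + (2 * t * h) *s axis 2 (p$2) + (3 * t^2 * h) *s axis 3 (p$3))
      = (\<lambda>h. h *s d)"
    by (simp add: fun_eq_iff vec_eq_iff forall_3 axis_def d_def)
  ultimately have "((\<lambda>t. dil t p) has_derivative (\<lambda>h. h *s d)) (at t)"
    by simp
  then have "((\<lambda>t. f (dil t p)) has_derivative (\<lambda>h. pd (h *s d) f (dil t p))) (at t)"
    by (intro has_derivative_compose[OF _ hol_has_derivative[OF assms]]) simp
  then show ?thesis
    unfolding has_field_derivative_def d_def[symmetric]
    by (simp add: pd_scale[OF assms] mult.commute[of _ "pd d f (dil t p)"])
qed

lemma holomorphic_dil: "hol f \<Longrightarrow> (\<lambda>t. f (dil t p)) holomorphic_on A"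
  unfolding holomorphic_on_def field_differentiable_def
  using has_field_derivative_dil has_field_derivative_at_within by blast

definition Ef :: "(complex^3 \<Rightarrow> complex) \<Rightarrow> complex^3 \<Rightarrow> complex" where
  "Ef f p = pd (E_vf p) f p"

lemma Ef_dil:
  assumes "hol f"
  shows "Ef f (dil t p) = t * deriv (\<lambda>t. f (dil t p)) t"
proof -
  have "E_vf (dil t p) = t *s vector [p$1, 2 * t * p$2, 3 * t^2 * p$3]"
    by (simp add: E_vf_def vec_eq_iff forall_3 power2_eq_square power3_eq_cube)
  then show ?thesis
    by (simp add: Ef_def pd_scale[OF assms] DERIV_imp_deriv[OF has_field_derivative_dil[OF assms]])
qed

text \<open>The weighted homogeneous component of \<open>f\<close> of degree \<open>k\<close>, for
  the weights 1, 2, 3 of the coordinates.\<close>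

definition cf :: "nat \<Rightarrow> (complex^3 \<Rightarrow> complex) \<Rightarrow> complex^3 \<Rightarrow> complex" where
  "cf k f p = (deriv ^^ k) (\<lambda>t. f (dil t p)) 0 / fact k"

lemma has_fps_expansion_dil:
  assumes "hol f"
  shows "(\<lambda>t. f (dil t p)) has_fps_expansion Abs_fps (\<lambda>k. cf k f p)"
proof -
  have "(\<lambda>t. f (dil t p)) has_fps_expansion fps_expansion (\<lambda>t. f (dil t p)) 0"
    by (rule has_fps_expansion_fps_expansion[of UNIV]) (auto intro: holomorphic_dil assms)
  then show ?thesis
    by (simp add: fps_expansion_def cf_def)
qed

lemma cf_eq_fps_nth: "(\<lambda>t. f (dil t p)) has_fps_expansion F \<Longrightarrow> cf k f p = fps_nth F k"
  unfolding cf_def by (rule fps_nth_fps_expansion[symmetric])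

lemma cf_sums:
  assumes "hol f"
  shows "(\<lambda>k. cf k f p * t ^ k) sums f (dil t p)"
  using holomorphic_power_series[of "\<lambda>t. f (dil t p)" 0 "norm t + 1" t]
  by (simp add: holomorphic_dil assms cf_def)

text \<open>Convergence for every \<open>t\<close> forces a positive radius of convergence, and then
  the coefficients are determined by the function.\<close>

lemma cf_eqI:
  assumes "\<And>t. (\<lambda>k. a k * t ^ k) sums f (dil t p)"
  shows "cf k f p = a k"
proof -
  have "ereal (norm t) \<le> fps_conv_radius (Abs_fps a)" for t :: complex
    unfolding fps_conv_radius_def
    by (rule conv_radius_geI) (use assms[of t] in \<open>auto simp: sums_iff\<close>)
  from this[of 1] have "0 < fps_conv_radius (Abs_fps a)"
    by (rule less_le_trans[rotated]) simp
  then have "(\<lambda>t. f (dil t p)) has_fps_expansion Abs_fps a"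
    using assms by (auto simp: has_fps_expansion_def eval_fps_def sums_iff)
  then show ?thesis
    by (simp add: cf_eq_fps_nth)
qed

lemma cf_0 [simp]: "cf 0 f p = f 0"
  by (simp add: cf_def)

lemma cf_const: "cf k (\<lambda>p. c) p = (if k = 0 then c else 0)"
proof (rule cf_eqI)
  fix t :: complex
  have "(\<lambda>k. (if k = 0 then c else 0) * t ^ k) = (\<lambda>k. if k = 0 then c * t ^ k else 0)"
    by auto
  then show "(\<lambda>k. (if k = 0 then c else 0) * t ^ k) sums c"
    using sums_single[of 0 "\<lambda>k. c * t ^ k"] by simp
qed

lemma cf_add: "hol f \<Longrightarrow> hol g \<Longrightarrow> cf k (\<lambda>p. f p + g p) p = cf k f p + cf k g p"
  by (rule cf_eqI) (auto simp: distrib_right intro!: sums_add cf_sums)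

lemma cf_diff: "hol f \<Longrightarrow> hol g \<Longrightarrow> cf k (\<lambda>p. f p - g p) p = cf k f p - cf k g p"
  by (rule cf_eqI) (auto simp: left_diff_distrib intro!: sums_diff cf_sums)

lemma cf_sum:
  "(\<And>i. i \<in> I \<Longrightarrow> hol (f i)) \<Longrightarrow> cf k (\<lambda>p. \<Sum>i\<in>I. f i p) p = (\<Sum>i\<in>I. cf k (f i) p)"
  by (rule cf_eqI) (auto simp: sum_distrib_right intro!: sums_sum cf_sums)

lemma cf_mult:
  assumes "hol f" "hol g"
  shows "cf k (\<lambda>p. f p * g p) p = (\<Sum>i\<le>k. cf i f p * cf (k - i) g p)"
  using cf_eq_fps_nth[OF has_fps_expansion_mult[OF has_fps_expansion_dil[OF assms(1)]
        has_fps_expansion_dil[OF assms(2)]]]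
  by (simp add: fps_mult_nth atMost_atLeast0)

lemma cf_cmult: "hol f \<Longrightarrow> cf k (\<lambda>p. c * f p) p = c * cf k f p"
  by (rule cf_eqI) (auto simp: mult.assoc intro!: sums_mult cf_sums)

lemma cf_Ef:
  assumes "hol f"
  shows "cf k (Ef f) p = of_nat k * cf k f p"
proof -
  have "(\<lambda>t. t * deriv (\<lambda>t. f (dil t p)) t) has_fps_expansion
      fps_X * fps_deriv (Abs_fps (\<lambda>k. cf k f p))"
    by (intro has_fps_expansion_mult has_fps_expansion_fps_X has_fps_expansion_deriv
        has_fps_expansion_dil assms)
  then have "(\<lambda>t. Ef f (dil t p)) has_fps_expansion fps_X * fps_deriv (Abs_fps (\<lambda>k. cf k f p))"
    by (simp add: Ef_dil[OF assms])
  from cf_eq_fps_nth[OF this] show ?thesis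
    by (cases k) (simp_all del: of_nat_Suc)
qed

lemma cf_dil: "hol f \<Longrightarrow> cf k f (dil t p) = cf k f p * t ^ k"
proof (rule cf_eqI)
  fix s :: complex assume "hol f"
  from cf_sums[OF this, of p "s * t"]
  show "(\<lambda>k. cf k f p * t ^ k * s ^ k) sums f (dil s (dil t p))"
    by (simp add: power_mult_distrib mult_ac)
qed

lemma cf_cf: "hol f \<Longrightarrow> cf j (cf k f) p = (if j = k then cf k f p else 0)"
proof (rule cf_eqI)
  fix t :: complex
  assume "hol f"
  moreover have "(\<lambda>j. (if j = k then cf k f p else 0) * t ^ j)
      = (\<lambda>j. if j = k then cf k f p * t ^ j else 0)"
    by auto
  ultimately show "(\<lambda>j. (if j = k then cf k f p else 0) * t ^ j) sums cf k f (dil t p)"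
    using sums_single[of k "\<lambda>j. cf k f p * t ^ j"] by (simp add: cf_dil)
qed

lemma cf_ext:
  assumes "hol f" "hol g" "\<And>k. cf k f p = cf k g p"
  shows "f p = g p"
  using cf_sums[OF assms(1), of p 1] cf_sums[OF assms(2), of p 1] assms(3)
  by (auto intro: sums_unique2)

lemma hol_cf [intro]:
  assumes "hol f"
  shows "hol (cf k f)"
proof -
  have eq: "cf k f p = integral {0..1} (\<lambda>t. f (dil (ec t) p) * inverse (ec t ^ k))" for p
    using integral_unique[OF Taylor_coefficient_has_integral[OF holomorphic_dil[OF assms, of p], of 0 k]]
    by (simp add: cf_def)
  show ?thesis
    unfolding hol_def
  proof (intro conjI allI)
    show "continuous_on UNIV (cf k f)"
      unfolding eq[abs_def]
      by (rule continuous_on_integral_unit)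
        (auto simp: case_prod_unfold intro!: continuous_intros hol_continuous_compose[OF assms])
  next
    fix p v :: "complex^3"
    show "(\<lambda>z. cf k f (p + z *s v)) holomorphic_on UNIV"
      unfolding eq
      by (rule holomorphic_on_integral_unit)
        (auto simp: case_prod_unfold dil_line intro!: continuous_intros
          hol_continuous_compose[OF assms] holomorphic_intros hol_line[OF assms])
  qed
qed

text \<open>Cauchy's inequality on the circle of radius 2 in \<open>t\<close>. A radius above 1 is
  what matters: the ratio 1/2 leaves room for the ratio 3/4 of the solution in
  \<open>nonresonant_solution\<close>.\<close>

lemma cf_bound:
  assumes "hol f"
  shows "\<exists>M\<ge>0. \<forall>k. \<forall>p\<in>cball 0 r. norm (cf k f p) \<le> M / 2 ^ k"
proof -
  have "compact ((\<lambda>x. f (dil (fst x) (snd x))) ` (cball 0 2 \<times> cball 0 r))"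
    by (intro compact_continuous_image compact_Times hol_continuous_compose[OF assms]
        continuous_intros) auto
  then obtain M where M: "M > 0"
    "\<And>t p. norm t \<le> 2 \<Longrightarrow> norm p \<le> r \<Longrightarrow> norm (f (dil t p)) \<le> M"
    by (auto dest!: compact_imp_bounded simp: bounded_pos)
  have "norm (cf k f p) \<le> M / 2 ^ k" if "p \<in> cball 0 r" for k p
  proof -
    have "norm ((deriv ^^ k) (\<lambda>t. f (dil t p)) 0) \<le> fact k * M / 2 ^ k"
      by (rule Cauchy_inequality)
        (use M that in \<open>auto intro: holomorphic_dil assms holomorphic_on_imp_continuous_on\<close>)
    then show ?thesis
      by (simp add: cf_def norm_divide field_simps)
  qed
  then show ?thesis using M by (intro exI[of _ M]) auto
qed

section \<open>Complex matrices and polynomial actions\<close>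

type_synonym 'n cmat = "complex^'n^'n"

text \<open>The norm of a nested vector is the Euclidean norm of all entries, and Cauchy-Schwarz in
  each row gives the constant 1. The bounds for \<open>k0\<close> and the Gronwall rates rest on
  it.\<close>

lemma norm_matrix_mult:
  fixes A :: "complex^'n^'m" and B :: "complex^'k^'n"
  shows "norm (A ** B) \<le> norm A * norm B"
proof -
  have row: "norm ((A ** B) $ i) \<le> norm B * norm (A $ i)" for i
  proof -
    have "(A ** B) $ i = (\<Sum>k\<in>UNIV. A $ i $ k *s B $ k)"
      by (simp add: vec_eq_iff matrix_matrix_mult_def sum_component)
    then have "norm ((A ** B) $ i) \<le> (\<Sum>k\<in>UNIV. \<bar>norm (A $ i $ k)\<bar> * \<bar>norm (B $ k)\<bar>)"
      by (simp add: sum_norm_le norm_vector_scalar_mult)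
    also have "\<dots> \<le> norm (A $ i) * norm B"
      using L2_set_mult_ineq unfolding norm_vec_def[of B] norm_vec_def[of "A $ i"] .
    finally show ?thesis by (simp add: mult.commute)
  qed
  have "norm (A ** B) \<le> L2_set (\<lambda>i. norm B * norm (A $ i)) UNIV"
    unfolding norm_vec_def[of "A ** B"] by (rule L2_set_mono) (auto simp: row)
  also have "\<dots> = norm A * norm B"
    by (subst L2_set_right_distrib[symmetric]) (auto simp: norm_vec_def[of A] mult.commute)
  finally show ?thesis .
qed

lemma matrix_sub_ldistrib: "A ** (B - C) = A ** B - A ** C" for A :: "'n::finite cmat"
  by (simp add: vec_eq_iff matrix_matrix_mult_def right_diff_distrib sum_subtractf)

lemma matrix_sub_rdistrib: "(B - C) ** A = B ** A - C ** A" for A :: "'n::finite cmat"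
  by (simp add: vec_eq_iff matrix_matrix_mult_def left_diff_distrib sum_subtractf)

lemma matrix_add_rdistrib': "(B + C) ** A = B ** A + C ** A" for A :: "'n::finite cmat"
  by (simp add: vec_eq_iff matrix_matrix_mult_def distrib_right sum.distrib)

lemma matrix_uminus: "(- B) ** A = - (B ** A)" "A ** (- B) = - (A ** B)" for A :: "'n::finite cmat"
  by (simp_all add: vec_eq_iff matrix_matrix_mult_def sum_negf)

lemma bounded_bilinear_mm: "bounded_bilinear ((**) :: 'n::finite cmat \<Rightarrow> 'n cmat \<Rightarrow> 'n cmat)"
proof
  show "\<exists>K. \<forall>a b. norm ((a :: 'n cmat) ** (b :: 'n cmat)) \<le> norm a * norm b * K"
    by (intro exI[of _ 1]) (simp add: norm_matrix_mult)
qed (simp_all add: matrix_add_ldistrib matrix_add_rdistrib',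
    simp_all add: vec_eq_iff matrix_matrix_mult_def scaleR_sum_right)

interpretation mm: bounded_bilinear "(**) :: 'n::finite cmat \<Rightarrow> 'n cmat \<Rightarrow> 'n cmat"
  by (rule bounded_bilinear_mm)

lemmas mring = matrix_add_ldistrib matrix_add_rdistrib' matrix_sub_ldistrib matrix_sub_rdistrib
  matrix_uminus matrix_mul_assoc[symmetric]

lemma cscale_nth [simp]: "(c *\<^sub>C M) $ i $ j = c * M $ i $ j"
  by (simp add: cscale_def)

lemma cscale_simps [simp]:
  "1 *\<^sub>C M = M" "0 *\<^sub>C M = 0" "c *\<^sub>C 0 = 0" "c *\<^sub>C d *\<^sub>C M = (c * d) *\<^sub>C M"
  "(- c) *\<^sub>C M = - (c *\<^sub>C M)" "c *\<^sub>C (- M) = - (c *\<^sub>C M)"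
  by (simp_all add: vec_eq_iff)

lemma cscale_distrib:
  "c *\<^sub>C (M + N) = c *\<^sub>C M + c *\<^sub>C N" "(c + d) *\<^sub>C M = c *\<^sub>C M + d *\<^sub>C M"
  "c *\<^sub>C (M - N) = c *\<^sub>C M - c *\<^sub>C N" "(c - d) *\<^sub>C M = c *\<^sub>C M - d *\<^sub>C M"
  by (simp_all add: vec_eq_iff algebra_simps)

lemma cscale_mm [simp]: "(c *\<^sub>C A) ** B = c *\<^sub>C (A ** B)" "A ** (c *\<^sub>C B) = c *\<^sub>C (A ** B)"
  by (simp_all add: vec_eq_iff matrix_matrix_mult_def sum_distrib_left algebra_simps)

lemma cscale_of_real: "of_real r *\<^sub>C M = r *\<^sub>R M"
  by (simp add: vec_eq_iff scaleR_conv_of_real[where 'a=complex])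

lemma cscale_scaleR: "c *\<^sub>C (r *\<^sub>R M) = r *\<^sub>R (c *\<^sub>C M)"
  by (simp add: vec_eq_iff)

lemma norm_cscale [simp]: "norm (c *\<^sub>C M) = norm c * norm M"
proof -
  have "norm ((c *\<^sub>C M) $ i) = norm c * norm (M $ i)" for i
    by (simp add: norm_vec_def L2_set_right_distrib norm_mult)
  then show ?thesis
    by (simp add: norm_vec_def[of "c *\<^sub>C M"] norm_vec_def[of M] L2_set_right_distrib)
qed

lemma cscale_sum: "c *\<^sub>C (\<Sum>i\<in>I. f i) = (\<Sum>i\<in>I. c *\<^sub>C f i)"
  by (simp add: vec_eq_iff sum_distrib_left)

lemma cscale_eq_0_iff [simp]: "c *\<^sub>C M = 0 \<longleftrightarrow> c = 0 \<or> M = 0"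
  by (auto simp: vec_eq_iff)

section \<open>Complex-linear operators on matrices and their polynomials\<close>

definition clin :: "('n cmat \<Rightarrow> 'n::finite cmat) \<Rightarrow> bool" where
  "clin T \<longleftrightarrow> (\<forall>X Y. T (X + Y) = T X + T Y) \<and> (\<forall>c X. T (c *\<^sub>C X) = c *\<^sub>C T X)"

lemma clinI: "(\<And>X Y. T (X + Y) = T X + T Y) \<Longrightarrow> (\<And>c X. T (c *\<^sub>C X) = c *\<^sub>C T X) \<Longrightarrow> clin T"
  by (simp add: clin_def)

lemma clinD:
  assumes "clin T"
  shows "T (X + Y) = T X + T Y" "T (c *\<^sub>C X) = c *\<^sub>C T X" "T 0 = 0" "T (- X) = - T X"
    "T (X - Y) = T X - T Y" "T (r *\<^sub>R X) = r *\<^sub>R T X"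
proof -
  show a: "T (X + Y) = T X + T Y" "T (c *\<^sub>C X) = c *\<^sub>C T X" for X Y c
    using assms by (auto simp: clin_def)
  show "T 0 = 0" using a(2)[of 0 0] by simp
  show m: "T (- X) = - T X" for X using a(2)[of "-1" X] by simp
  show "T (X - Y) = T X - T Y" using a(1)[of X "- Y"] by (simp add: m)
  show "T (r *\<^sub>R X) = r *\<^sub>R T X" using a(2)[of "of_real r" X] by (simp add: cscale_of_real)
qed

lemma clin_linear: "clin T \<Longrightarrow> linear T"
  by (auto intro!: linearI simp: clinD)

lemma clin_sum: "clin T \<Longrightarrow> T (\<Sum>i\<in>I. f i) = (\<Sum>i\<in>I. T (f i))"
  by (rule linear_sum[OF clin_linear])

lemma clin_mult_left [simp]: "clin ((**) M)"
  and clin_mult_right [simp]: "clin (\<lambda>X. X ** M)"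
  by (auto intro!: clinI simp: mring)

lemma clin_cscale [simp]: "clin (\<lambda>X. c *\<^sub>C X)"
  by (auto intro!: clinI simp: cscale_distrib mult.commute)

lemma clin_diff: "clin S \<Longrightarrow> clin T \<Longrightarrow> clin (\<lambda>X. S X - T X)"
  by (auto intro!: clinI simp: clinD cscale_distrib)

lemma clin_funpow: "clin T \<Longrightarrow> clin (T ^^ n)"
  by (induction n) (auto intro!: clinI simp: clinD)

definition pact :: "complex poly \<Rightarrow> ('n cmat \<Rightarrow> 'n::finite cmat) \<Rightarrow> 'n cmat \<Rightarrow> 'n cmat" where
  "pact p T X = fold_coeffs (\<lambda>a Y. a *\<^sub>C X + T Y) p 0"

lemma pact_0 [simp]: "pact 0 T X = 0"
  by (simp add: pact_def)

lemma pact_pCons: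
  assumes "clin T"
  shows "pact (pCons a p) T X = a *\<^sub>C X + T (pact p T X)"
  by (cases "p = 0"; cases "a = 0") (simp_all add: pact_def clinD[OF assms])

lemma pact_add:
  assumes "clin T"
  shows "pact (p + q) T X = pact p T X + pact q T X"
  by (induction p q rule: poly_induct2)
    (simp_all add: pact_pCons[OF assms] clinD[OF assms] cscale_distrib)

lemma pact_smult:
  assumes "clin T"
  shows "pact (smult c p) T X = c *\<^sub>C pact p T X"
  by (induction p) (simp_all add: pact_pCons[OF assms] clinD[OF assms] cscale_distrib)

lemma pact_clin:
  assumes "clin T"
  shows "clin (pact p T)"
  by (induction p)
    (auto intro!: clinI simp: pact_pCons[OF assms] clinD[OF assms] clinD cscale_distrib mult.commute)

lemma pact_minus: "clin T \<Longrightarrow> pact (- p) T X = - pact p T X"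
  using pact_smult[of T "-1" p X] by simp

lemma pact_diff: "clin T \<Longrightarrow> pact (p - q) T X = pact p T X - pact q T X"
  using pact_add[of T p "- q" X] by (simp add: pact_minus)

lemma pact_sum: "clin T \<Longrightarrow> pact (\<Sum>i\<in>I. p i) T X = (\<Sum>i\<in>I. pact (p i) T X)"
  by (induction I rule: infinite_finite_induct) (simp_all add: pact_add)

lemma pact_mult:
  assumes "clin T"
  shows "pact (p * q) T X = pact p T (pact q T X)"
  by (induction p) (simp_all add: pact_pCons[OF assms] pact_add[OF assms] pact_smult[OF assms]
      clinD[OF pact_clin[OF assms]])

lemma pact_const: "clin T \<Longrightarrow> pact [:c:] T X = c *\<^sub>C X"
  by (simp add: pact_pCons clinD)

lemma pact_1: "clin T \<Longrightarrow> pact 1 T X = X"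
  using pact_const[of T 1 X] by (simp add: one_pCons)

lemma pact_linear: "clin T \<Longrightarrow> pact [:-c, 1:] T X = T X - c *\<^sub>C X"
  by (simp add: pact_pCons clinD)

lemma pact_monom: "clin T \<Longrightarrow> pact (monom c n) T X = c *\<^sub>C (T ^^ n) X"
  by (induction n) (simp_all add: monom_0 monom_Suc pact_const pact_pCons clinD)

lemma pact_in:
  assumes "clin T" "X \<in> W" "\<And>Y. Y \<in> W \<Longrightarrow> T Y \<in> W" "0 \<in> W"
    "\<And>c Y. Y \<in> W \<Longrightarrow> c *\<^sub>C Y \<in> W" "\<And>Y Z. Y \<in> W \<Longrightarrow> Z \<in> W \<Longrightarrow> Y + Z \<in> W"
  shows "pact p T X \<in> W"
  by (induction p) (simp_all add: pact_pCons[OF assms(1)] assms)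

lemma pact_mm: "pact p ((**) M) X = pact p ((**) M) (mat 1) ** X"
  by (induction p) (simp_all add: pact_pCons mring)

lemma real_dependence:
  fixes f :: "nat \<Rightarrow> 'a::euclidean_space"
  shows "\<exists>c. (\<exists>i\<le>DIM('a). c i \<noteq> 0) \<and> (\<Sum>i\<le>DIM('a). c i *\<^sub>R f i) = 0"
proof (cases "inj_on f {..DIM('a)}")
  case False
  then obtain i j where ij: "i \<le> DIM('a)" "j \<le> DIM('a)" "i \<noteq> j" "f i = f j"
    by (auto simp: inj_on_def)
  define c where "c k = (if k = i then 1 else if k = j then -1 else (0::real))" for k
  have "(\<Sum>k\<le>DIM('a). c k *\<^sub>R f k) = (\<Sum>k\<in>{i, j}. c k *\<^sub>R f k)"
    by (rule sum.mono_neutral_right) (use ij in \<open>auto simp: c_def\<close>)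
  also have "\<dots> = 0" using ij by (simp add: c_def)
  finally show ?thesis using ij by (intro exI[of _ c]) (auto simp: c_def)
next
  case True
  then have "card (f ` {..DIM('a)}) > DIM('a)" by (simp add: card_image)
  then have "dependent (f ` {..DIM('a)})"
    by (intro dependent_biggerset) auto
  then obtain u v where u: "v \<in> f ` {..DIM('a)}" "u v \<noteq> 0" "(\<Sum>v\<in>f ` {..DIM('a)}. u v *\<^sub>R v) = 0"
    by (auto simp: dependent_finite)
  then show ?thesis
    by (intro exI[of _ "\<lambda>i. u (f i)"]) (auto simp: sum.reindex[OF True])
qed

lemma annihilator_at:
  fixes T :: "'n cmat \<Rightarrow> 'n::finite cmat"
  assumes "clin T"
  shows "\<exists>p. p \<noteq> 0 \<and> degree p \<le> DIM('n cmat) \<and> pact p T X = 0"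
proof -
  let ?D = "DIM('n cmat)"
  obtain c where c: "\<exists>i\<le>?D. c i \<noteq> 0" "(\<Sum>i\<le>?D. c i *\<^sub>R (T ^^ i) X) = 0"
    using real_dependence[of "\<lambda>i. (T ^^ i) X"] by auto
  define p where "p = (\<Sum>i\<le>?D. monom (complex_of_real (c i)) i)"
  have "coeff p i = of_real (c i)" if "i \<le> ?D" for i
    using that by (simp add: p_def coeff_sum)
  then have "p \<noteq> 0" using c(1) by fastforce
  moreover have "degree p \<le> ?D"
    unfolding p_def by (intro degree_sum_le) (auto intro: order_trans[OF degree_monom_le])
  moreover have "pact p T X = 0"
    using c(2) by (simp add: p_def pact_sum[OF assms] pact_monom[OF assms] cscale_of_real)
  ultimately show ?thesis by blast
qed

text \<open>The product of polynomials that kill the individual vectors of a real basis. The bound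
  on the degree depends on the dimension only, which makes the exponent in
  \<open>nilpotent_bound\<close> uniform.\<close>

lemma annihilator:
  fixes T :: "'n cmat \<Rightarrow> 'n::finite cmat"
  assumes "clin T"
  shows "\<exists>p. p \<noteq> 0 \<and> degree p \<le> DIM('n cmat) * DIM('n cmat) \<and> (\<forall>X. pact p T X = 0)"
proof -
  have "\<exists>p. p \<noteq> 0 \<and> degree p \<le> card B * DIM('n cmat) \<and> (\<forall>b\<in>B. pact p T b = 0)"
    if "finite B" for B
    using that
  proof induction
    case empty
    show ?case by (intro exI[of _ 1]) simp
  next
    case (insert b B)
    then obtain p where p: "p \<noteq> 0" "degree p \<le> card B * DIM('n cmat)" "\<forall>b\<in>B. pact p T b = 0"
      by auto
    obtain q where q: "q \<noteq> 0" "degree q \<le> DIM('n cmat)" "pact q T b = 0"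
      using annihilator_at[OF assms] by blast
    have "pact (p * q) T x = 0" if "x \<in> insert b B" for x
    proof (cases "x = b")
      case True
      then show ?thesis using q by (simp add: pact_mult[OF assms] clinD[OF pact_clin[OF assms]])
    next
      case False
      then show ?thesis using p that
        by (simp add: mult.commute[of p] pact_mult[OF assms] clinD[OF pact_clin[OF assms]])
    qed
    then show ?case
      using p q insert.hyps by (intro exI[of _ "p * q"]) (auto simp: degree_mult_eq)
  qed
  from this[of Basis] obtain p where p: "p \<noteq> 0" "degree p \<le> DIM('n cmat) * DIM('n cmat)"
    "\<forall>b\<in>Basis. pact p T b = 0" by auto
  have "pact p T X = 0" for X
  proof -
    have "pact p T X = pact p T (\<Sum>b\<in>Basis. (X \<bullet> b) *\<^sub>R b)"
      by (simp only: euclidean_representation)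
    also have "\<dots> = 0"
      using p(3) by (simp add: clin_sum[OF pact_clin[OF assms]] clinD[OF pact_clin[OF assms]])
    finally show ?thesis .
  qed
  then show ?thesis using p by blast
qed

lemma funpow_mm: "(((**) M) ^^ k) X = (((**) M) ^^ k) (mat 1) ** X" for M X :: "'n::finite cmat"
  by (induction k) (simp_all add: mring)

text \<open>The roots of an annihilating polynomial are peeled off one by one: a root 0 costs one
  power of \<open>M\<close>, and a root \<open>x \<noteq> 0\<close> costs nothing because
  \<open>M - x\<close> is injective. The exponent is the same for all \<open>M\<close>, as a whole
  family of nilpotent matrices has to be treated with one exponent.\<close>

lemma nilpotent_bound:
  fixes M :: "'n::finite cmat"
  assumes "\<And>x v. x \<noteq> 0 \<Longrightarrow> M *v v = x *s v \<Longrightarrow> v = 0"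
  shows "(((**) M) ^^ (DIM('n cmat) * DIM('n cmat))) (mat 1) = 0"
proof -
  have inj: "X = 0" if "M ** X = x *\<^sub>C X" "x \<noteq> 0" for x X
  proof -
    have "M *v column j X = x *s column j X" for j
      using arg_cong[OF that(1), of "\<lambda>Y. column j Y"]
      by (simp add: vec_eq_iff column_def matrix_matrix_mult_def matrix_vector_mult_def)
    then have "column j X = 0" for j using assms that(2) by blast
    then show ?thesis by (simp add: vec_eq_iff column_def)
  qed
  have *: "(((**) M) ^^ degree p) X = 0" if "p \<noteq> 0" "pact p ((**) M) X = 0" for p X
    using that
  proof (induction "degree p" arbitrary: p X)
    case 0
    then obtain a where "p = [:a:]" "a \<noteq> 0" by (metis degree_0_id pCons_0_0)
    then show ?case using 0 by (simp add: pact_const)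
  next
    case (Suc d)
    obtain x where "poly p x = 0"
      using fundamental_theorem_of_algebra[of p] Suc.hyps(2) constant_degree[of p] by auto
    then obtain q where q: "p = [:-x, 1:] * q" by (auto simp: poly_eq_0_iff_dvd elim: dvdE)
    then have "q \<noteq> 0" using Suc.prems by auto
    then have d: "degree q = d"
      using Suc.hyps(2) by (simp add: q degree_mult_eq del: mult_pCons_left mult_pCons_right)
    have "pact q ((**) M) (M ** X - x *\<^sub>C X) = 0"
      using Suc.prems(2) by (simp add: q mult.commute[of _ q] pact_mult pact_linear del: mult_pCons_left mult_pCons_right)
    from Suc.hyps(1)[OF d[symmetric] \<open>q \<noteq> 0\<close> this]
    have "(((**) M) ^^ d) (M ** X) = x *\<^sub>C (((**) M) ^^ d) X"
      by (simp add: d clinD[OF clin_funpow])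
    then have "M ** (((**) M) ^^ d) X = x *\<^sub>C (((**) M) ^^ d) X"
      by (metis funpow_swap1)
    then show ?case
      using inj[of "(((**) M) ^^ d) X" x] Suc.hyps(2)[symmetric] by (cases "x = 0") auto
  qed
  obtain p where p: "p \<noteq> 0" "degree p \<le> DIM('n cmat) * DIM('n cmat)" "pact p ((**) M) (mat 1) = 0"
    using annihilator[OF clin_mult_left, of M] by blast
  have "DIM('n cmat) * DIM('n cmat) = (DIM('n cmat) * DIM('n cmat) - degree p) + degree p"
    using p(2) by simp
  then have "(((**) M) ^^ (DIM('n cmat) * DIM('n cmat))) (mat 1)
      = (((**) M) ^^ (DIM('n cmat) * DIM('n cmat) - degree p)) ((((**) M) ^^ degree p) (mat 1))"
    by (metis comp_apply funpow_add)
  also have "\<dots> = 0"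
    using *[OF p(1,3)] by (simp add: clinD[OF clin_funpow])
  finally show ?thesis .
qed

section \<open>Jordan decomposition and exponentials\<close>

lemma coprime_linear_poly: "a \<noteq> b \<Longrightarrow> coprime [:-a, 1:] [:-b, 1 :: complex:]"
proof (rule coprimeI)
  fix c assume "a \<noteq> b" "c dvd [:-a, 1:]" "c dvd [:-b, 1:]"
  then have "c dvd [:-a, 1:] - [:-b, 1:]" by (intro dvd_diff)
  then have "c dvd [:b - a:]" by simp
  moreover have "is_unit [:b - a:]"
    using \<open>a \<noteq> b\<close> by (simp add: is_unit_const_poly_iff dvd_field_iff)
  ultimately show "is_unit c" by (rule dvd_unit_imp_unit)
qed

lemma coprime_prod_linear_powers:
  assumes "finite L" "x \<notin> L"
  shows "coprime (\<Prod>l\<in>L. [:-l, 1:] ^ m) ([:-x, 1 :: complex:] ^ n)"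
  using assms by (intro prod_coprime_left) (auto intro!: coprime_linear_poly)

text \<open>When a root \<open>x\<close> is added, \<open>q\<close> is corrected by a multiple of
  the product for the old roots, which keeps the old congruences; Bezout coefficients choose the
  multiple so that the new one holds.\<close>

lemma polynomial_chinese_remainder:
  assumes "finite L"
  shows "\<exists>q. \<forall>l\<in>L. [:-l, 1 :: complex:] ^ m dvd q - [:l:]"
  using assms
proof induction
  case (insert x L)
  then obtain q where q: "\<And>l. l \<in> L \<Longrightarrow> [:-l, 1:] ^ m dvd q - [:l:]" by auto
  define P where "P = (\<Prod>l\<in>L. [:-l, 1 :: complex:] ^ m)"
  define a where "a = [:-x, 1 :: complex:] ^ m"
  have "gcd P a = 1"
    using coprime_prod_linear_powers[OF insert.hyps(1,2)] by (simp add: P_def a_def)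
  then obtain u v where uv: "u * P + v * a = 1"
    using bezout_coefficients_fst_snd[of P a] by metis
  define q' where "q' = q + ([:x:] - q) * u * P"
  have "a dvd q' - [:x:]"
  proof
    have "q' - [:x:] = (q - [:x:]) * (1 - u * P)" by (simp add: q'_def algebra_simps)
    also have "1 - u * P = v * a" using uv by (simp add: algebra_simps)
    finally show "q' - [:x:] = a * ((q - [:x:]) * v)" by (simp add: algebra_simps)
  qed
  moreover have "[:-l, 1:] ^ m dvd q' - [:l:]" if "l \<in> L" for l
  proof -
    have "[:-l, 1:] ^ m dvd P"
      unfolding P_def using insert.hyps(1) that by (rule dvd_prodI)
    then have "[:-l, 1:] ^ m dvd (q - [:l:]) + ([:x:] - q) * u * P"
      by (intro dvd_add q[OF that] dvd_mult)
    then show ?thesis by (simp add: q'_def algebra_simps)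
  qed
  ultimately show ?case by (auto simp: a_def)
qed auto

lemma prod_linear_powers_dvd:
  assumes "finite L" "\<And>l. l \<in> L \<Longrightarrow> [:-l, 1 :: complex:] ^ m dvd x"
  shows "(\<Prod>l\<in>L. [:-l, 1:] ^ m) dvd x"
  using assms
proof induction
  case (insert l L)
  then have "coprime ([:-l, 1:] ^ m) (\<Prod>l\<in>L. [:-l, 1:] ^ m)"
    using coprime_prod_linear_powers[of L l m m] by (subst coprime_commute)
  moreover have "[:-l, 1:] ^ m dvd x" "(\<Prod>l\<in>L. [:-l, 1:] ^ m) dvd x"
    using insert by auto
  ultimately have "[:-l, 1:] ^ m * (\<Prod>l\<in>L. [:-l, 1:] ^ m) dvd x"
    by (intro divides_mult)
  then show ?case using insert.hyps by simp
qed simp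

lemma dvd_prod_root_powers:
  fixes p :: "complex poly"
  assumes "p \<noteq> 0"
  shows "p dvd (\<Prod>l | poly p l = 0. [:-l, 1:] ^ degree p)"
proof -
  have "(\<Prod>l | poly p l = 0. [:-l, 1:] ^ Polynomial.order l p) dvd (\<Prod>l | poly p l = 0. [:-l, 1:] ^ degree p)"
    using order_degree[OF assms] by (intro prod_dvd_prod le_imp_power_dvd) auto
  then have "smult (lead_coeff p) (\<Prod>l | poly p l = 0. [:-l, 1:] ^ Polynomial.order l p)
      dvd (\<Prod>l | poly p l = 0. [:-l, 1:] ^ degree p)"
    using assms by (simp add: smult_dvd_iff)
  then show ?thesis
    by (simp add: complex_poly_decompose)
qed

lemma pact_dvd: "clin T \<Longrightarrow> p dvd q \<Longrightarrow> (\<And>X. pact p T X = 0) \<Longrightarrow> pact q T X = 0"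
  by (auto elim!: dvdE simp: pact_mult)

lemma pact_pcompose:
  "pact p ((**) (pact q ((**) M) (mat 1))) (mat 1) = pact (pcompose p q) ((**) M) (mat 1)"
proof (induction p)
  case (pCons a p)
  show ?case
    by (simp add: pCons.IH pact_pCons pcompose_pCons pact_add pact_mult pact_const
        pact_mm[of q M "pact (pcompose p q) ((**) M) (mat 1)", symmetric])
qed simp

lemma pcompose_monom: "pcompose (monom 1 n) q = q ^ n" for q :: "complex poly"
  by (induction n) (simp_all add: monom_0 monom_Suc pcompose_pCons)

text \<open>\<open>S\<close> is \<open>q(M)\<close> for a polynomial \<open>q\<close> congruent to
  \<open>l\<close> modulo \<open>[:-l, 1:] ^ m\<close> at every eigenvalue \<open>l\<close>, and
  \<open>N\<close> is \<open>M - q(M)\<close>. Each \<open>[:-l, 1:]\<close> divides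
  \<open>[:0, 1:] - q\<close>, so \<open>N\<close> is nilpotent, and the product of the distinct
  linear factors, composed with \<open>q\<close>, is a multiple of an annihilator of
  \<open>M\<close>. Both parts commute as polynomials in \<open>M\<close>.\<close>

lemma Jordan_decomposition:
  fixes M :: "'n::finite cmat"
  obtains S N L where "M = S + N" "S ** N = N ** S" "nilpotent_matrix N" "finite L"
    "pact (\<Prod>l\<in>L. [:-l, 1:]) ((**) S) (mat 1) = 0"
proof -
  let ?T = "(**) M"
  obtain p where p: "p \<noteq> 0" "\<And>X. pact p ?T X = 0"
    using annihilator[OF clin_mult_left, of M] by blast
  define L where "L = {l. poly p l = 0}"
  have L: "finite L" unfolding L_def by (rule poly_roots_finite[OF p(1)])
  have m: "degree p > 0" if "l \<in> L" for l
    using that p(1) by (auto simp: L_def elim!: degree_eq_zeroE intro: Nat.gr0I)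
  define m where "m = degree p"
  obtain q where q: "\<And>l. l \<in> L \<Longrightarrow> [:-l, 1:] ^ m dvd q - [:l:]"
    using polynomial_chinese_remainder[OF L] by blast
  have lin: "[:-l, 1:] dvd q - [:l:]" if "l \<in> L" for l
    using q[OF that] m[OF that] by (metis dvd_power dvd_trans m_def)
  have pd: "p dvd (\<Prod>l\<in>L. [:-l, 1:] ^ m)"
    unfolding L_def m_def by (rule dvd_prod_root_powers[OF p(1)])
  define S where "S = pact q ?T (mat 1)"
  define N where "N = pact ([:0, 1:] - q) ?T (mat 1)"
  have "M = S + N"
    by (simp add: S_def N_def pact_diff pact_linear[of _ 0, simplified])
  moreover have "S ** N = N ** S"
    unfolding S_def N_def by (simp add: pact_mm[symmetric] pact_mult[symmetric] mult.commute)
  moreover have "nilpotent_matrix N"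
  proof -
    have "(\<Prod>l\<in>L. [:-l, 1:] ^ m) dvd ([:0, 1:] - q) ^ m"
    proof (rule prod_linear_powers_dvd[OF L], rule dvd_power_same)
      fix l assume "l \<in> L"
      then have "[:-l, 1:] dvd [:-l, 1:] - (q - [:l:])" by (intro dvd_diff lin) auto
      moreover have "[:-l, 1:] - (q - [:l:]) = [:0, 1:] - q" by (simp add: algebra_simps)
      ultimately show "[:-l, 1:] dvd [:0, 1:] - q" by simp
    qed
    then have "pact (([:0, 1:] - q) ^ m) ?T (mat 1) = 0"
      using pd p(2) by (meson pact_dvd clin_mult_left dvd_trans)
    moreover have "pact (([:0, 1:] - q) ^ m) ?T (mat 1)
        = pact (monom 1 m) ((**) N) (mat 1)"
      unfolding N_def pact_pcompose by (simp add: pcompose_monom)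
    ultimately show ?thesis
      by (auto simp: nilpotent_matrix_def pact_monom)
  qed
  moreover have "pact (\<Prod>l\<in>L. [:-l, 1:]) ((**) S) (mat 1) = 0"
  proof -
    have "(\<Prod>l\<in>L. [:-l, 1:] ^ m) dvd pcompose (\<Prod>l\<in>L. [:-l, 1:]) q"
    proof (rule prod_linear_powers_dvd[OF L])
      fix l assume l: "l \<in> L"
      have c: "pcompose [:-l, 1:] q = q - [:l:]" for l
        by (simp add: pcompose_pCons poly_eq_iff coeff_pCons split: nat.split)
      have "q - [:l:] dvd (\<Prod>l\<in>L. q - [:l:])" using L l by (rule dvd_prodI)
      then show "[:-l, 1:] ^ m dvd pcompose (\<Prod>l\<in>L. [:-l, 1:]) q"
        using q[OF l] unfolding pcompose_prod c by (rule dvd_trans[rotated])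
    qed
    then show ?thesis
      unfolding S_def pact_pcompose using pd p(2) by (meson pact_dvd clin_mult_left dvd_trans)
  qed
  ultimately show ?thesis using that L by blast
qed

definition diagm :: "('n \<Rightarrow> complex) \<Rightarrow> 'n::finite cmat" where
  "diagm d = (\<chi> i j. if i = j then d i else 0)"

lemma diagm_mult_left: "(diagm d ** X) $ i $ j = d i * X $ i $ j"
  and diagm_mult_right: "(X ** diagm d) $ i $ j = X $ i $ j * d j"
  by (simp_all add: diagm_def matrix_matrix_mult_def if_distrib[of "\<lambda>x. x * _"]
      if_distrib[of "\<lambda>x. _ * x"] cong: if_cong)

lemma cscale_mult_vec: "(c *\<^sub>C A) *v v = c *s (A *v v)"
  by (simp add: vec_eq_iff matrix_vector_mult_def sum_distrib_left mult.assoc)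

text \<open>The eigenvectors span. With \<open>r\<close> the product over the other roots,
  \<open>a = r(x) \<noteq> 0\<close> and \<open>r - a = (X - x) s\<close>, one has
  \<open>a v = r(S) v - s(S) (S - x) v\<close>: the first term is an eigenvector for
  \<open>x\<close>, and the vector \<open>(S - x) v\<close> in the second is killed by
  \<open>r(S)\<close>.\<close>

lemma diagonalizable:
  fixes S :: "'n::finite cmat"
  assumes "finite L" "pact (\<Prod>l\<in>L. [:-l, 1:]) ((**) S) (mat 1) = 0"
  obtains Q P :: "'n cmat" and d where "Q ** P = mat 1" "P ** Q = mat 1" "S = Q ** diagm d ** P"
proof -
  define V where "V = {v. \<exists>l. S *v v = l *s v}"
  \<comment> \<open>The additional polynomial \<open>p\<close> strengthens the induction: it takes
    up the quotient \<open>s\<close>.\<close>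
  have eig: "pact p ((**) S) (mat 1) *v v \<in> vec.span V"
    if "finite L" "pact (\<Prod>l\<in>L. [:-l, 1:]) ((**) S) (mat 1) *v v = 0" for L p v
    using that
  proof (induction arbitrary: v p)
    case empty
    then have "v = 0" by (simp add: pact_1)
    then show ?case by (simp add: vec.span_zero)
  next
    case (insert x L)
    let ?r = "\<Prod>l\<in>L. [:-l, 1:]"
    define a where "a = poly ?r x"
    have a: "a \<noteq> 0" using insert.hyps by (auto simp: a_def poly_prod)
    have "[:-x, 1:] dvd ?r - [:a:]" by (simp add: poly_eq_0_iff_dvd[symmetric] a_def)
    then obtain s where s: "?r - [:a:] = [:-x, 1:] * s" by (auto elim: dvdE)
    let ?A = "\<lambda>p. pact p ((**) S) (mat 1)"
    have Am: "?A (p * q) = ?A p ** ?A q" for p q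
      by (simp add: pact_mult pact_mm[of p S "?A q", symmetric])
    have "?A p *v v \<in> vec.span V"
      if "?A [:-x, 1:] *v (?A ?r *v v) = 0"
    proof -
      have "S *v (?A p *v (?A ?r *v v)) = x *s (?A p *v (?A ?r *v v))"
      proof -
        have "?A [:-x, 1:] *v (?A p *v (?A ?r *v v)) = ?A p *v (?A [:-x, 1:] *v (?A ?r *v v))"
          by (simp only: matrix_vector_mul_assoc Am[symmetric] mult.assoc mult.commute[of _ p] mult.left_commute)
        also have "\<dots> = 0" using that by simp
        finally show ?thesis
          by (simp add: pact_linear matrix_vector_mult_diff_rdistrib cscale_mult_vec)
      qed
      then have 1: "?A p *v (?A ?r *v v) \<in> vec.span V"
        by (intro vec.span_base) (auto simp: V_def)
      have "?A ?r *v (?A [:-x, 1:] *v v) = 0"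
        using that by (simp only: matrix_vector_mul_assoc Am[symmetric] mult.commute)
      then have 2: "?A (p * s) *v (?A [:-x, 1:] *v v) \<in> vec.span V"
        by (rule insert.IH)
      have "p * [:a:] = p * ?r - p * s * [:-x, 1:]"
        unfolding mult.assoc[of p s] mult.commute[of s] s[symmetric] by (simp only: right_diff_distrib) simp
      then have e: "?A (p * [:a:]) = ?A p ** ?A ?r - ?A (p * s) ** ?A [:-x, 1:]"
        by (simp only: pact_diff[OF clin_mult_left] Am[symmetric])
      have "a *s (?A p *v v) = ?A (p * [:a:]) *v v"
        by (simp add: pact_smult cscale_mult_vec)
      also have "\<dots> = ?A p *v (?A ?r *v v) - ?A (p * s) *v (?A [:-x, 1:] *v v)"
        by (simp only: e matrix_vector_mult_diff_rdistrib matrix_vector_mul_assoc)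
      finally have "a *s (?A p *v v) = ?A p *v (?A ?r *v v) - ?A (p * s) *v (?A [:-x, 1:] *v v)" .
      then have "a *s (?A p *v v) \<in> vec.span V"
        using vec.span_diff[OF 1 2] by simp
      from vec.span_scale[OF this, of "1 / a"] show ?thesis using a by simp
    qed
    then show ?case
      using insert.prems insert.hyps
      by (simp add: Am matrix_vector_mul_assoc del: mult_pCons_left)
  qed
  have span: "vec.span V = UNIV"
    using eig[OF assms(1), of _ 1] assms(2) by (auto simp: pact_1)
  obtain B where B: "B \<subseteq> V" "vec.independent B" "V \<subseteq> vec.span B"
    using vec.maximal_independent_subset by blast
  then have spanB: "vec.span B = UNIV"
    using span by (metis vec.span_mono vec.span_span top.extremum_uniqueI)
  then have cB: "card B = CARD('n)"
    using vec.basis_card_eq_dim[of B UNIV] B by (simp add: card_cart_basis)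
  then have "finite B" by (metis card.infinite finite_UNIV_card_ge_0 finite less_numeral_extra(3))
  then obtain e where e: "bij_betw e (UNIV :: 'n set) B"
    using cB by (metis finite_same_card_bij finite)
  then have "\<forall>i. \<exists>l. S *v e i = l *s e i"
    using B(1) by (auto simp: V_def bij_betw_def)
  then obtain d where d: "\<And>i. S *v e i = d i *s e i" by metis
  define Q :: "'n cmat" where "Q = (\<chi> i j. e j $ i)"
  have "columns Q = B"
    using e by (auto simp: columns_def column_def Q_def bij_betw_def image_def)
  then obtain P where P: "Q ** P = mat 1"
    using spanB matrix_right_invertible_span_columns[of Q] by auto
  then have P': "P ** Q = mat 1" by (simp add: matrix_left_right_inverse)
  have "(S ** Q) $ i $ j = (Q ** diagm d) $ i $ j" for i j
    using arg_cong[OF d[of j], of "\<lambda>v. v $ i"]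
    by (simp add: diagm_mult_right) (simp add: matrix_matrix_mult_def matrix_vector_mult_def Q_def mult.commute)
  then have "S ** Q = Q ** diagm d" by (simp add: vec_eq_iff)
  then have "S = Q ** diagm d ** P"
    by (metis P matrix_mul_assoc matrix_mul_rid)
  with P P' show ?thesis by (rule that)
qed


section \<open>Exponential polynomials, with exponentials in \<open>z\<close> and polynomial
  coefficients in \<open>w\<close>\<close>

definition exp_poly :: "(complex \<Rightarrow> complex \<Rightarrow> complex) \<Rightarrow> bool" where
  "exp_poly F \<longleftrightarrow> (\<exists>L P. finite L \<and> F = (\<lambda>z w. \<Sum>l\<in>L. exp (l * z) * poly (P l) w))"

lemma exp_poly_poly: "exp_poly (\<lambda>z w. poly p w)"
  unfolding exp_poly_def by (intro exI[of _ "{0}"] exI[of _ "\<lambda>_. p"]) simp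

lemma exp_poly_exp: "exp_poly (\<lambda>z w. exp (z * l))"
  unfolding exp_poly_def
  by (intro exI[of _ "{l}"] exI[of _ "\<lambda>_. 1"]) (simp add: mult.commute)

lemma exp_poly_const: "exp_poly (\<lambda>z w. c)"
  using exp_poly_poly[of "[:c:]"] by simp

lemma exp_poly_add:
  assumes "exp_poly F" "exp_poly G"
  shows "exp_poly (\<lambda>z w. F z w + G z w)"
proof -
  obtain L P where 1: "finite L" "F = (\<lambda>z w. \<Sum>l\<in>L. exp (l * z) * poly (P l) w)"
    using assms(1) by (auto simp: exp_poly_def)
  obtain K Q where 2: "finite K" "G = (\<lambda>z w. \<Sum>l\<in>K. exp (l * z) * poly (Q l) w)"
    using assms(2) by (auto simp: exp_poly_def)
  define P' where "P' l = (if l \<in> L then P l else 0)" for l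
  define Q' where "Q' l = (if l \<in> K then Q l else 0)" for l
  have "F z w = (\<Sum>l\<in>L \<union> K. exp (l * z) * poly (P' l) w)" for z w
    unfolding 1(2) by (rule sum.mono_neutral_cong_left) (use 1 2 in \<open>auto simp: P'_def\<close>)
  moreover have "G z w = (\<Sum>l\<in>L \<union> K. exp (l * z) * poly (Q' l) w)" for z w
    unfolding 2(2) by (rule sum.mono_neutral_cong_left) (use 1 2 in \<open>auto simp: Q'_def\<close>)
  ultimately show ?thesis
    unfolding exp_poly_def using 1 2
    by (intro exI[of _ "L \<union> K"] exI[of _ "\<lambda>l. P' l + Q' l"])
      (simp add: sum.distrib distrib_left)
qed

lemma exp_poly_mult:
  assumes "exp_poly F" "exp_poly G"
  shows "exp_poly (\<lambda>z w. F z w * G z w)"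
proof -
  obtain L P where 1: "finite L" "F = (\<lambda>z w. \<Sum>l\<in>L. exp (l * z) * poly (P l) w)"
    using assms(1) by (auto simp: exp_poly_def)
  obtain K Q where 2: "finite K" "G = (\<lambda>z w. \<Sum>l\<in>K. exp (l * z) * poly (Q l) w)"
    using assms(2) by (auto simp: exp_poly_def)
  define I where "I = (\<lambda>x. fst x + snd x) ` (L \<times> K)"
  define R where "R n = (\<Sum>x | x \<in> L \<times> K \<and> fst x + snd x = n. P (fst x) * Q (snd x))" for n
  have "F z w * G z w = (\<Sum>n\<in>I. exp (n * z) * poly (R n) w)" for z w
  proof -
    have "F z w * G z w = (\<Sum>x\<in>L \<times> K. exp ((fst x + snd x) * z) * poly (P (fst x) * Q (snd x)) w)"
      unfolding 1(2) 2(2) sum_product sum.cartesian_product case_prod_unfold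
      by (simp add: exp_add ring_distribs mult_ac)
    also have "\<dots> = (\<Sum>n\<in>I. \<Sum>x | x \<in> L \<times> K \<and> fst x + snd x = n.
        exp ((fst x + snd x) * z) * poly (P (fst x) * Q (snd x)) w)"
      unfolding I_def using 1 2 by (intro sum.image_gen) auto
    also have "\<dots> = (\<Sum>n\<in>I. exp (n * z) * poly (R n) w)"
      by (intro sum.cong) (auto simp: R_def poly_sum sum_distrib_left intro!: sum.cong)
    finally show ?thesis .
  qed
  then show ?thesis
    unfolding exp_poly_def using 1 2 by (intro exI[of _ I] exI[of _ R]) (auto simp: I_def fun_eq_iff)
qed

lemma exp_poly_sum: "(\<And>i. i \<in> I \<Longrightarrow> exp_poly (F i)) \<Longrightarrow> exp_poly (\<lambda>z w. \<Sum>i\<in>I. F i z w)"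
  by (induction I rule: infinite_finite_induct) (simp_all add: exp_poly_const exp_poly_add)

lemma smult_add_pderiv_eq_0:
  fixes p :: "complex poly"
  assumes "smult c p + pderiv p = 0" "c \<noteq> 0"
  shows "p = 0"
proof -
  have e: "smult c p = - pderiv p" using assms(1) by (simp add: eq_neg_iff_add_eq_0)
  then have "degree p = degree p - 1"
    using assms(2) degree_pderiv[of p] by (metis degree_minus degree_smult_eq)
  then have "pderiv p = 0" by (simp add: pderiv_eq_0_iff)
  then show ?thesis using e assms(2) by simp
qed

lemma pderiv_funpow_eq_0: "degree p < n \<Longrightarrow> (pderiv ^^ n) p = 0" for p :: "complex poly"
proof (induction n arbitrary: p)
  case (Suc n)
  show ?case
  proof (cases "degree p = 0")
    case True
    then have "pderiv p = 0" by (simp add: pderiv_eq_0_iff)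
    moreover have "(pderiv ^^ n) (0 :: complex poly) = 0" by (induction n) auto
    ultimately show ?thesis by (simp add: funpow_swap1[of pderiv n p, symmetric] funpow_Suc_right del: funpow.simps)
  next
    case False
    then show ?thesis using Suc by (simp add: funpow_Suc_right degree_pderiv del: funpow.simps)
  qed
qed simp

text \<open>After division by \<open>exp (m z)\<close> the term of \<open>m\<close> is a polynomial,
  and enough differentiations remove it. They act injectively on the coefficients of the remaining
  exponentials, so the induction hypothesis applies to those.\<close>

lemma exp_poly_independent:
  fixes L :: "complex set"
  assumes "finite L" "\<And>z. (\<Sum>l\<in>L. exp (l * z) * poly (P l) z) = 0" "l \<in> L"
  shows "P l = 0"
  using assms
proof (induction L arbitrary: P l)
  case (insert m L)
  \<comment> \<open>Differentiating \<open>exp (c z) p(z)\<close> replaces \<open>p\<close> by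
    \<open>D c p\<close>, which is injective for \<open>c \<noteq> 0\<close> because it preserves
    the degree.\<close>
  define D where "D c p = smult c p + pderiv p" for c and p :: "complex poly"
  have step: "poly ((pderiv ^^ n) (P m)) z
      + (\<Sum>l\<in>L. exp ((l - m) * z) * poly ((D (l - m) ^^ n) (P l)) z) = 0" for n z
  proof (induction n arbitrary: z)
    case 0
    have "exp (- m * z) * (\<Sum>l\<in>insert m L. exp (l * z) * poly (P l) z) = 0"
      using insert.prems(1) by simp
    then show ?case
      using insert.hyps
      by (simp add: sum_distrib_left distrib_left mult.assoc[symmetric] exp_add[symmetric] left_diff_distrib)
  next
    case (Suc n)
    let ?f = "\<lambda>z. poly ((pderiv ^^ n) (P m)) z
      + (\<Sum>l\<in>L. exp ((l - m) * z) * poly ((D (l - m) ^^ n) (P l)) z)"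
    have "(?f has_field_derivative poly (pderiv ((pderiv ^^ n) (P m))) z
      + (\<Sum>l\<in>L. (l - m) * exp ((l - m) * z) * poly ((D (l - m) ^^ n) (P l)) z
          + exp ((l - m) * z) * poly (pderiv ((D (l - m) ^^ n) (P l))) z)) (at z)"
      by (auto intro!: derivative_eq_intros DERIV_sum poly_DERIV sum.cong simp: algebra_simps)
    moreover have "?f = (\<lambda>z. 0)" using Suc.IH by auto
    ultimately have "poly (pderiv ((pderiv ^^ n) (P m))) z
      + (\<Sum>l\<in>L. (l - m) * exp ((l - m) * z) * poly ((D (l - m) ^^ n) (P l)) z
          + exp ((l - m) * z) * poly (pderiv ((D (l - m) ^^ n) (P l))) z) = 0"
      using DERIV_unique[OF _ DERIV_const[of 0]] by simp
    moreover have "(l - m) * exp ((l - m) * z) * poly q z + exp ((l - m) * z) * poly (pderiv q) z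
        = exp ((l - m) * z) * poly (D (l - m) q) z" for l q
      by (simp add: D_def algebra_simps)
    ultimately show ?case by simp
  qed
  define n where "n = Suc (degree (P m))"
  have "(\<Sum>l\<in>L. exp (l * z) * poly ((D (l - m) ^^ n) (P l)) z) = 0" for z
  proof -
    have "exp (m * z) * (\<Sum>l\<in>L. exp ((l - m) * z) * poly ((D (l - m) ^^ n) (P l)) z) = 0"
      using step[of n z] by (simp add: n_def pderiv_funpow_eq_0 del: funpow.simps)
    then show ?thesis
      by (simp add: sum_distrib_left mult.assoc[symmetric] exp_add[symmetric] left_diff_distrib)
  qed
  then have "(D (k - m) ^^ n) (P k) = 0" if "k \<in> L" for k
    using insert.IH[of "\<lambda>k. (D (k - m) ^^ n) (P k)"] that by blast
  moreover have "p = 0" if "(D c ^^ j) p = 0" "c \<noteq> 0" for c j p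
    using that by (induction j) (auto simp: D_def dest: smult_add_pderiv_eq_0)
  ultimately have 0: "P k = 0" if "k \<in> L" for k
    using that insert.hyps by (metis right_minus_eq)
  then have "poly (P m) z = 0" for z using step[of 0 z] by simp
  then have "P m = 0" by (metis poly_all_0_iff_0)
  then show ?case using 0 insert.prems(2) by auto
qed simp

text \<open>Here the two times are decoupled: vanishing for real \<open>z = w\<close> extends to
  complex \<open>z = w\<close> by the identity theorem, independence kills every coefficient
  polynomial, and then nothing is left for unrelated \<open>z\<close> and \<open>w\<close>.\<close>

lemma exp_poly_eq_0:
  assumes "exp_poly F" "\<And>t::real. F (of_real t) (of_real t) = 0"
  shows "F z w = 0"
proof -
  obtain L P where 1: "finite L" "F = (\<lambda>z w. \<Sum>l\<in>L. exp (l * z) * poly (P l) w)"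
    using assms(1) by (auto simp: exp_poly_def)
  have "(\<lambda>z. F z z) z = 0" for z
  proof (rule analytic_continuation[of "\<lambda>z. F z z" UNIV "\<real>" 0])
    show "(\<lambda>z. F z z) holomorphic_on UNIV"
      unfolding 1(2) by (intro holomorphic_intros)
    show "0 islimpt (\<real> :: complex set)"
      unfolding islimpt_approachable
    proof (intro allI impI)
      fix e :: real assume "e > 0"
      then show "\<exists>x'\<in>\<real>. x' \<noteq> (0 :: complex) \<and> dist x' 0 < e"
        by (intro bexI[of _ "of_real (e / 2)"]) auto
    qed
  qed (use assms(2) in \<open>auto elim: Reals_cases\<close>)
  then have "P l = 0" if "l \<in> L" for l
    using exp_poly_independent[OF 1(1) _ that] by (auto simp: 1(2))
  then show ?thesis by (simp add: 1(2))
qed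


lemma bounded_linear_cscale: "bounded_linear (\<lambda>c. c *\<^sub>C M)" for M :: "'n::finite cmat"
  by (auto simp: linear_conv_bounded_linear[symmetric] vec_eq_iff algebra_simps intro!: linearI)

lemma diagm_eq_sum: "diagm d = (\<Sum>i\<in>UNIV. d i *\<^sub>C axis i (axis i 1))"
  by (simp add: vec_eq_iff diagm_def axis_def if_distrib[of "\<lambda>x. x $ _"] if_distrib[of "\<lambda>x. _ * x"]
      cong: if_cong)

lemma diagm_mult: "diagm c ** diagm d = diagm (\<lambda>i. c i * d i)"
  by (simp add: vec_eq_iff diagm_mult_left) (simp add: diagm_def)

lemma diagm_1: "diagm (\<lambda>i. 1) = mat 1"
  by (simp add: vec_eq_iff diagm_def mat_def)

lemma conj_diagm_mult:
  assumes "P ** Q = mat 1"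
  shows "(Q ** diagm c ** P) ** (Q ** diagm d ** P) = Q ** diagm (\<lambda>i. c i * d i) ** P"
proof -
  have "(Q ** diagm c ** P) ** (Q ** diagm d ** P) = Q ** diagm c ** (P ** Q) ** diagm d ** P"
    by (simp only: matrix_mul_assoc)
  then show ?thesis by (simp add: assms mring diagm_mult[symmetric])
qed

text \<open>In coordinates where \<open>S\<close> is diagonal, commuting means that an entry
  vanishes unless its two eigenvalues agree, and then their images under \<open>f\<close> agree as
  well.\<close>

lemma conj_diagm_commute:
  assumes PQ: "P ** Q = mat 1" "Q ** P = mat 1"
    and c: "(Q ** diagm d ** P) ** N = N ** (Q ** diagm d ** P)"
  shows "(Q ** diagm (\<lambda>i. f (d i)) ** P) ** N = N ** (Q ** diagm (\<lambda>i. f (d i)) ** P)"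
proof -
  define N' where "N' = P ** N ** Q"
  have N: "N = Q ** N' ** P"
  proof -
    have "Q ** N' ** P = (Q ** P) ** N ** (Q ** P)" by (simp only: N'_def matrix_mul_assoc)
    then show ?thesis by (simp add: PQ)
  qed
  have l: "(Q ** diagm e ** P) ** N = Q ** (diagm e ** N') ** P" for e
  proof -
    have "(Q ** diagm e ** P) ** (Q ** N' ** P) = Q ** diagm e ** (P ** Q) ** N' ** P"
      by (simp only: matrix_mul_assoc)
    then show ?thesis by (simp add: N PQ mring)
  qed
  have r: "N ** (Q ** diagm e ** P) = Q ** (N' ** diagm e) ** P" for e
  proof -
    have "(Q ** N' ** P) ** (Q ** diagm e ** P) = Q ** N' ** (P ** Q) ** diagm e ** P"
      by (simp only: matrix_mul_assoc)
    then show ?thesis by (simp add: N PQ mring)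
  qed
  have "P ** (Q ** (diagm d ** N') ** P) ** Q = P ** (Q ** (N' ** diagm d) ** P) ** Q"
    using c by (simp add: l r)
  then have "(P ** Q) ** (diagm d ** N') ** (P ** Q) = (P ** Q) ** (N' ** diagm d) ** (P ** Q)"
    by (simp only: matrix_mul_assoc)
  then have "diagm d ** N' = N' ** diagm d" by (simp add: PQ)
  then have "d i = d j \<or> N' $ i $ j = 0" for i j
    by (metis diagm_mult_left diagm_mult_right mult.commute mult_cancel_left)
  then have "(diagm (\<lambda>i. f (d i)) ** N') $ i $ j = (N' ** diagm (\<lambda>i. f (d i))) $ i $ j" for i j
    by (metis diagm_mult_left diagm_mult_right mult.commute mult_zero_right)
  then have "diagm (\<lambda>i. f (d i)) ** N' = N' ** diagm (\<lambda>i. f (d i))"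
    by (simp add: vec_eq_iff)
  then show ?thesis by (simp add: l r)
qed

text \<open>\<open>g z w\<close> plays the role of \<open>exp (z S) exp (w N)\<close>.\<close>

lemma Jordan_exponential:
  fixes M :: "'n::finite cmat"
  obtains S N and Q P :: "'n cmat" and d and g :: "complex \<Rightarrow> complex \<Rightarrow> 'n cmat"
  where "M = S + N" "S ** N = N ** S" "nilpotent_matrix N"
    "Q ** P = mat 1" "P ** Q = mat 1" "S = Q ** diagm d ** P"
    "g 0 0 = mat 1" "\<forall>i j. exp_poly (\<lambda>z w. g z w $ i $ j)" "\<forall>z w. g z w ** g (- z) (- w) = mat 1"
    "\<forall>z w t. ((\<lambda>t. g (of_real t * z) (of_real t * w)) has_vector_derivative
      (z *\<^sub>C S + w *\<^sub>C N) ** g (of_real t * z) (of_real t * w)) (at t)"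
proof -
  obtain S N L where SN: "M = S + N" "S ** N = N ** S" "nilpotent_matrix N" and L: "finite L"
    "pact (\<Prod>l\<in>L. [:-l, 1:]) ((**) S) (mat 1) = 0"
    by (rule Jordan_decomposition)
  obtain Q P :: "'n cmat" and d
    where QP: "Q ** P = mat 1" "P ** Q = mat 1" and S: "S = Q ** diagm d ** P"
    using diagonalizable[OF L] by metis
  obtain m0 where m0: "((**) N ^^ m0) (mat 1) = 0" using SN(3) by (auto simp: nilpotent_matrix_def)
  \<comment> \<open>The successor makes the sum in \<open>en\<close> contain its constant term
    \<open>mat 1\<close>.\<close>
  define m where "m = Suc m0"
  define Np where "Np k = ((**) N ^^ k) (mat 1)" for k
  have Np: "Np 0 = mat 1" "Np (Suc k) = N ** Np k" "Np m = 0" for k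
    using m0 by (simp_all add: Np_def m_def)
  define es where "es z = Q ** diagm (\<lambda>i. exp (z * d i)) ** P" for z
  define en where "en w = (\<Sum>k<m. (w ^ k / fact k) *\<^sub>C Np k)" for w
  have SNp: "S ** Np k = Np k ** S" for k
    by (induction k) (simp_all add: Np matrix_mul_assoc SN(2), simp add: mring)
  have NNp: "N ** Np k = Np k ** N" for k
  proof (induction k)
    case (Suc k)
    then show ?case by (simp only: Np(2)) (metis matrix_mul_assoc)
  qed (simp add: Np)
  have Sen: "S ** en w = en w ** S" and Nen: "N ** en w = en w ** N" for w
    by (simp_all add: en_def mm.sum_left mm.sum_right SNp NNp)
  have Nes: "N ** es z = es z ** N" for z
    unfolding es_def
    by (rule conj_diagm_commute[OF QP(2,1), where f="\<lambda>x. exp (z * x)", symmetric])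
      (use SN(2) S in auto)
  have Ses: "S ** es z = es z ** S" for z
    unfolding es_def S by (simp add: conj_diagm_mult[OF QP(2)] mult.commute)
  have des: "((\<lambda>t. es (of_real t * z)) has_vector_derivative z *\<^sub>C (S ** es (of_real t * z))) (at t)"
    for z and t :: real
  proof -
    have e: "((\<lambda>t. exp (of_real t * z * d i)) has_vector_derivative
        z * d i * exp (of_real t * z * d i)) (at t)" for i
      by (auto intro!: derivative_eq_intros has_vector_derivative_real_field)
    have "((\<lambda>t. diagm (\<lambda>i. exp (of_real t * z * d i))) has_vector_derivative
        diagm (\<lambda>i. z * d i * exp (of_real t * z * d i))) (at t)"
      unfolding diagm_eq_sum
      by (intro has_vector_derivative_sum bounded_linear.has_vector_derivative[OF bounded_linear_cscale] e)
    then have "((\<lambda>t. es (of_real t * z)) has_vector_derivative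
        Q ** diagm (\<lambda>i. z * d i * exp (of_real t * z * d i)) ** P) (at t)"
      unfolding es_def
      by (rule bounded_linear.has_vector_derivative[OF mm.bounded_linear_left
            bounded_linear.has_vector_derivative[OF mm.bounded_linear_right]])
    moreover have "diagm (\<lambda>i. z * d i * exp (of_real t * z * d i))
        = z *\<^sub>C diagm (\<lambda>i. d i * exp (of_real t * z * d i))"
      by (simp add: vec_eq_iff diagm_def)
    ultimately show ?thesis
      by (simp add: S es_def conj_diagm_mult[OF QP(2)])
  qed
  have den: "((\<lambda>t. en (of_real t * w)) has_vector_derivative w *\<^sub>C (N ** en (of_real t * w))) (at t)"
    for w and t :: real
  proof -
    define c where "c k = (if k = 0 then 0 else w * (of_real t * w) ^ (k - 1) / fact (k - 1))" for k
    have e: "((\<lambda>t. (of_real t * w) ^ k / fact k) has_vector_derivative c k) (at t)" for k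
    proof (cases k)
      case (Suc j)
      have "((\<lambda>x. x * w) has_field_derivative w) (at (of_real t))"
        by (auto intro!: derivative_eq_intros)
      from DERIV_cdivide[OF DERIV_power_Suc[OF this, of j], of "fact (Suc j)"]
      have "((\<lambda>x. (x * w) ^ Suc j / fact (Suc j)) has_field_derivative
          of_nat (Suc j) * (of_real t * w) ^ j * w / fact (Suc j)) (at (of_real t))"
        by (simp add: mult_ac del: fact_Suc power_Suc)
      then have "((\<lambda>t. (of_real t * w) ^ Suc j / fact (Suc j)) has_vector_derivative
          of_nat (Suc j) * (of_real t * w) ^ j * w / fact (Suc j)) (at t)"
        by (rule has_vector_derivative_real_field)
      moreover have "of_nat (Suc j) * (of_real t * w) ^ j * w / fact (Suc j) = c k"
      proof -
        have "n * a * w / (n * b) = w * a / b" if "n \<noteq> 0" for n a b :: complex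
          using that by simp
        from this[OF of_nat_neq_0] show ?thesis
          by (simp only: c_def Suc fact_Suc) (simp del: of_nat_Suc)
      qed
      ultimately show ?thesis by (simp only: Suc)
    qed (simp add: c_def)
    have "((\<lambda>t. en (of_real t * w)) has_vector_derivative (\<Sum>k<m. c k *\<^sub>C Np k)) (at t)"
      unfolding en_def
      by (intro has_vector_derivative_sum bounded_linear.has_vector_derivative[OF bounded_linear_cscale] e)
    moreover have "(\<Sum>k<m. c k *\<^sub>C Np k) = w *\<^sub>C (N ** en (of_real t * w))"
    proof -
      have "(\<Sum>k<m. c k *\<^sub>C Np k) = (\<Sum>k<Suc m. c k *\<^sub>C Np k)" by (simp add: Np)
      also have "\<dots> = (\<Sum>k<m. c (Suc k) *\<^sub>C Np (Suc k))"
        by (subst sum.lessThan_Suc_shift) (simp add: c_def)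
      also have "\<dots> = w *\<^sub>C (N ** en (of_real t * w))"
        by (simp add: en_def mm.sum_right cscale_sum c_def Np)
      finally show ?thesis .
    qed
    ultimately show ?thesis by simp
  qed
  define g where "g z w = es z ** en w" for z w
  have comm: "(z *\<^sub>C S + w *\<^sub>C N) ** g x y = g x y ** (z *\<^sub>C S + w *\<^sub>C N)" for z w x y
  proof -
    have "S ** g x y = g x y ** S"
      unfolding g_def by (metis Ses Sen matrix_mul_assoc)
    moreover have "N ** g x y = g x y ** N"
      unfolding g_def by (metis Nes Nen matrix_mul_assoc)
    ultimately show ?thesis by (simp add: mring)
  qed
  have dg: "((\<lambda>t. g (of_real t * z) (of_real t * w)) has_vector_derivative
      (z *\<^sub>C S + w *\<^sub>C N) ** g (of_real t * z) (of_real t * w)) (at t)" for z w t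
  proof -
    have "((\<lambda>t. es (of_real t * z) ** en (of_real t * w)) has_vector_derivative
        es (of_real t * z) ** (w *\<^sub>C (N ** en (of_real t * w)))
        + z *\<^sub>C (S ** es (of_real t * z)) ** en (of_real t * w)) (at t)"
      by (rule mm.has_vector_derivative[OF des den])
    moreover have "es (of_real t * z) ** (N ** en (of_real t * w))
        = N ** es (of_real t * z) ** en (of_real t * w)"
      by (simp add: Nes matrix_mul_assoc)
    ultimately show ?thesis
      by (simp add: g_def mring add.commute)
  qed
  have g0: "g 0 0 = mat 1"
  proof -
    have "en 0 = mat 1"
      by (simp add: en_def m_def sum.lessThan_Suc_shift Np power_0_left del: sum.lessThan_Suc)
    then show ?thesis by (simp add: g_def es_def diagm_1 QP)
  qed
  have inv: "g z w ** g (- z) (- w) = mat 1" for z w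
  proof -
    \<comment> \<open>The product is constant in \<open>t\<close>: its derivative vanishes since the
      generator commutes with \<open>g\<close>.\<close>
    let ?k = "\<lambda>t. g (of_real t * z) (of_real t * w) ** g (of_real t * (- z)) (of_real t * (- w))"
    have d0: "(?k has_vector_derivative 0) (at t)" for t
    proof (rule has_vector_derivative_eq_rhs[OF mm.has_vector_derivative[OF dg dg]])
      show "g (of_real t * z) (of_real t * w) **
          ((- z *\<^sub>C S + - w *\<^sub>C N) ** g (of_real t * - z) (of_real t * - w)) +
          (z *\<^sub>C S + w *\<^sub>C N) ** g (of_real t * z) (of_real t * w) **
            g (of_real t * - z) (of_real t * - w) = 0"
        unfolding comm[of z w] by (simp add: mring)
    qed
    have "?k 1 = ?k 0"
    proof (rule has_vector_derivative_zero_constant[OF convex_UNIV d0])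
      fix c assume c: "\<And>t. t \<in> UNIV \<Longrightarrow> ?k t = c"
      show ?thesis by (simp only: c[OF UNIV_I])
    qed
    then show ?thesis by (simp add: g0)
  qed
  have ep: "exp_poly (\<lambda>z w. g z w $ i $ j)" for i j
  proof -
    have "exp_poly (\<lambda>z w. es z $ i $ k)" for k
    proof -
      have "es z $ i $ k = (\<Sum>l\<in>UNIV. Q $ i $ l * exp (z * d l) * P $ l $ k)" for z
        by (simp add: es_def matrix_matrix_mult_def[of "Q ** _" P] diagm_mult_right)
      then show ?thesis
        by (simp only:) (intro exp_poly_sum exp_poly_mult exp_poly_const exp_poly_exp)
    qed
    moreover have "exp_poly (\<lambda>z w. en w $ k $ j)" for k
    proof -
      have "en w $ k $ j = (\<Sum>l<m. poly (monom (Np l $ k $ j / fact l) l) w)" for w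
        by (simp add: en_def sum_component poly_monom mult.commute)
      then show ?thesis
        by (simp only:) (intro exp_poly_sum exp_poly_poly)
    qed
    ultimately have "exp_poly (\<lambda>z w. \<Sum>k\<in>UNIV. es z $ i $ k * en w $ k $ j)"
      by (intro exp_poly_sum exp_poly_mult)
    then show ?thesis
      by (simp only: g_def matrix_matrix_mult_def vec_lambda_beta)
  qed
  show ?thesis
    by (rule that[of S N Q P d g, OF SN QP S g0]) (intro allI ep inv dg)+
qed

section \<open>Lie algebras of algebraic groups\<close>

text \<open>A distance function is continuous but need not be differentiable, so only an upper bound
  on forward increments is assumed. The comparison function \<open>\<psi>\<close> starts
  \<open>\<epsilon>\<close> higher and grows at a rate \<open>\<epsilon>\<close> larger. At the
  infimum of the set where \<open>\<phi>\<close> exceeds it, the increment bound keeps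
  \<open>\<phi>\<close> below for a while longer, a contradiction; finally \<open>\<epsilon>\<close>
  tends to 0.\<close>

lemma Dini_Gronwall:
  fixes \<phi> :: "real \<Rightarrow> real"
  assumes ab: "a \<le> b" and M: "M \<ge> 0" and c: "continuous_on {a..b} \<phi>"
    and nn: "\<And>s. \<phi> s \<ge> 0"
    and D: "\<And>s e. a \<le> s \<Longrightarrow> s < b \<Longrightarrow> e > 0 \<Longrightarrow>
      eventually (\<lambda>d. \<phi> (s + d) \<le> \<phi> s + d * (M * \<phi> s + e)) (at_right 0)"
  shows "\<phi> b \<le> exp (M * (b - a)) * \<phi> a"
proof -
  have "\<phi> b \<le> (\<phi> a + \<epsilon>) * exp ((M + \<epsilon>) * (b - a))" if \<epsilon>: "\<epsilon> > 0" for \<epsilon>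
  proof (rule ccontr)
    define \<psi> where "\<psi> s = (\<phi> a + \<epsilon>) * exp ((M + \<epsilon>) * (s - a))" for s
    have c': "continuous_on {a..b} \<psi>" unfolding \<psi>_def by (intro continuous_intros)
    have \<psi>: "\<psi> s \<ge> \<epsilon>" if "s \<ge> a" for s
      using mult_mono[of \<epsilon> "\<phi> a + \<epsilon>" 1 "exp ((M + \<epsilon>) * (s - a))"] nn[of a] \<epsilon> M that
      by (simp add: \<psi>_def)
    define B where "B = {s\<in>{a..b}. \<phi> s > \<psi> s}"
    assume "\<not> \<phi> b \<le> (\<phi> a + \<epsilon>) * exp ((M + \<epsilon>) * (b - a))"
    then have bB: "b \<in> B" using ab by (auto simp: B_def \<psi>_def)
    define s where "s = Inf B"
    have bdd: "bdd_below B" by (auto simp: B_def bdd_below_def)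
    have s: "a \<le> s" "s \<le> b"
      unfolding s_def using bB bdd by (auto simp: B_def intro: cInf_greatest cInf_lower)
    have le: "s \<le> r" if "r \<in> B" for r unfolding s_def using that bdd by (rule cInf_lower)
    have \<phi>s: "\<phi> s \<le> \<psi> s"
    proof (cases "s = a")
      case True
      then show ?thesis using \<epsilon> by (simp add: \<psi>_def)
    next
      case False
      have "closure {a..<s} = {a..s}" using False s by (intro closure_atLeastLessThan) auto
      moreover have "continuous_on {a..s} (\<lambda>r. \<psi> r - \<phi> r)"
        using s by (intro continuous_intros continuous_on_subset[OF c] continuous_on_subset[OF c']) auto
      moreover have "\<psi> r - \<phi> r \<ge> 0" if "r \<in> {a..<s}" for r
      proof (rule ccontr)
        assume "\<not> \<psi> r - \<phi> r \<ge> 0"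
        then have "r \<in> B" using that s by (simp add: B_def)
        then show False using le[of r] that by simp
      qed
      ultimately have "\<psi> s - \<phi> s \<ge> 0"
        using continuous_ge_on_closure[of "{a..<s}" "\<lambda>r. \<psi> r - \<phi> r" s 0] s by auto
      then show ?thesis by simp
    qed
    have "s < b"
      using \<phi>s bB s by (cases "s = b") (auto simp: B_def)
    \<comment> \<open>The error \<open>\<epsilon> * \<epsilon>\<close> is at most
      \<open>\<epsilon> * \<psi> s\<close>, so the surplus in the rate of \<open>\<psi>\<close>
      absorbs it.\<close>
    have "eventually (\<lambda>d. \<phi> (s + d) \<le> \<phi> s + d * (M * \<phi> s + \<epsilon> * \<epsilon>)) (at_right 0)"
      using s \<open>s < b\<close> \<epsilon> by (intro D) auto
    then obtain \<delta> where \<delta>: "\<delta> > 0"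
      "\<And>d. 0 < d \<Longrightarrow> d < \<delta> \<Longrightarrow> \<phi> (s + d) \<le> \<phi> s + d * (M * \<phi> s + \<epsilon> * \<epsilon>)"
      by (auto simp: eventually_at_right_field)
    have "r \<ge> s + \<delta>" if r: "r \<in> B" for r
    proof (rule ccontr)
      assume "\<not> r \<ge> s + \<delta>"
      moreover have "r \<noteq> s" using r \<phi>s by (auto simp: B_def)
      ultimately have d: "0 < r - s" "r - s < \<delta>" using le[OF r] by auto
      define d where "d = r - s"
      have "\<phi> r \<le> \<phi> s + d * (M * \<phi> s + \<epsilon> * \<epsilon>)"
        using \<delta>(2)[OF d] by (simp add: d_def)
      also have "\<dots> \<le> \<psi> s + d * (M * \<psi> s + \<epsilon> * \<psi> s)"
        using d \<phi>s M \<epsilon> \<psi>[OF s(1)] by (intro add_mono mult_left_mono) (auto simp: d_def)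
      also have "\<dots> = \<psi> s * (1 + (M + \<epsilon>) * d)" by (simp add: algebra_simps)
      also have "\<dots> \<le> \<psi> s * exp ((M + \<epsilon>) * d)"
        using \<psi>[OF s(1)] \<epsilon> by (intro mult_left_mono exp_ge_add_one_self) auto
      also have "\<dots> = \<psi> r"
        by (simp add: \<psi>_def d_def exp_add[symmetric] algebra_simps)
      finally show False using r by (simp add: B_def)
    qed
    then have "s + \<delta> \<le> s" unfolding s_def using bB by (intro cInf_greatest) auto
    then show False using \<delta>(1) by simp
  qed
  then have le: "eventually (\<lambda>\<epsilon>. \<phi> b \<le> (\<phi> a + \<epsilon>) * exp ((M + \<epsilon>) * (b - a))) (at_right 0)"
    by (auto simp: eventually_at_right_field intro: exI[of _ 1])
  have "((\<lambda>\<epsilon>. (\<phi> a + \<epsilon>) * exp ((M + \<epsilon>) * (b - a))) \<longlongrightarrow>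
      (\<phi> a + 0) * exp ((M + 0) * (b - a))) (at_right 0)"
    by (intro tendsto_intros)
  from tendsto_lowerbound[OF this le] show ?thesis by (simp add: mult.commute)
qed

lemma has_vector_derivative_imp_quotient:
  fixes c :: "real \<Rightarrow> 'a::real_normed_vector"
  assumes "(c has_vector_derivative X) (at 0)"
  shows "((\<lambda>d. (c d - c 0) /\<^sub>R d) \<longlongrightarrow> X) (at 0)"
proof -
  have "((\<lambda>y. norm (c y - c 0 - y *\<^sub>R X) / norm y) \<longlongrightarrow> 0) (at 0)"
    using assms by (simp add: has_vector_derivative_def has_derivative_iff_norm)
  moreover have "eventually (\<lambda>y. norm (c y - c 0 - y *\<^sub>R X) / norm y
      = norm ((c y - c 0) /\<^sub>R y - X)) (at 0)"
    unfolding eventually_at_filter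
  proof (intro always_eventually allI impI)
    fix y :: real assume "y \<noteq> 0"
    then have "(c y - c 0) /\<^sub>R y - X = (c y - c 0 - y *\<^sub>R X) /\<^sub>R y"
      by (simp add: scaleR_diff_right)
    then show "norm (c y - c 0 - y *\<^sub>R X) / norm y = norm ((c y - c 0) /\<^sub>R y - X)"
      by (simp add: divide_inverse mult.commute)
  qed
  ultimately have "((\<lambda>y. norm ((c y - c 0) /\<^sub>R y - X)) \<longlongrightarrow> 0) (at 0)"
    by (rule Lim_transform_eventually)
  then show ?thesis
    by (simp add: tendsto_norm_zero_iff LIM_zero_iff)
qed

lemma norm_quotient_at_right:
  fixes c :: "real \<Rightarrow> 'a::real_normed_vector"
  assumes "(c has_vector_derivative X) (at 0)"
  shows "((\<lambda>d. norm (c d - c 0) / d) \<longlongrightarrow> norm X) (at_right 0)"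
proof -
  have "((\<lambda>d. norm ((c d - c 0) /\<^sub>R d)) \<longlongrightarrow> norm X) (at_right 0)"
    using has_vector_derivative_imp_quotient[OF assms]
    by (intro tendsto_norm) (rule tendsto_mono[OF at_le], auto)
  moreover have "eventually (\<lambda>d. norm ((c d - c 0) /\<^sub>R d) = norm (c d - c 0) / d) (at_right 0)"
    by (auto simp: eventually_at_right_field divide_inverse mult.commute intro!: exI[of _ 1])
  ultimately show ?thesis by (rule Lim_transform_eventually)
qed

text \<open>The curves \<open>cX\<close>, \<open>cY\<close> stand in for one-parameter groups: the definition of \<open>lie_algebra\<close>
  provides them, and no exponential map is needed.\<close>

lemma infdist_invariance:
  fixes g X Y :: "real \<Rightarrow> 'n::finite cmat"
  assumes ab: "a \<le> b" and Z: "Z \<noteq> {}"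
    and g: "\<And>s. a \<le> s \<Longrightarrow> s \<le> b \<Longrightarrow> (g has_vector_derivative X s ** g s - g s ** Y s) (at s)"
    and M: "\<And>s. a \<le> s \<Longrightarrow> s \<le> b \<Longrightarrow> norm (X s) + norm (Y s) \<le> M"
    and c: "\<And>s. a \<le> s \<Longrightarrow> s \<le> b \<Longrightarrow> \<exists>cX cY. cX 0 = mat 1 \<and> cY 0 = mat 1 \<and>
      (cX has_vector_derivative X s) (at (0::real)) \<and> (cY has_vector_derivative - Y s) (at (0::real)) \<and>
      (\<forall>d. \<forall>k\<in>Z. cX d ** k ** cY d \<in> Z)"
  shows "infdist (g b) Z \<le> exp (M * (b - a)) * infdist (g a) Z"
proof (rule Dini_Gronwall[OF ab])
  show "M \<ge> 0" using M[of a] ab by (smt (verit) norm_ge_zero)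
  have "continuous_on {a..b} g"
    by (intro continuous_at_imp_continuous_on ballI has_vector_derivative_continuous[OF g]) auto
  then show "continuous_on {a..b} (\<lambda>s. infdist (g s) Z)"
    by (intro continuous_intros)
  show "infdist (g s) Z \<ge> 0" for s by (rule infdist_nonneg)
  fix s e :: real assume s: "a \<le> s" "s < b" and e: "e > 0"
  obtain cX cY where cX: "cX 0 = mat 1" "(cX has_vector_derivative X s) (at 0)"
    and cY: "cY 0 = mat 1" "(cY has_vector_derivative - Y s) (at 0)"
    and cZ: "\<And>d k. k \<in> Z \<Longrightarrow> cX d ** k ** cY d \<in> Z"
    using c[of s] s by auto
  define D where "D = infdist (g s) Z"
  \<comment> \<open>Both terms have value \<open>g s\<close> and velocity
    \<open>X s ** g s - g s ** Y s\<close> at \<open>d = 0\<close>, so \<open>r d\<close> is of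
    smaller order than \<open>d\<close>.\<close>
  define r where "r d = g (s + d) - cX d ** g s ** cY d" for d
  define u where "u d = norm (cX d - cX 0)" for d
  define v where "v d = norm (cY d - cY 0)" for d
  have "((\<lambda>d. g (s + d)) has_vector_derivative X s ** g s - g s ** Y s) (at 0)"
    using vector_diff_chain_at[of "\<lambda>d. s + d" 1 0 g "X s ** g s - g s ** Y s"] g[of s] s
    by (simp add: o_def has_vector_derivative_add[OF has_vector_derivative_const
          has_vector_derivative_id, simplified])
  then have "(r has_vector_derivative X s ** g s - g s ** Y s -
      (cX 0 ** g s ** - Y s + (X s ** g s) ** cY 0)) (at 0)"
    unfolding r_def
    by (intro has_vector_derivative_diff mm.has_vector_derivative[OF _ cY(2)]
        bounded_linear.has_vector_derivative[OF mm.bounded_linear_left cX(2)])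
  then have "(r has_vector_derivative 0) (at 0)"
    by (simp add: cX cY mring)
  from norm_quotient_at_right[OF this] have r: "((\<lambda>d. norm (r d) / d) \<longlongrightarrow> 0) (at_right 0)"
    by (simp add: r_def cX cY)
  have u: "((\<lambda>d. u d / d) \<longlongrightarrow> norm (X s)) (at_right 0)"
    unfolding u_def by (rule norm_quotient_at_right[OF cX(2)])
  have v: "((\<lambda>d. v d / d) \<longlongrightarrow> norm (Y s)) (at_right 0)"
    unfolding v_def using norm_quotient_at_right[OF cY(2)] by simp
  have "((\<lambda>d. v d / d * d) \<longlongrightarrow> norm (Y s) * 0) (at_right 0)"
    by (intro tendsto_mult v tendsto_ident_at)
  moreover have "eventually (\<lambda>d. v d / d * d = v d) (at_right 0)"
    by (auto simp: eventually_at_right_field intro!: exI[of _ 1])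
  ultimately have "(v \<longlongrightarrow> norm (Y s) * 0) (at_right 0)"
    by (rule Lim_transform_eventually)
  then have v0: "(v \<longlongrightarrow> 0) (at_right 0)" by simp
  have "((\<lambda>d. norm (r d) / d + D * (u d / d + v d / d + u d / d * v d)) \<longlongrightarrow>
      0 + D * (norm (X s) + norm (Y s) + norm (X s) * 0)) (at_right 0)"
    by (intro tendsto_intros r u v v0)
  moreover have "0 + D * (norm (X s) + norm (Y s) + norm (X s) * 0) < M * D + e"
    using M[of s] s e mult_left_mono[of "norm (X s) + norm (Y s)" M D]
    by (simp add: D_def mult.commute infdist_nonneg)
  ultimately have "eventually (\<lambda>d. norm (r d) / d + D * (u d / d + v d / d + u d / d * v d)
      < M * D + e) (at_right 0)"
    by (rule order_tendstoD)
  then show "eventually (\<lambda>d. infdist (g (s + d)) Z \<le> infdist (g s) Z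
      + d * (M * infdist (g s) Z + e)) (at_right 0)"
    using eventually_at_right_less[of 0]
  proof eventually_elim
    case (elim d)
    \<comment> \<open>This is \<open>(1 + u d) (1 + v d)\<close>, a bound for the factor by which
      multiplication with \<open>cX d\<close> and \<open>cY d\<close> stretches the distance to a
      point \<open>k\<close> of \<open>Z\<close>.\<close>
    define q where "q = 1 + u d + v d + u d * v d"
    have q: "q > 0" by (auto simp: q_def u_def v_def intro!: add_pos_nonneg)
    have "infdist (g (s + d)) Z \<le> norm (r d) + q * dist (g s) k" if k: "k \<in> Z" for k
    proof -
      let ?W = "g s - k"
      have "infdist (g (s + d)) Z \<le> norm (g (s + d) - cX d ** k ** cY d)"
        using infdist_le[OF cZ[OF k]] by (simp add: dist_norm)
      also have "g (s + d) - cX d ** k ** cY d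
          = r d + (?W + (cX d - cX 0) ** ?W + ?W ** (cY d - cY 0)
            + (cX d - cX 0) ** ?W ** (cY d - cY 0))"
        by (simp add: r_def cX cY mring)
      also have "norm \<dots> \<le> norm (r d) + (norm ?W + u d * norm ?W + norm ?W * v d
            + u d * norm ?W * v d)"
      proof (intro norm_triangle_le add_mono order_refl)
        show 1: "norm ((cX d - cX 0) ** ?W) \<le> u d * norm ?W"
          by (simp add: u_def norm_matrix_mult)
        show "norm (?W ** (cY d - cY 0)) \<le> norm ?W * v d"
          by (simp add: v_def norm_matrix_mult)
        show "norm ((cX d - cX 0) ** ?W ** (cY d - cY 0)) \<le> u d * norm ?W * v d"
          by (rule order_trans[OF norm_matrix_mult]) (auto simp: v_def u_def intro!: mult_mono 1[unfolded u_def])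
      qed
      finally show ?thesis by (simp add: q_def dist_norm algebra_simps)
    qed
    then have "(infdist (g (s + d)) Z - norm (r d)) / q \<le> dist (g s) k" if "k \<in> Z" for k
      using that q by (simp add: divide_le_eq mult.commute) (smt (verit))
    then have "(infdist (g (s + d)) Z - norm (r d)) / q \<le> D"
      unfolding D_def infdist_notempty[OF Z] by (intro cINF_greatest[OF Z])
    then have "infdist (g (s + d)) Z \<le> norm (r d) + D * q"
      using q by (simp add: divide_le_eq)
    also have "\<dots> = D + d * (norm (r d) / d + D * (u d / d + v d / d + u d / d * v d))"
      using elim by (simp add: q_def field_simps)
    also have "\<dots> \<le> D + d * (M * D + e)"
      using elim by (intro add_left_mono mult_left_mono) auto
    finally show ?case by (simp add: D_def)
  qed
qed

text \<open>The estimate is started at \<open>s\<close> and \<open>s\<close> is sent to minus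
  infinity: up to \<open>s0\<close> the distance grows by at most
  \<open>exp (\<mu> * (s0 - s))\<close>, but it begins at size \<open>C * exp (\<kappa> * s)\<close>
  with \<open>\<kappa> > \<mu>\<close>. Hence it is zero at \<open>s0\<close>, and the cruder rate
  \<open>M\<close> carries this on to time 0.\<close>

lemma infdist_orbit_eq_0:
  fixes g X Y :: "real \<Rightarrow> 'n::finite cmat"
  assumes Z: "Z \<noteq> {}"
    and g: "\<And>s. s \<le> 0 \<Longrightarrow> (g has_vector_derivative X s ** g s - g s ** Y s) (at s)"
    and c: "\<And>s. s \<le> 0 \<Longrightarrow> \<exists>cX cY. cX 0 = mat 1 \<and> cY 0 = mat 1 \<and>
      (cX has_vector_derivative X s) (at (0::real)) \<and> (cY has_vector_derivative - Y s) (at (0::real)) \<and>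
      (\<forall>d. \<forall>k\<in>Z. cX d ** k ** cY d \<in> Z)"
    and M: "\<And>s. s \<le> 0 \<Longrightarrow> norm (X s) + norm (Y s) \<le> M"
    and \<mu>: "s0 \<le> 0" "\<And>s. s \<le> s0 \<Longrightarrow> norm (X s) + norm (Y s) \<le> \<mu>" "\<mu> < \<kappa>"
    and C: "\<And>s. s \<le> s0 \<Longrightarrow> infdist (g s) Z \<le> C * exp (\<kappa> * s)"
  shows "infdist (g 0) Z = 0"
proof -
  have "infdist (g s0) Z \<le> C * exp (\<mu> * s0) * exp ((\<kappa> - \<mu>) * s)" if "s \<le> s0" for s
  proof -
    have "infdist (g s0) Z \<le> exp (\<mu> * (s0 - s)) * infdist (g s) Z"
      using that \<mu>(1) by (intro infdist_invariance[OF _ Z]) (use g \<mu>(2) c in auto)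
    also have "\<dots> \<le> exp (\<mu> * (s0 - s)) * (C * exp (\<kappa> * s))"
      using C[OF that] by (intro mult_left_mono) auto
    also have "\<dots> = C * exp (\<mu> * s0) * exp ((\<kappa> - \<mu>) * s)"
      by (simp add: algebra_simps flip: exp_add)
    finally show ?thesis .
  qed
  then have "eventually (\<lambda>s. infdist (g s0) Z \<le> C * exp (\<mu> * s0) * exp ((\<kappa> - \<mu>) * s)) at_bot"
    by (auto simp: eventually_at_bot_linorder)
  moreover have "((\<lambda>s. C * exp (\<mu> * s0) * exp ((\<kappa> - \<mu>) * s)) \<longlongrightarrow> C * exp (\<mu> * s0) * 0) at_bot"
    using \<mu>(3) by (intro tendsto_mult tendsto_const filterlim_compose[OF exp_at_bot]
        filterlim_tendsto_pos_mult_at_bot[OF tendsto_const] filterlim_ident) auto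
  ultimately have "infdist (g s0) Z \<le> 0"
    using tendsto_lowerbound[of _ _ at_bot "infdist (g s0) Z", OF _ _ trivial_limit_at_bot_linorder]
    by simp
  moreover have "infdist (g 0) Z \<le> exp (M * (0 - s0)) * infdist (g s0) Z"
    using \<mu>(1) by (intro infdist_invariance[OF _ Z]) (use g M c in auto)
  ultimately show ?thesis
    using infdist_nonneg[of "g 0" Z] infdist_nonneg[of "g s0" Z] by (simp add: antisym)
qed


section \<open>Algebraic groups: closedness, and closure properties of the Lie algebra\<close>

lemma continuous_polynomial_map: "polynomial_map f \<Longrightarrow> continuous_on UNIV f"
  by (induction rule: polynomial_map.induct) (auto intro!: continuous_intros)

lemma exp_poly_polynomial_map:
  assumes "polynomial_map f" "\<And>i j. exp_poly (\<lambda>z w. g z w $ i $ j)"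
  shows "exp_poly (\<lambda>z w. f (g z w))"
  using assms(1)
  by induction (auto intro: exp_poly_const exp_poly_add exp_poly_mult assms(2))

lemma matrix_inv_unique:
  fixes A :: "'n::finite cmat"
  assumes "A ** B = mat 1"
  shows "matrix_inv A = B"
proof -
  have BA: "B ** A = mat 1" using assms by (rule matrix_left_right_inverse1)
  have "A ** matrix_inv A = mat 1 \<and> matrix_inv A ** A = mat 1"
    unfolding matrix_inv_def
    using someI[of "\<lambda>A'. A ** A' = mat 1 \<and> A' ** A = mat 1" B] assms BA by blast
  then have "matrix_inv A = (B ** A) ** matrix_inv A" "A ** matrix_inv A = mat 1"
    by (simp_all add: BA)
  then show ?thesis by (metis matrix_mul_assoc matrix_mul_rid)
qed

lemma matrix_inv_mult:
  fixes A :: "'n::finite cmat"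
  assumes "invertible A"
  shows "A ** matrix_inv A = mat 1" "matrix_inv A ** A = mat 1"
proof -
  obtain B where "A ** B = mat 1" using assms by (auto simp: invertible_def)
  then show "A ** matrix_inv A = mat 1" "matrix_inv A ** A = mat 1"
    using matrix_inv_unique[of A B] matrix_left_right_inverse1[of A B] by simp_all
qed

context
  fixes H :: "('n::finite cmat) set"
  assumes H: "algebraic_group H"
begin

lemma alg_group_one: "mat 1 \<in> H"
  using H subgroup.one_closed[of H GL] by (simp add: algebraic_group_def GL_def)

lemma alg_group_mult: "A \<in> H \<Longrightarrow> B \<in> H \<Longrightarrow> A ** B \<in> H"
  using H subgroup.m_closed[of H GL A B] by (simp add: algebraic_group_def GL_def)

lemma alg_group_invertible: "A \<in> H \<Longrightarrow> invertible A"
  using H by (auto simp: algebraic_group_def GL_def)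

lemma alg_group_inv:
  assumes "A \<in> H"
  shows "matrix_inv A \<in> H"
proof -
  have A: "A ** matrix_inv A = mat 1" "matrix_inv A ** A = mat 1"
    using alg_group_invertible[OF assms] by (simp_all add: matrix_inv_mult)
  have "inv\<^bsub>GL\<^esub> A = matrix_inv A"
    unfolding m_inv_def
  proof (rule the_equality)
    show "matrix_inv A \<in> carrier GL \<and> A \<otimes>\<^bsub>GL\<^esub> matrix_inv A = \<one>\<^bsub>GL\<^esub> \<and>
        matrix_inv A \<otimes>\<^bsub>GL\<^esub> A = \<one>\<^bsub>GL\<^esub>"
      using A by (auto simp: GL_def invertible_def)
  qed (auto simp: GL_def matrix_inv_unique)
  then show ?thesis
    using H subgroup.m_inv_closed[of H GL A] assms by (simp add: algebraic_group_def)
qed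

lemma alg_group_nonempty: "H \<noteq> {}"
  using alg_group_one by auto

text \<open>The polynomial equations survive passage to the closure, but invertibility does not;
  \<open>H\<close> is closed only relative to the invertible matrices.\<close>

lemma alg_group_closed:
  assumes "infdist A H = 0" "invertible A"
  shows "A \<in> H"
proof -
  obtain P where P: "\<And>f. f \<in> P \<Longrightarrow> polynomial_map f" "H = {g \<in> carrier GL. \<forall>f\<in>P. f g = 0}"
    using H by (auto simp: algebraic_group_def)
  have A: "A \<in> closure H"
    using assms(1) alg_group_nonempty by (simp add: in_closure_iff_infdist_zero)
  have "f A = 0" if f: "f \<in> P" for f
  proof -
    have "closure H \<subseteq> f -` {0}"
      using P f by (intro closure_minimal closed_vimage continuous_polynomial_map) auto
    then show ?thesis using A by auto
  qed
  then show ?thesis using assms(2) by (simp add: P GL_def)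
qed

lemma lie_algebraI:
  "(\<And>t. c t \<in> H) \<Longrightarrow> c 0 = mat 1 \<Longrightarrow> (c has_vector_derivative X) (at 0) \<Longrightarrow> X \<in> lie_algebra H"
  unfolding lie_algebra_def by blast

lemma lie_algebraE:
  assumes "X \<in> lie_algebra H"
  obtains c where "\<forall>t. c t \<in> H" "c 0 = mat 1" "(c has_vector_derivative X) (at (0::real))"
  using assms unfolding lie_algebra_def by blast

lemma lie_algebra_0: "0 \<in> lie_algebra H"
  by (rule lie_algebraI[of "\<lambda>t. mat 1"]) (auto simp: alg_group_one)

lemma lie_algebra_add:
  assumes "X \<in> lie_algebra H" "Y \<in> lie_algebra H"
  shows "X + Y \<in> lie_algebra H"
proof -
  obtain c where c: "\<forall>t. c t \<in> H" "c 0 = mat 1" "(c has_vector_derivative X) (at (0::real))"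
    using assms(1) by (rule lie_algebraE)
  obtain b where b: "\<forall>t. b t \<in> H" "b 0 = mat 1" "(b has_vector_derivative Y) (at (0::real))"
    using assms(2) by (rule lie_algebraE)
  show ?thesis
    by (rule lie_algebraI[of "\<lambda>t. c t ** b t"])
      (use mm.has_vector_derivative[OF c(3) b(3)] c b in \<open>auto simp: alg_group_mult add.commute\<close>)
qed

lemma lie_algebra_scaleR:
  assumes "X \<in> lie_algebra H"
  shows "r *\<^sub>R X \<in> lie_algebra H"
proof -
  obtain c where c: "\<forall>t. c t \<in> H" "c 0 = mat 1" "(c has_vector_derivative X) (at (0::real))"
    using assms by (rule lie_algebraE)
  have "((\<lambda>t. r * t) has_vector_derivative r) (at 0)"
    using has_vector_derivative_mult_right[OF has_vector_derivative_id, of r "at 0"] by simp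
  from vector_diff_chain_at[OF this, of c X] c(3)
  show ?thesis
    by (intro lie_algebraI[of "\<lambda>t. c (r * t)"]) (auto simp: c o_def)
qed

lemma lie_algebra_uminus: "X \<in> lie_algebra H \<Longrightarrow> - X \<in> lie_algebra H"
  using lie_algebra_scaleR[of X "-1"] by simp

lemma lie_algebra_curves:
  assumes "X \<in> lie_algebra H" "Y \<in> lie_algebra H"
  shows "\<exists>cX cY. cX 0 = mat 1 \<and> cY 0 = mat 1 \<and>
      (cX has_vector_derivative X) (at (0::real)) \<and> (cY has_vector_derivative - Y) (at (0::real)) \<and>
      (\<forall>d. \<forall>k\<in>H. cX d ** k ** cY d \<in> H)"
proof -
  obtain c where c: "\<forall>t. c t \<in> H" "c 0 = mat 1" "(c has_vector_derivative X) (at (0::real))"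
    using assms(1) by (rule lie_algebraE)
  obtain b where b: "\<forall>t. b t \<in> H" "b 0 = mat 1" "(b has_vector_derivative - Y) (at (0::real))"
    using lie_algebra_uminus[OF assms(2)] by (rule lie_algebraE)
  show ?thesis
    by (intro exI[of _ c] exI[of _ b] conjI b(2,3) c(2,3) allI ballI alg_group_mult)
      (use b(1) c(1) in auto)
qed

text \<open>The distance of \<open>g t t\<close> from \<open>H\<close> starts at 0 and obeys the
  Gronwall estimate, so the real one-parameter group of \<open>X\<close> stays in \<open>H\<close>;
  \<open>exp_poly_eq_0\<close> frees the two arguments, and all \<open>g z w\<close> lie in
  \<open>H\<close>. Velocities of the curves \<open>g (t z) (t w)\<close> give the combinations of
  \<open>S\<close> and \<open>N\<close>, and conjugation with the one-parameter group gives the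
  commutators.\<close>

lemma lie_algebra_Jordan:
  assumes X: "X \<in> lie_algebra H"
  obtains S N and Q P :: "'n cmat" and d where "X = S + N" "S ** N = N ** S" "nilpotent_matrix N"
    "Q ** P = mat 1" "P ** Q = mat 1" "S = Q ** diagm d ** P"
    "\<And>z w. z *\<^sub>C S + w *\<^sub>C N \<in> lie_algebra H"
    "\<And>Y. Y \<in> lie_algebra H \<Longrightarrow> X ** Y - Y ** X \<in> lie_algebra H"
proof -
  obtain S N and Q P :: "'n cmat" and d g where SN: "X = S + N" "S ** N = N ** S"
    "nilpotent_matrix N" "Q ** P = mat 1" "P ** Q = mat 1" "S = Q ** diagm d ** P"
    and g0: "g 0 0 = mat 1" and ep: "\<forall>i j. exp_poly (\<lambda>z w. g z w $ i $ j)"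
    and gi: "\<forall>z w. g z w ** g (- z) (- w) = mat 1"
    and dg: "\<forall>z w t. ((\<lambda>t. g (of_real t * z) (of_real t * w)) has_vector_derivative
      (z *\<^sub>C S + w *\<^sub>C N) ** g (of_real t * z) (of_real t * w)) (at t)"
    by (rule Jordan_exponential[of X])
  note ep = ep[rule_format] and gi = gi[rule_format] and dg = dg[rule_format]
  have ginv: "invertible (g z w)" for z w
    using gi by (auto simp: invertible_right_inverse)
  have gr: "g (of_real r) (of_real r) \<in> H" for r :: real
  proof -
    define G where "G t = g (of_real t * of_real r) (of_real t * of_real r)" for t :: real
    have rX: "of_real r *\<^sub>C S + of_real r *\<^sub>C N = r *\<^sub>R X"
      by (simp add: SN(1) cscale_of_real scaleR_add_right)
    have "(G has_vector_derivative (r *\<^sub>R X) ** G s - G s ** 0) (at s)" for s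
      using dg[of "of_real r" "of_real r" s] by (simp add: G_def[abs_def] rX)
    then have "infdist (G 1) H \<le> exp (norm (r *\<^sub>R X) * (1 - 0)) * infdist (G 0) H"
      by (intro infdist_invariance[where X="\<lambda>s. r *\<^sub>R X" and Y="\<lambda>s. 0"] alg_group_nonempty
          lie_algebra_curves lie_algebra_scaleR X lie_algebra_0) auto
    moreover have "infdist (G 0) H = 0" by (simp add: G_def g0 alg_group_one)
    ultimately have "infdist (G 1) H = 0"
      using infdist_nonneg[of "G 1" H] by simp
    then show ?thesis
      using alg_group_closed[of "G 1"] ginv by (simp add: G_def)
  qed
  have gH: "g z w \<in> H" for z w
  proof -
    obtain P where P: "\<And>f. f \<in> P \<Longrightarrow> polynomial_map f" "H = {g \<in> carrier GL. \<forall>f\<in>P. f g = 0}"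
      using H by (auto simp: algebraic_group_def)
    have "f (g z w) = 0" if "f \<in> P" for f
      by (rule exp_poly_eq_0[OF exp_poly_polynomial_map[OF P(1)[OF that] ep]])
        (use gr that P(2) in auto)
    then show ?thesis using ginv by (simp add: P(2) GL_def)
  qed
  have sub: "z *\<^sub>C S + w *\<^sub>C N \<in> lie_algebra H" for z w
    by (rule lie_algebraI[of "\<lambda>t. g (of_real t * z) (of_real t * w)"])
      (use dg[of z w 0] in \<open>auto simp: gH g0\<close>)
  have br: "X ** Y - Y ** X \<in> lie_algebra H" if Y: "Y \<in> lie_algebra H" for Y
  proof -
    define G where "G t = g (of_real t) (of_real t)" for t :: real
    define \<phi> where "\<phi> t = G t ** Y ** G (- t)" for t
    have dG: "(G has_vector_derivative X) (at 0)"
      using dg[of 1 1 0] by (simp add: G_def[abs_def] SN(1) g0)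
    have dG': "((\<lambda>t. G (- t)) has_vector_derivative - X) (at 0)"
      using dg[of "- 1" "- 1" 0] by (simp add: G_def SN(1) g0)
    have G0: "G 0 = mat 1" by (simp add: G_def g0)
    have "(\<phi> has_vector_derivative G 0 ** Y ** - X + (X ** Y) ** G (- 0)) (at 0)"
      unfolding \<phi>_def
      by (intro mm.has_vector_derivative dG'
          bounded_linear.has_vector_derivative[OF mm.bounded_linear_left dG])
    then have "(\<phi> has_vector_derivative X ** Y - Y ** X) (at 0)"
      by (simp add: G0 mring)
    from has_vector_derivative_imp_quotient[OF this]
    have lim: "((\<lambda>t. (\<phi> t - \<phi> 0) /\<^sub>R t) \<longlongrightarrow> X ** Y - Y ** X) (at 0)" .
    have "\<phi> t \<in> lie_algebra H" for t
    proof -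
      obtain c where c: "\<forall>t. c t \<in> H" "c 0 = mat 1" "(c has_vector_derivative Y) (at (0::real))"
        using Y by (rule lie_algebraE)
      show ?thesis
      proof (rule lie_algebraI[of "\<lambda>s. G t ** c s ** G (- t)"])
        show "G t ** c s ** G (- t) \<in> H" for s
          by (intro alg_group_mult) (auto simp: G_def gH c)
        show "G t ** c 0 ** G (- t) = mat 1"
          using gi[of "of_real t" "of_real t"] by (simp add: G_def c)
        show "((\<lambda>s. G t ** c s ** G (- t)) has_vector_derivative \<phi> t) (at 0)"
          unfolding \<phi>_def
          by (rule bounded_linear.has_vector_derivative[OF mm.bounded_linear_left
                bounded_linear.has_vector_derivative[OF mm.bounded_linear_right c(3)]])
      qed
    qed
    then have "(\<phi> t - \<phi> 0) /\<^sub>R t \<in> lie_algebra H" for t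
      using lie_algebra_add[OF _ lie_algebra_uminus, of "\<phi> t" "\<phi> 0"] by (simp add: lie_algebra_scaleR)
    \<comment> \<open>The commutator is a limit of difference quotients, each in
      \<open>lie_algebra H\<close>; a finite-dimensional real subspace contains such limits.\<close>
    moreover have "closed (lie_algebra H)"
      by (rule closed_subspace)
        (auto simp: subspace_def lie_algebra_0 lie_algebra_add lie_algebra_scaleR)
    ultimately show ?thesis
      using Lim_in_closed_set[OF _ _ _ lim] by (simp add: trivial_limit_at)
  qed
  show ?thesis
    by (rule that[OF SN sub br])
qed

text \<open>Real curves give closure under real multiples only; complex multiples come from
  \<open>z = w = c\<close> in the Jordan decomposition.\<close>

lemma lie_algebra_cscale: "X \<in> lie_algebra H \<Longrightarrow> c *\<^sub>C X \<in> lie_algebra H"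
proof (erule lie_algebra_Jordan)
  fix S N
  assume "X = S + N" "\<And>z w. z *\<^sub>C S + w *\<^sub>C N \<in> lie_algebra H"
  then show "c *\<^sub>C X \<in> lie_algebra H" by (simp add: cscale_distrib)
qed

lemma lie_algebra_diff: "X \<in> lie_algebra H \<Longrightarrow> Y \<in> lie_algebra H \<Longrightarrow> X - Y \<in> lie_algebra H"
  using lie_algebra_add[OF _ lie_algebra_uminus, of X Y] by simp

lemma lie_algebra_commutator:
  "X \<in> lie_algebra H \<Longrightarrow> Y \<in> lie_algebra H \<Longrightarrow> X ** Y - Y ** X \<in> lie_algebra H"
  by (erule lie_algebra_Jordan) blast

lemma lie_algebra_Ad:
  assumes X: "X \<in> lie_algebra H" and h: "h \<in> H"
  shows "h ** X ** matrix_inv h \<in> lie_algebra H"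
proof -
  obtain c where c: "\<forall>t. c t \<in> H" "c 0 = mat 1" "(c has_vector_derivative X) (at (0::real))"
    using X by (rule lie_algebraE)
  show ?thesis
  proof (rule lie_algebraI[of "\<lambda>s. h ** c s ** matrix_inv h"])
    show "h ** c s ** matrix_inv h \<in> H" for s
      by (intro alg_group_mult alg_group_inv h c(1)[rule_format])
    show "h ** c 0 ** matrix_inv h = mat 1"
      by (simp add: c matrix_inv_mult alg_group_invertible h)
    show "((\<lambda>s. h ** c s ** matrix_inv h) has_vector_derivative h ** X ** matrix_inv h) (at 0)"
      by (rule bounded_linear.has_vector_derivative[OF mm.bounded_linear_left
            bounded_linear.has_vector_derivative[OF mm.bounded_linear_right c(3)]])
  qed
qed

end

section \<open>Matrix-valued functions and non-resonant equations\<close>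

definition hmat :: "(complex^3 \<Rightarrow> 'n::finite cmat) \<Rightarrow> bool" where
  "hmat F \<longleftrightarrow> (\<forall>i j. hol (\<lambda>p. F p $ i $ j))"

definition mpd :: "complex^3 \<Rightarrow> (complex^3 \<Rightarrow> 'n cmat) \<Rightarrow> complex^3 \<Rightarrow> 'n::finite cmat" where
  "mpd v F p = (\<chi> i j. pd v (\<lambda>q. F q $ i $ j) p)"

definition mE :: "(complex^3 \<Rightarrow> 'n cmat) \<Rightarrow> complex^3 \<Rightarrow> 'n::finite cmat" where
  "mE F p = mpd (E_vf p) F p"

definition mcf :: "nat \<Rightarrow> (complex^3 \<Rightarrow> 'n cmat) \<Rightarrow> complex^3 \<Rightarrow> 'n::finite cmat" where
  "mcf k F p = (\<chi> i j. cf k (\<lambda>q. F q $ i $ j) p)"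

lemma hmat_entry: "hmat F \<Longrightarrow> hol (\<lambda>p. F p $ i $ j)"
  by (simp add: hmat_def)

lemma mpd_nth: "mpd v F p $ i $ j = pd v (\<lambda>q. F q $ i $ j) p"
  and mcf_nth: "mcf k F p $ i $ j = cf k (\<lambda>q. F q $ i $ j) p"
  and mE_nth: "mE F p $ i $ j = Ef (\<lambda>q. F q $ i $ j) p"
  by (simp_all add: mpd_def mcf_def mE_def Ef_def)

lemma matrix_eq_sum: "M = (\<Sum>i\<in>UNIV. \<Sum>j\<in>UNIV. M $ i $ j *\<^sub>C axis i (axis j 1))"
  for M :: "'n::finite cmat"
proof -
  have "(\<Sum>i\<in>UNIV. \<Sum>j\<in>UNIV. (M $ i $ j *\<^sub>C axis i (axis j 1)) $ k $ l) = M $ k $ l" for k l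
  proof -
    have "(M $ i $ j *\<^sub>C (axis i (axis j 1) :: 'n cmat)) $ k $ l
        = (if j = l then if i = k then M $ i $ j else 0 else 0)" for i j
      by (auto simp: axis_def)
    then show ?thesis by (simp only:) (simp add: sum.delta)
  qed
  then show ?thesis by (simp add: vec_eq_iff sum_component)
qed

lemma norm_matrix_le_sum: "norm M \<le> (\<Sum>i\<in>UNIV. \<Sum>j\<in>UNIV. norm (M $ i $ j))"
  for M :: "'n::finite cmat"
proof -
  have a: "norm (axis i x) = norm x" for i :: 'n and x :: "'b::real_normed_vector"
  proof -
    have "(norm (axis i x $ k))\<^sup>2 = (if k = i then (norm x)\<^sup>2 else 0)" for k
      by (simp add: axis_def)
    then show ?thesis by (simp only: norm_vec_def L2_set_def) simp
  qed
  have "norm (\<Sum>i\<in>UNIV. \<Sum>j\<in>UNIV. M $ i $ j *\<^sub>C (axis i (axis j 1) :: 'n cmat))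
      \<le> (\<Sum>i\<in>UNIV. \<Sum>j\<in>UNIV. norm (M $ i $ j))"
    by (intro sum_norm_le) (simp add: a)
  then show ?thesis by (simp only: matrix_eq_sum[of M, symmetric])
qed

lemma norm_entry_le: "norm (M $ i $ j) \<le> norm M" for M :: "'n::finite cmat"
  using Finite_Cartesian_Product.norm_nth_le[of M i] Finite_Cartesian_Product.norm_nth_le[of "M $ i" j]
  by (rule order_trans[rotated])

lemma clin_expand:
  assumes "clin T"
  shows "T M = (\<Sum>i\<in>UNIV. \<Sum>j\<in>UNIV. M $ i $ j *\<^sub>C T (axis i (axis j 1)))"
proof -
  have "T M = T (\<Sum>i\<in>UNIV. \<Sum>j\<in>UNIV. M $ i $ j *\<^sub>C axis i (axis j 1))"
    by (simp only: matrix_eq_sum[of M, symmetric])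
  then show ?thesis by (simp only: clin_sum[OF assms] clinD(2)[OF assms])
qed

lemma hmat_const [simp]: "hmat (\<lambda>p. M)"
  by (simp add: hmat_def)

lemma hmat_add: "hmat F \<Longrightarrow> hmat G \<Longrightarrow> hmat (\<lambda>p. F p + G p)"
  and hmat_diff: "hmat F \<Longrightarrow> hmat G \<Longrightarrow> hmat (\<lambda>p. F p - G p)"
  and hmat_cscale: "hol c \<Longrightarrow> hmat F \<Longrightarrow> hmat (\<lambda>p. c p *\<^sub>C F p)"
  and hmat_mm: "hmat F \<Longrightarrow> hmat G \<Longrightarrow> hmat (\<lambda>p. F p ** G p)"
  by (simp_all add: hmat_def matrix_matrix_mult_def hol_add hol_diff hol_mult hol_sum)

lemma hmat_sum: "(\<And>i. i \<in> I \<Longrightarrow> hmat (F i)) \<Longrightarrow> hmat (\<lambda>p. \<Sum>i\<in>I. F i p)"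
  by (induction I rule: infinite_finite_induct) (auto intro: hmat_add)

lemma hmat_clin:
  assumes "clin T" "hmat F"
  shows "hmat (\<lambda>p. T (F p))"
  by (subst ext[OF clin_expand[OF assms(1), of "F _"]])
    (intro hmat_sum hmat_cscale hmat_entry assms hmat_const)

lemma hmat_mcf: "hmat F \<Longrightarrow> hmat (mcf k F)"
  by (simp add: hmat_def mcf_nth hol_cf)

lemma hmat_has_derivative:
  assumes "hmat F"
  shows "(F has_derivative (\<lambda>v. mpd v F p)) (at p)"
proof -
  have "((\<lambda>p. \<Sum>i\<in>UNIV. \<Sum>j\<in>UNIV. F p $ i $ j *\<^sub>C axis i (axis j 1)) has_derivative
      (\<lambda>v. \<Sum>i\<in>UNIV. \<Sum>j\<in>UNIV. pd v (\<lambda>q. F q $ i $ j) p *\<^sub>C axis i (axis j 1))) (at p)"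
    by (intro has_derivative_sum bounded_linear.has_derivative[OF bounded_linear_cscale]
        hol_has_derivative hmat_entry[OF assms])
  moreover have "mpd v F p = (\<Sum>i\<in>UNIV. \<Sum>j\<in>UNIV. pd v (\<lambda>q. F q $ i $ j) p *\<^sub>C axis i (axis j 1))" for v
    using matrix_eq_sum[of "mpd v F p"] by (simp only: mpd_nth)
  ultimately show ?thesis by (simp only: matrix_eq_sum[symmetric])
qed

lemma mpd_add: "hmat F \<Longrightarrow> hmat G \<Longrightarrow> mpd v (\<lambda>p. F p + G p) p = mpd v F p + mpd v G p"
  and mpd_diff: "hmat F \<Longrightarrow> hmat G \<Longrightarrow> mpd v (\<lambda>p. F p - G p) p = mpd v F p - mpd v G p"
  and mpd_cscale: "hol c \<Longrightarrow> hmat F \<Longrightarrow> mpd v (\<lambda>p. c p *\<^sub>C F p) p = pd v c p *\<^sub>C F p + c p *\<^sub>C mpd v F p"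
  and mpd_const: "mpd v (\<lambda>p. M) p = 0"
  by (simp_all add: vec_eq_iff mpd_nth pd_plus pd_diff pd_mult hmat_entry)

lemma mpd_mm:
  assumes "hmat F" "hmat G"
  shows "mpd v (\<lambda>p. F p ** G p) p = mpd v F p ** G p + F p ** mpd v G p"
proof -
  have "mpd v (\<lambda>p. F p ** G p) p $ i $ j = (mpd v F p ** G p + F p ** mpd v G p) $ i $ j" for i j
    using assms
    by (simp add: mpd_nth matrix_matrix_mult_def pd_sum pd_mult hol_mult hmat_entry sum.distrib)
  then show ?thesis by (simp add: vec_eq_iff)
qed

lemma hmat_continuous: "hmat F \<Longrightarrow> continuous_on A F"
  by (meson continuous_at_imp_continuous_on has_derivative_continuous hmat_has_derivative)

lemma mcf_0 [simp]: "mcf 0 F p = F 0"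
  by (simp add: vec_eq_iff mcf_nth)

lemma mcf_const: "mcf k (\<lambda>p. M) p = (if k = 0 then M else 0)"
  by (simp add: vec_eq_iff mcf_nth cf_const)

lemma mcf_add: "hmat F \<Longrightarrow> hmat G \<Longrightarrow> mcf k (\<lambda>p. F p + G p) p = mcf k F p + mcf k G p"
  by (simp add: vec_eq_iff mcf_nth cf_add hmat_entry)

lemma mcf_diff: "hmat F \<Longrightarrow> hmat G \<Longrightarrow> mcf k (\<lambda>p. F p - G p) p = mcf k F p - mcf k G p"
  by (simp add: vec_eq_iff mcf_nth cf_diff hmat_entry)

lemma mcf_mm:
  assumes "hmat F" "hmat G"
  shows "mcf k (\<lambda>p. F p ** G p) p = (\<Sum>i\<le>k. mcf i F p ** mcf (k - i) G p)"
proof -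
  have "mcf k (\<lambda>p. F p ** G p) p $ a $ b = (\<Sum>i\<le>k. mcf i F p ** mcf (k - i) G p) $ a $ b" for a b
  proof -
    have "mcf k (\<lambda>p. F p ** G p) p $ a $ b
        = (\<Sum>l\<in>UNIV. \<Sum>i\<le>k. mcf i F p $ a $ l * mcf (k - i) G p $ l $ b)"
      using assms by (simp add: mcf_nth matrix_matrix_mult_def cf_sum cf_mult hmat_entry hol_mult)
    also have "\<dots> = (\<Sum>i\<le>k. \<Sum>l\<in>UNIV. mcf i F p $ a $ l * mcf (k - i) G p $ l $ b)"
      by (rule sum.swap)
    finally show ?thesis by (simp add: sum_component matrix_matrix_mult_def)
  qed
  then show ?thesis by (simp add: vec_eq_iff)
qed

lemma mcf_sum: "(\<And>i. i \<in> I \<Longrightarrow> hmat (F i)) \<Longrightarrow> mcf k (\<lambda>p. \<Sum>i\<in>I. F i p) p = (\<Sum>i\<in>I. mcf k (F i) p)"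
  by (simp add: vec_eq_iff mcf_nth cf_sum hmat_entry sum_component)

lemma mcf_clin:
  assumes "clin T" "hmat F"
  shows "mcf k (\<lambda>p. T (F p)) p = T (mcf k F p)"
proof -
  have 1: "mcf k (\<lambda>p. F p $ i $ j *\<^sub>C M) p = mcf k F p $ i $ j *\<^sub>C M" for i j and M :: "'a cmat"
    using cf_cmult[OF hmat_entry[OF assms(2)], of k _ i j p]
    by (simp add: vec_eq_iff mcf_nth mult.commute)
  have h: "hmat (\<lambda>p. F p $ i $ j *\<^sub>C M)" for i j and M :: "'a cmat"
    by (intro hmat_cscale hmat_const hmat_entry assms)
  have "mcf k (\<lambda>p. T (F p)) p
      = mcf k (\<lambda>p. \<Sum>i\<in>UNIV. \<Sum>j\<in>UNIV. F p $ i $ j *\<^sub>C T (axis i (axis j 1))) p"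
    by (simp only: clin_expand[OF assms(1), of "F _", symmetric])
  also have "\<dots> = (\<Sum>i\<in>UNIV. \<Sum>j\<in>UNIV. mcf k F p $ i $ j *\<^sub>C T (axis i (axis j 1)))"
    by (simp only: mcf_sum hmat_sum h 1)
  also have "\<dots> = T (mcf k F p)"
    by (rule clin_expand[OF assms(1), symmetric])
  finally show ?thesis .
qed

lemma mcf_mE: "hmat F \<Longrightarrow> mcf k (mE F) p = of_nat k *\<^sub>C mcf k F p"
  by (simp add: vec_eq_iff mcf_nth mE_nth cf_Ef hmat_entry)

lemma mcf_mcf: "hmat F \<Longrightarrow> mcf j (mcf k F) p = (if j = k then mcf k F p else 0)"
  by (simp add: vec_eq_iff mcf_nth cf_cf hmat_entry)

lemma mcf_dil: "hmat F \<Longrightarrow> mcf k F (dil t p) = t ^ k *\<^sub>C mcf k F p"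
  by (simp add: vec_eq_iff mcf_nth cf_dil hmat_entry mult.commute)

lemma mcf_ext: "hmat F \<Longrightarrow> hmat G \<Longrightarrow> (\<And>k. mcf k F p = mcf k G p) \<Longrightarrow> F p = G p"
proof -
  assume F: "hmat F" and G: "hmat G" and e: "\<And>k. mcf k F p = mcf k G p"
  have "F p $ i $ j = G p $ i $ j" for i j
    by (rule cf_ext[OF hmat_entry[OF F] hmat_entry[OF G]]) (simp only: mcf_nth[symmetric] e)
  then show ?thesis by (simp add: vec_eq_iff)
qed

lemma E_vf_nth [simp]: "E_vf p $ 1 = p $ 1" "E_vf p $ 2 = 2 * p $ 2" "E_vf p $ 3 = 3 * p $ 3"
  by (simp_all add: E_vf_def)

lemma hol_pd_field:
  assumes "hol f" "\<And>i. hol (\<lambda>p. Z p $ i)"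
  shows "hol (\<lambda>p. pd (Z p) f p)"
  by (subst ext[OF pd_expand[OF assms(1), of "Z _"]]) (auto intro!: hol_sum hol_mult assms)

lemma hol_E_vf: "hol (\<lambda>p. E_vf p $ i)"
  using exhaust_3[of i] hol_mult[OF hol_const hol_coord] by auto

lemma hmat_mE: "hmat F \<Longrightarrow> hmat (mE F)"
  unfolding hmat_def mE_nth Ef_def by (intro allI hol_pd_field hol_E_vf) blast

lemma mcf_bound:
  assumes "hmat F"
  shows "\<exists>M\<ge>0. \<forall>k. \<forall>p\<in>cball 0 r. norm (mcf k F p) \<le> M / 2 ^ k"
proof -
  have "\<forall>i j. \<exists>M\<ge>0. \<forall>k. \<forall>p\<in>cball 0 r. norm (mcf k F p $ i $ j) \<le> M / 2 ^ k"
    unfolding mcf_nth using cf_bound[OF hmat_entry[OF assms]] by blast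
  then obtain M where M: "\<And>i j. M i j \<ge> 0"
    "\<And>i j k p. p \<in> cball 0 r \<Longrightarrow> norm (mcf k F p $ i $ j) \<le> M i j / 2 ^ k"
    by metis
  show ?thesis
  proof (intro exI[of _ "\<Sum>i\<in>UNIV. \<Sum>j\<in>UNIV. M i j"] conjI allI ballI)
    show "(\<Sum>i\<in>UNIV. \<Sum>j\<in>UNIV. M i j) \<ge> 0" by (intro sum_nonneg M)
    fix k and p :: "complex^3" assume "p \<in> cball 0 r"
    then have "norm (mcf k F p) \<le> (\<Sum>i\<in>UNIV. \<Sum>j\<in>UNIV. M i j / 2 ^ k)"
      by (intro order_trans[OF norm_matrix_le_sum] sum_mono M)
    then show "norm (mcf k F p) \<le> (\<Sum>i\<in>UNIV. \<Sum>j\<in>UNIV. M i j) / 2 ^ k"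
      by (simp add: sum_divide_distrib)
  qed
qed

lemma vanishing_order_bound:
  assumes f: "hol f" and k0: "k0 > 0" and z: "\<And>k. 0 < k \<Longrightarrow> k < k0 \<Longrightarrow> cf k f p = 0"
  shows "\<exists>C. \<forall>t. norm t \<le> 1 \<longrightarrow> norm (f (dil t p) - f 0) \<le> C * norm t ^ k0"
proof -
  obtain M where M: "M \<ge> 0" "\<And>k. norm (cf k f p) \<le> M / 2 ^ k"
    using cf_bound[OF f, of "norm p"] by auto
  have s: "summable (\<lambda>k. M * (1 / 2) ^ (k + k0))"
    by (intro summable_ignore_initial_segment summable_mult summable_geometric) auto
  have "norm (f (dil t p) - f 0) \<le> (\<Sum>k. M * (1 / 2) ^ (k + k0)) * norm t ^ k0" if t: "norm t \<le> 1" for t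
  proof -
    have "(\<lambda>k. cf (k + k0) f p * t ^ (k + k0)) sums
        (f (dil t p) - (\<Sum>k<k0. cf k f p * t ^ k))"
      using cf_sums[OF f] by (rule sums_split_initial_segment)
    also have "(\<Sum>k<k0. cf k f p * t ^ k) = (\<Sum>k\<in>{0}. cf k f p * t ^ k)"
      using k0 z by (intro sum.mono_neutral_right) auto
    finally have sm: "(\<lambda>k. cf (k + k0) f p * t ^ (k + k0)) sums (f (dil t p) - f 0)" by simp
    have "norm (cf (k + k0) f p * t ^ (k + k0)) \<le> M * (1 / 2) ^ (k + k0) * norm t ^ k0" for k
    proof -
      have "norm t ^ (k + k0) \<le> norm t ^ k0"
        using t by (intro power_decreasing) auto
      moreover have "norm (cf (k + k0) f p) \<le> M * (1 / 2) ^ (k + k0)"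
        using M(2)[of "k + k0"] by (simp add: power_divide)
      ultimately show ?thesis
        using M(1) unfolding norm_mult norm_power by (intro mult_mono) auto
    qed
    then have "norm (\<Sum>k. cf (k + k0) f p * t ^ (k + k0)) \<le> (\<Sum>k. M * (1 / 2) ^ (k + k0) * norm t ^ k0)"
      by (intro norm_suminf_le summable_mult2 s)
    then show ?thesis
      using sm s by (simp add: sums_iff suminf_mult2)
  qed
  then show ?thesis by blast
qed


lemma hmat_vanishing_order_bound:
  assumes F: "hmat F" and k0: "k0 > 0" and z: "\<And>k. 0 < k \<Longrightarrow> k < k0 \<Longrightarrow> mcf k F p = 0"
  shows "\<exists>C. \<forall>t. norm t \<le> 1 \<longrightarrow> norm (F (dil t p) - F 0) \<le> C * norm t ^ k0"
proof -
  have "\<forall>i j. \<exists>C. \<forall>t. norm t \<le> 1 \<longrightarrow> norm (F (dil t p) $ i $ j - F 0 $ i $ j) \<le> C * norm t ^ k0"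
    using vanishing_order_bound[OF hmat_entry[OF F] k0] z by (simp add: mcf_nth[symmetric])
  then obtain C where C:
    "\<And>i j t. norm t \<le> 1 \<Longrightarrow> norm (F (dil t p) $ i $ j - F 0 $ i $ j) \<le> C i j * norm t ^ k0"
    by metis
  have "norm (F (dil t p) - F 0) \<le> (\<Sum>i\<in>UNIV. \<Sum>j\<in>UNIV. C i j) * norm t ^ k0" if "norm t \<le> 1" for t
  proof -
    have "norm (F (dil t p) - F 0) \<le> (\<Sum>i\<in>UNIV. \<Sum>j\<in>UNIV. C i j * norm t ^ k0)"
      by (rule order_trans[OF norm_matrix_le_sum], intro sum_mono) (simp add: C that)
    then show ?thesis by (simp only: sum_distrib_right)
  qed
  then show ?thesis by blast
qed

text \<open>The substitution \<open>t = exp s\<close> turns \<open>E\<close> into the derivative by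
  the real time \<open>s\<close> and moves the singular point \<open>t = 0\<close> to minus
  infinity, so that estimates for ordinary differential equations apply.\<close>

lemma has_vector_derivative_orbit:
  assumes F: "hmat F"
  shows "((\<lambda>s. F (dil (of_real (exp s)) p)) has_vector_derivative mE F (dil (of_real (exp s)) p)) (at s)"
proof -
  have d: "((\<lambda>s. f (dil (of_real (exp s)) p)) has_vector_derivative Ef f (dil (of_real (exp s)) p)) (at s)"
    if f: "hol f" for f
  proof -
    have "((\<lambda>x. f (dil (exp x) p)) has_field_derivative
        deriv (\<lambda>t. f (dil t p)) (exp (of_real s)) * exp (of_real s)) (at (of_real s))"
      by (intro DERIV_chain2[where f="\<lambda>t. f (dil t p)"] DERIV_exp holomorphic_derivI[of _ UNIV]
          holomorphic_dil f) auto
    then have "((\<lambda>s. f (dil (exp (of_real s)) p)) has_vector_derivative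
        deriv (\<lambda>t. f (dil t p)) (exp (of_real s)) * exp (of_real s)) (at s)"
      by (rule has_vector_derivative_real_field)
    then show ?thesis
      by (simp add: Ef_dil[OF f] exp_of_real mult.commute)
  qed
  have "((\<lambda>s. \<Sum>i\<in>UNIV. \<Sum>j\<in>UNIV. F (dil (of_real (exp s)) p) $ i $ j *\<^sub>C axis i (axis j 1))
      has_vector_derivative
      (\<Sum>i\<in>UNIV. \<Sum>j\<in>UNIV. mE F (dil (of_real (exp s)) p) $ i $ j *\<^sub>C axis i (axis j 1))) (at s)"
    unfolding mE_nth
    by (intro has_vector_derivative_sum bounded_linear.has_vector_derivative[OF bounded_linear_cscale]
        d hmat_entry[OF F])
  then show ?thesis by (simp only: matrix_eq_sum[symmetric])
qed

text \<open>Course-of-values recursion over the weights. The cut-off with \<open>undefined\<close>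
  expresses that the value at \<open>k\<close> may depend on all smaller indices and on nothing
  else.\<close>

lemma strong_recursion_exists: "\<exists>f. \<forall>k::nat. f k = R (\<lambda>j. if j < k then f j else undefined) k"
proof -
  have "wfrec less_than R k = R (\<lambda>j. if j < k then wfrec less_than R j else undefined) k" for k
    by (subst wfrec[OF wf_less_than]) (simp add: cut_def)
  then show ?thesis by blast
qed

lemma clin_bounded_below_inverse:
  assumes T: "clin T" and c: "c > 0" and b: "\<And>Z. norm (T Z) \<ge> c * norm Z"
  shows "\<exists>I. clin I \<and> (\<forall>W. T (I W) = W) \<and> (\<forall>W. norm (I W) \<le> norm W / c)"
proof -
  have "inj T"
    unfolding linear_injective_0[OF clin_linear[OF T]]
    using b c by (metis norm_zero mult_le_0_iff norm_le_zero_iff not_less)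
  then obtain I where I: "linear I" "\<And>x. I (T x) = x" "\<And>x. T (I x) = x"
    using linear_injective_isomorphism[OF clin_linear[OF T]] by metis
  have "I (a *\<^sub>C W) = a *\<^sub>C I W" for a W
  proof -
    have "I (a *\<^sub>C W) = I (T (a *\<^sub>C I W))" by (simp add: clinD[OF T] I)
    then show ?thesis by (simp add: I)
  qed
  then have "clin I" using I(1) by (intro clinI) (auto simp: linear_add)
  moreover have "norm (I W) \<le> norm W / c" for W
    using b[of "I W"] c by (simp add: I field_simps)
  ultimately show ?thesis using I(3) by blast
qed

text \<open>Coefficients of ratio 1/2 are convolved with a solution of ratio 3/4. As the second
  ratio is larger, the sum keeps it, at the price of a factor that does not depend on
  \<open>k\<close>.\<close>

lemma geometric_convolution_bound: "(\<Sum>j<k. (1/2) ^ (k - j) * (3/4) ^ j) \<le> 2 * (3/4 :: real) ^ k"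
proof (induction k)
  case (Suc k)
  have "(\<Sum>j<k. (1/2) ^ (Suc k - j) * (3/4) ^ j) = 1/2 * (\<Sum>j<k. (1/2) ^ (k - j) * (3/4 :: real) ^ j)"
    unfolding sum_distrib_left by (intro sum.cong) (auto simp: Suc_diff_le)
  then show ?case using Suc by simp
qed simp

text \<open>The equation \<open>E h = Y1 h - h Y2\<close> is solved by comparing weighted Taylor coefficients. From
  order \<open>k0\<close> on there is no resonance, and the recursion even yields geometric decay.\<close>

lemma nonresonant_solution:
  fixes Y1 Y2 :: "complex^3 \<Rightarrow> 'n::finite cmat"
  assumes Y: "hmat Y1" "hmat Y2" and k0: "k0 > 0" "norm (Y1 0) + norm (Y2 0) < real k0"
    and eq: "\<And>k p. k < k0 \<Longrightarrow> mcf k Y1 p = mcf k Y2 p"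
  obtains h where "hmat h" "h 0 = mat 1" "\<forall>k p. 0 < k \<longrightarrow> k < k0 \<longrightarrow> mcf k h p = 0"
    "\<forall>p. mE h p = Y1 p ** h p - h p ** Y2 p"
proof -
  define M0 where "M0 = norm (Y1 0) + norm (Y2 0)"
  \<comment> \<open>In weight \<open>k\<close> the equation reads \<open>T k h_k = G h k\<close>,
    where \<open>G\<close> collects the contributions of the lower weights of
    \<open>h\<close>.\<close>
  define T where "T k Z = of_nat k *\<^sub>C Z - (Y1 0 ** Z - Z ** Y2 0)" for k Z
  have T: "clin (T k)" for k
    unfolding T_def by (intro clin_diff clin_cscale clin_mult_left clin_mult_right)
  have Tb: "norm (T k Z) \<ge> (real k - M0) * norm Z" for k Z
  proof -
    have "norm (Y1 0 ** Z - Z ** Y2 0) \<le> norm (Y1 0) * norm Z + norm Z * norm (Y2 0)"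
      by (intro order_trans[OF norm_triangle_ineq4] add_mono norm_matrix_mult)
    moreover have "norm (T k Z) \<ge> real k * norm Z - norm (Y1 0 ** Z - Z ** Y2 0)"
      unfolding T_def using norm_triangle_ineq2[of "of_nat k *\<^sub>C Z" "Y1 0 ** Z - Z ** Y2 0"] by simp
    ultimately show ?thesis by (simp add: M0_def algebra_simps)
  qed
  have "\<exists>I. k \<ge> k0 \<longrightarrow> clin I \<and> (\<forall>W. T k (I W) = W) \<and> (\<forall>W. norm (I W) \<le> norm W / (real k - M0))" for k
  proof (cases "k \<ge> k0")
    case True
    then have "real k - M0 > 0" using k0(2) by (simp add: M0_def)
    from clin_bounded_below_inverse[OF T this Tb] show ?thesis by blast
  qed simp
  then obtain I where I: "\<And>k. k \<ge> k0 \<Longrightarrow> clin (I k)" "\<And>k W. k \<ge> k0 \<Longrightarrow> T k (I k W) = W"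
    "\<And>k W. k \<ge> k0 \<Longrightarrow> norm (I k W) \<le> norm W / (real k - M0)" by metis
  define G where "G f k p = (\<Sum>j<k. mcf (k - j) Y1 p ** f j p - f j p ** mcf (k - j) Y2 p)"
    for f :: "nat \<Rightarrow> complex^3 \<Rightarrow> 'n cmat" and k p
  have Gcong: "G f k = G f' k" if "\<And>j. j < k \<Longrightarrow> f j = f' j" for f f' k
    unfolding G_def using that by (intro ext sum.cong) auto
  \<comment> \<open>Weights between 0 and \<open>k0\<close> can be set to zero: \<open>Y1\<close>
    and \<open>Y2\<close> agree below \<open>k0\<close>, so \<open>mat 1\<close> alone solves the
    equation up to that order.\<close>
  define R where "R f k = (if k = 0 then (\<lambda>p. mat 1) else if k < k0 then (\<lambda>p. 0) else (\<lambda>p. I k (G f k p)))"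
    for f k
  obtain hc where "\<forall>k. hc k = R (\<lambda>j. if j < k then hc j else undefined) k"
    using strong_recursion_exists[of R] by blast
  moreover have "G (\<lambda>j. if j < k then hc j else undefined) k = G hc k" for k
    by (rule Gcong) simp
  ultimately have hc: "hc k = (if k = 0 then (\<lambda>p. mat 1) else if k < k0 then (\<lambda>p. 0)
      else (\<lambda>p. I k (G hc k p)))" for k
    by (simp add: R_def)
  have hh: "hmat (hc k)" for k
  proof (induction k rule: less_induct)
    case (less k)
    have "hmat (G hc k)"
      unfolding G_def[abs_def] by (intro hmat_sum hmat_diff hmat_mm hmat_mcf Y less.IH) auto
    then have "hmat (\<lambda>p. I k (G hc k p))" if "k \<ge> k0" using that by (intro hmat_clin[OF I(1)])
    then show ?case by (subst hc) simp
  qed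
  have dil: "hc k (dil t p) = t ^ k *\<^sub>C hc k p" for k t p
  proof (induction k rule: less_induct)
    case (less k)
    have "G hc k (dil t p) = t ^ k *\<^sub>C G hc k p"
      unfolding G_def cscale_sum
    proof (intro sum.cong refl)
      fix j assume j: "j \<in> {..<k}"
      have "t ^ (k - j) * t ^ j = t ^ k" using j by (simp flip: power_add)
      then show "mcf (k - j) Y1 (dil t p) ** hc j (dil t p) - hc j (dil t p) ** mcf (k - j) Y2 (dil t p)
          = t ^ k *\<^sub>C (mcf (k - j) Y1 p ** hc j p - hc j p ** mcf (k - j) Y2 p)"
        using less.IH[of j] j
        by (simp add: mcf_dil Y cscale_distrib mult.commute[of "t ^ j"])
    qed
    then show ?case
      unfolding hc[of k] using clinD(2)[OF I(1), of k] by simp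
  qed
  have bound: "\<exists>Q\<ge>0. \<forall>k. \<forall>p\<in>cball 0 r. norm (hc k p) \<le> Q * (3/4) ^ k" for r
  proof -
    obtain M1 where M1: "M1 \<ge> 0" "\<And>k p. p \<in> cball 0 r \<Longrightarrow> norm (mcf k Y1 p) \<le> M1 / 2 ^ k"
      using mcf_bound[OF Y(1)] by metis
    obtain M2 where M2: "M2 \<ge> 0" "\<And>k p. p \<in> cball 0 r \<Longrightarrow> norm (mcf k Y2 p) \<le> M2 / 2 ^ k"
      using mcf_bound[OF Y(2)] by metis
    define M where "M = M1 + M2"
    \<comment> \<open>From \<open>k1\<close> on the inverse of \<open>T k\<close> gains a factor
      \<open>1 / (2 M)\<close>, which compensates the factor \<open>2 M\<close> of the
      convolution.\<close>
    obtain k1 where k1: "k1 \<ge> k0" "real k1 > M0 + 2 * M"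
      by (metis le_cases less_le_trans of_nat_le_iff reals_Archimedean2)
    have "\<forall>k. \<exists>B\<ge>0. \<forall>p\<in>cball 0 r. norm (hc k p) \<le> B"
    proof
      fix k
      have "compact (hc k ` cball 0 r)"
        by (intro compact_continuous_image hmat_continuous hh) auto
      then obtain B where "B > 0" "\<forall>x\<in>hc k ` cball 0 r. norm x \<le> B"
        using compact_imp_bounded bounded_pos by metis
      then show "\<exists>B\<ge>0. \<forall>p\<in>cball 0 r. norm (hc k p) \<le> B" by (intro exI[of _ B]) auto
    qed
    then obtain B where B: "\<And>k. B k \<ge> 0" "\<And>k p. p \<in> cball 0 r \<Longrightarrow> norm (hc k p) \<le> B k" by metis
    \<comment> \<open>\<open>Q\<close> is large enough for the finitely many weights below
      \<open>k1\<close>, where nothing but boundedness on the ball is known.\<close>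
    define Q where "Q = (\<Sum>k<k1. B k * (4/3) ^ k)"
    have Q0: "Q \<ge> 0" unfolding Q_def by (intro sum_nonneg mult_nonneg_nonneg B) auto
    have "norm (hc k p) \<le> Q * (3/4) ^ k" if p: "p \<in> cball 0 r" for k p
    proof (induction k rule: less_induct)
      case (less k)
      show ?case
      proof (cases "k < k1")
        case True
        have "B k * (4/3) ^ k \<le> Q"
          unfolding Q_def using True B
          by (intro member_le_sum[of k "{..<k1}" "\<lambda>k. B k * (4/3) ^ k"]) auto
        then have "B k * (4/3) ^ k * (3/4) ^ k \<le> Q * (3/4) ^ k" by (intro mult_right_mono) auto
        moreover have "(4/3) ^ k * (3/4) ^ k = (1::real)" by (simp flip: power_mult_distrib)
        ultimately show ?thesis using B(2)[OF p, of k] by (simp add: mult.assoc)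
      next
        case False
        then have k: "k \<ge> k0" "k > 0" "real k - M0 > 0" "real k - M0 \<ge> 2 * M"
          using k1 k0 M1(1) M2(1) by (auto simp: M_def)
        have "norm (G hc k p) \<le> (\<Sum>j<k. M * Q * ((1/2) ^ (k - j) * (3/4) ^ j))"
          unfolding G_def
        proof (rule sum_norm_le)
          fix j assume "j \<in> {..<k}"
          then have IH: "norm (hc j p) \<le> Q * (3/4) ^ j" by (intro less.IH) auto
          have "norm (mcf (k - j) Y1 p ** hc j p - hc j p ** mcf (k - j) Y2 p)
              \<le> M1 / 2 ^ (k - j) * (Q * (3/4) ^ j) + Q * (3/4) ^ j * (M2 / 2 ^ (k - j))"
            using M1 M2 p IH Q0
            by (intro order_trans[OF norm_triangle_ineq4] add_mono order_trans[OF norm_matrix_mult] mult_mono) auto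
          also have "\<dots> = M * Q * ((1/2) ^ (k - j) * (3/4) ^ j)"
            by (simp add: M_def power_divide) (simp add: algebra_simps add_divide_distrib)
          finally show "norm (mcf (k - j) Y1 p ** hc j p - hc j p ** mcf (k - j) Y2 p)
              \<le> M * Q * ((1/2) ^ (k - j) * (3/4) ^ j)" .
        qed
        also have "\<dots> \<le> M * Q * (2 * (3/4) ^ k)"
          unfolding sum_distrib_left[symmetric] using M1 M2 Q0
          by (intro mult_left_mono geometric_convolution_bound) (auto simp: M_def)
        also have "\<dots> \<le> (real k - M0) * (Q * (3/4) ^ k)"
          using mult_right_mono[OF k(4), of "Q * (3/4) ^ k"] Q0 by (simp add: mult_ac)
        finally have "norm (G hc k p) / (real k - M0) \<le> Q * (3/4) ^ k"
          using k by (simp add: divide_le_eq mult.commute)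
        then show ?thesis
          using I(3)[OF k(1), of "G hc k p"] k by (subst hc) simp
      qed
    qed
    then show ?thesis using Q0 by blast
  qed
  have sumQ: "summable (\<lambda>k. Q * (3/4 :: real) ^ k)" for Q
    by (intro summable_mult summable_geometric) auto
  define h where "h p = (\<chi> i j. \<Sum>k. hc k p $ i $ j)" for p
  have h: "hmat h"
    unfolding hmat_def h_def
  proof (intro allI, simp only: vec_lambda_beta, rule hol_suminf)
    fix i j k show "hol (\<lambda>p. hc k p $ i $ j)" by (rule hmat_entry[OF hh])
  next
    fix i j r
    obtain Q where "\<forall>k. \<forall>p\<in>cball 0 r. norm (hc k p) \<le> Q * (3/4) ^ k" using bound by blast
    then show "\<exists>M. summable M \<and> (\<forall>k. \<forall>p\<in>cball 0 r. norm (hc k p $ i $ j) \<le> M k)"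
      using sumQ[of Q] norm_entry_le order_trans by (intro exI[of _ "\<lambda>k. Q * (3/4) ^ k"]) blast
  qed
  have mh: "mcf k h p = hc k p" for k p
  proof -
    have "cf k (\<lambda>q. h q $ i $ j) p = hc k p $ i $ j" for i j
    proof (rule cf_eqI)
      fix t
      obtain Q where Q: "\<And>k. norm (hc k (dil t p)) \<le> Q * (3/4) ^ k"
        using bound[of "norm (dil t p)"] by (metis mem_cball_0 order_refl)
      have "summable (\<lambda>k. hc k (dil t p) $ i $ j)"
        by (rule summable_comparison_test'[OF sumQ[of Q], of 0])
          (rule order_trans[OF norm_entry_le Q])
      then have "(\<lambda>k. hc k (dil t p) $ i $ j) sums (h (dil t p) $ i $ j)"
        by (simp add: h_def summable_sums)
      then show "(\<lambda>k. hc k p $ i $ j * t ^ k) sums (h (dil t p) $ i $ j)"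
        by (simp add: dil mult.commute)
    qed
    then show ?thesis by (simp add: vec_eq_iff mcf_nth)
  qed
  have ode: "mE h p = Y1 p ** h p - h p ** Y2 p" for p
  proof (rule mcf_ext[OF hmat_mE[OF h] hmat_diff[OF hmat_mm[OF Y(1) h] hmat_mm[OF h Y(2)]]])
    fix k
    have s: "(\<Sum>i\<le>k. f i (k - i)) = f 0 k + (\<Sum>j<k. f (k - j) j)"
      for f :: "nat \<Rightarrow> nat \<Rightarrow> 'n cmat"
    proof -
      have "(\<Sum>i\<le>k. f i (k - i)) = (\<Sum>j\<le>k. f (k - j) j)"
        by (rule sum.reindex_bij_witness[of _ "\<lambda>j. k - j" "\<lambda>j. k - j"]) auto
      then show ?thesis by (simp add: lessThan_Suc_atMost[symmetric] add.commute)
    qed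
    have s': "(\<Sum>i\<le>k. f i (k - i)) = f k 0 + (\<Sum>j<k. f j (k - j))"
      for f :: "nat \<Rightarrow> nat \<Rightarrow> 'n cmat"
      by (simp add: lessThan_Suc_atMost[symmetric] add.commute)
    have "mcf k (\<lambda>p. Y1 p ** h p - h p ** Y2 p) p
        = (Y1 0 ** hc k p - hc k p ** Y2 0) + G hc k p"
      unfolding mcf_diff[OF hmat_mm[OF Y(1) h] hmat_mm[OF h Y(2)]] mcf_mm[OF Y(1) h] mcf_mm[OF h Y(2)]
        s[of "\<lambda>i j. mcf i Y1 p ** mcf j h p"] s'[of "\<lambda>i j. mcf i h p ** mcf j Y2 p"]
      by (simp add: mh G_def sum_subtractf)
    also have "\<dots> = of_nat k *\<^sub>C hc k p"
    proof (cases "k \<ge> k0")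
      case True
      then have "T k (hc k p) = G hc k p" using k0 by (subst hc) (simp add: I(2))
      then show ?thesis by (simp add: T_def algebra_simps)
    next
      case False
      have "G hc k p = (if k = 0 then 0 else mcf k Y1 p - mcf k Y2 p)"
      proof (cases k)
        case (Suc m)
        have "G hc k p = (\<Sum>j\<in>{0}. mcf (k - j) Y1 p ** hc j p - hc j p ** mcf (k - j) Y2 p)"
          unfolding G_def using False Suc
          by (intro sum.mono_neutral_right) (auto simp: hc)
        then show ?thesis using Suc by (simp add: hc[of 0])
      qed (simp add: G_def)
      then have "G hc k p = 0" using False eq[of k p] by simp
      moreover have "Y1 0 = Y2 0" using eq[of 0 p] k0 by simp
      ultimately show ?thesis using False by (simp add: hc[of k])
    qed
    finally show "mcf k (mE h) p = mcf k (\<lambda>p. Y1 p ** h p - h p ** Y2 p) p"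
      by (simp add: mcf_mE[OF h] mh)
  qed
  show ?thesis
  proof (rule that[OF h])
    show "h 0 = mat 1" using mh[of 0 0] by (simp add: hc[of 0])
    show "\<forall>k p. 0 < k \<longrightarrow> k < k0 \<longrightarrow> mcf k h p = 0" by (simp add: mh hc)
  qed (use ode in auto)
qed

section \<open>Gauge transformations and resonances\<close>

lemma orbit_bounds:
  assumes Y: "hmat Y1" "hmat Y2" and k: "norm (Y1 0) + norm (Y2 0) < \<kappa>"
  shows "\<exists>M \<mu> s0. s0 \<le> 0 \<and> \<mu> < \<kappa> \<and>
    (\<forall>s\<le>0. norm (Y1 (dil (of_real (exp s)) p)) + norm (Y2 (dil (of_real (exp s)) p)) \<le> M) \<and>
    (\<forall>s\<le>s0. norm (Y1 (dil (of_real (exp s)) p)) + norm (Y2 (dil (of_real (exp s)) p)) \<le> \<mu>)"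
proof -
  define f where "f t = norm (Y1 (dil (of_real t) p)) + norm (Y2 (dil (of_real t) p))" for t :: real
  have c: "continuous_on UNIV f"
    unfolding f_def
    by (intro continuous_intros continuous_on_compose2[OF hmat_continuous[OF Y(1), of UNIV]]
        continuous_on_compose2[OF hmat_continuous[OF Y(2), of UNIV]]) auto
  have "compact (f ` {0..1})"
    by (intro compact_continuous_image continuous_on_subset[OF c]) auto
  then obtain M where M: "\<And>t. 0 \<le> t \<Longrightarrow> t \<le> 1 \<Longrightarrow> f t \<le> M"
    using bounded_real[of "f ` {0..1}"] compact_imp_bounded
    by (metis abs_le_D1 atLeastAtMost_iff image_eqI)
  \<comment> \<open>A rate strictly between the value at the origin, approached as \<open>s\<close>
    tends to minus infinity, and the order \<open>\<kappa>\<close>.\<close>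
  define \<mu> where "\<mu> = (f 0 + \<kappa>) / 2"
  have \<mu>: "f 0 < \<mu>" "\<mu> < \<kappa>" using k by (auto simp: \<mu>_def f_def)
  have "isCont f 0" using c by (simp add: continuous_on_eq_continuous_at)
  then obtain d where d: "d > 0" "\<And>t. norm (t - 0) < d \<Longrightarrow> norm (f t - f 0) < \<mu> - f 0"
    using \<mu>(1) by (metis continuous_at_eps_delta diff_gt_0_iff_gt dist_norm)
  define s0 where "s0 = min 0 (ln (d / 2))"
  have "f (exp s) \<le> \<mu>" if "s \<le> s0" for s
  proof -
    have "exp s \<le> exp (ln (d / 2))" using that by (simp add: s0_def)
    then have "exp s < d" using d(1) by simp
    then have "norm (f (exp s) - f 0) < \<mu> - f 0" by (intro d(2)) simp
    then show ?thesis by simp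
  qed
  moreover have "f (exp s) \<le> M" if "s \<le> 0" for s using that by (intro M) auto
  moreover have "s0 \<le> 0" by (simp add: s0_def)
  ultimately show ?thesis using \<mu>(2) unfolding f_def by blast
qed

text \<open>The set \<open>Z\<close> is left open because the lemma is applied twice: to
  \<open>{0}\<close> it is a uniqueness theorem, and to \<open>H\<close> it gives membership in the
  group.\<close>

lemma orbit_solution_infdist:
  fixes F Y1 Y2 :: "complex^3 \<Rightarrow> 'n::finite cmat"
  assumes F: "hmat F" and Y: "hmat Y1" "hmat Y2"
    and k0: "k0 > 0" "norm (Y1 0) + norm (Y2 0) < real k0"
    and z: "\<And>k. 0 < k \<Longrightarrow> k < k0 \<Longrightarrow> mcf k F p = 0"
    and ode: "\<And>p. mE F p = Y1 p ** F p - F p ** Y2 p"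
    and Z: "F 0 \<in> Z"
    and c: "\<And>p. \<exists>cX cY. cX 0 = mat 1 \<and> cY 0 = mat 1 \<and>
      (cX has_vector_derivative Y1 p) (at (0::real)) \<and> (cY has_vector_derivative - Y2 p) (at (0::real)) \<and>
      (\<forall>d. \<forall>k\<in>Z. cX d ** k ** cY d \<in> Z)"
  shows "infdist (F p) Z = 0"
proof -
  obtain M \<mu> s0 where b: "s0 \<le> 0" "\<mu> < real k0"
    "\<And>s. s \<le> 0 \<Longrightarrow> norm (Y1 (dil (of_real (exp s)) p)) + norm (Y2 (dil (of_real (exp s)) p)) \<le> M"
    "\<And>s. s \<le> s0 \<Longrightarrow> norm (Y1 (dil (of_real (exp s)) p)) + norm (Y2 (dil (of_real (exp s)) p)) \<le> \<mu>"
    using orbit_bounds[OF Y k0(2), of p] by metis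
  obtain C where C: "\<And>t. norm t \<le> 1 \<Longrightarrow> norm (F (dil t p) - F 0) \<le> C * norm t ^ k0"
    using hmat_vanishing_order_bound[OF F k0(1) z] by blast
  define g where "g s = F (dil (of_real (exp s)) p)" for s :: real
  have "infdist (g 0) Z = 0"
  proof (rule infdist_orbit_eq_0[where M = M and \<mu> = \<mu> and \<kappa> = "real k0" and C = C and ?s0.0 = s0])
    show "Z \<noteq> {}" using Z by auto
    show "(g has_vector_derivative Y1 (dil (of_real (exp s)) p) ** g s
        - g s ** Y2 (dil (of_real (exp s)) p)) (at s)" for s
      using has_vector_derivative_orbit[OF F, of p s] unfolding g_def[abs_def] ode .
    show "infdist (g s) Z \<le> C * exp (real k0 * s)" if "s \<le> s0" for s
    proof -
      have "infdist (g s) Z \<le> norm (F (dil (of_real (exp s)) p) - F 0)"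
        using infdist_le[OF Z, of "g s"] by (simp add: g_def dist_norm)
      also have "\<dots> \<le> C * norm (complex_of_real (exp s)) ^ k0"
        using that b(1) by (intro C) simp
      finally show ?thesis by (simp add: exp_of_nat_mult)
    qed
  qed (use b c in auto)
  then show ?thesis by (simp add: g_def)
qed

lemma mE_mm: "hmat F \<Longrightarrow> hmat G \<Longrightarrow> mE (\<lambda>p. F p ** G p) p = mE F p ** G p + F p ** mE G p"
  and mE_const [simp]: "mE (\<lambda>p. M) p = 0"
  and mE_diff: "hmat F \<Longrightarrow> hmat G \<Longrightarrow> mE (\<lambda>p. F p - G p) p = mE F p - mE G p"
  by (simp_all add: mE_def mpd_mm mpd_const mpd_diff)

lemma mcf_convolution_left:
  fixes k :: nat and f g :: "nat \<Rightarrow> 'n::finite cmat"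
  assumes "k > 0" "g 0 = mat 1" "\<And>i. 0 < i \<Longrightarrow> i < k \<Longrightarrow> g i = 0"
  shows "(\<Sum>i\<le>k. g i ** f (k - i)) = f k + g k ** f 0"
proof -
  have "(\<Sum>i\<le>k. g i ** f (k - i)) = (\<Sum>i\<in>{0, k}. g i ** f (k - i))"
    using assms by (intro sum.mono_neutral_right) (auto simp: le_less)
  then show ?thesis using assms by simp
qed

lemma mcf_convolution_right:
  fixes k :: nat and f g :: "nat \<Rightarrow> 'n::finite cmat"
  assumes "k > 0" "g 0 = mat 1" "\<And>i. 0 < i \<Longrightarrow> i < k \<Longrightarrow> g i = 0"
  shows "(\<Sum>i\<le>k. f i ** g (k - i)) = f k + f 0 ** g k"
proof -
  have "(\<Sum>i\<le>k. f i ** g (k - i)) = (\<Sum>i\<in>{0, k}. f i ** g (k - i))"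
    using assms by (intro sum.mono_neutral_right) (auto simp: le_less)
  then show ?thesis using assms by (simp add: add.commute)
qed

text \<open>A holomorphic inverse comes from the equation with \<open>Y1\<close> and
  \<open>Y2\<close> exchanged. The defect \<open>D = h hi - 1\<close> then satisfies
  \<open>E D = Y1 D - D Y1\<close> and vanishes to order \<open>k0\<close>, which forces
  \<open>D = 0\<close>; the growth bound for it holds since \<open>Y1 0 = Y2 0\<close>. With
  \<open>h\<close> invertible, closedness of \<open>H\<close> puts its values into
  \<open>H\<close>.\<close>

lemma orbit_solution_in_group:
  fixes Y1 Y2 :: "complex^3 \<Rightarrow> 'n::finite cmat"
  assumes H: "algebraic_group H" and Y: "hmat Y1" "hmat Y2"
    and L: "\<And>p. Y1 p \<in> lie_algebra H" "\<And>p. Y2 p \<in> lie_algebra H"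
    and k0: "k0 > 0" "norm (Y1 0) + norm (Y2 0) < real k0"
    and eq: "\<And>k p. k < k0 \<Longrightarrow> mcf k Y1 p = mcf k Y2 p"
  obtains h hi where "hmat h" "hmat hi" "\<forall>p. h p ** hi p = mat 1" "\<forall>p. h p \<in> H" "h 0 = mat 1"
    "\<forall>k p. 0 < k \<longrightarrow> k < k0 \<longrightarrow> mcf k h p = 0" "\<forall>p. mE h p = Y1 p ** h p - h p ** Y2 p"
proof -
  obtain h where h: "hmat h" "h 0 = mat 1" "\<forall>k p. 0 < k \<longrightarrow> k < k0 \<longrightarrow> mcf k h p = 0"
    "\<forall>p. mE h p = Y1 p ** h p - h p ** Y2 p"
    using nonresonant_solution[OF Y k0 eq] by metis
  have k0': "norm (Y2 0) + norm (Y1 0) < real k0" using k0(2) by simp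
  obtain hi where hi: "hmat hi" "hi 0 = mat 1" "\<forall>k p. 0 < k \<longrightarrow> k < k0 \<longrightarrow> mcf k hi p = 0"
    "\<forall>p. mE hi p = Y2 p ** hi p - hi p ** Y1 p"
    using nonresonant_solution[OF Y(2,1) k0(1) k0' eq[symmetric]] by metis
  define D where "D p = h p ** hi p - mat 1" for p
  have hhi: "hmat (\<lambda>p. h p ** hi p)" by (intro hmat_mm h hi)
  have D: "hmat D" unfolding D_def by (intro hmat_diff hhi hmat_const)
  have Y12: "Y1 0 = Y2 0" using eq[of 0 0] k0(1) by simp
  have inv: "h p ** hi p = mat 1" for p
  proof -
    have "infdist (D p) {0} = 0"
    proof (rule orbit_solution_infdist[OF D Y(1) Y(1) k0(1)])
      show "norm (Y1 0) + norm (Y1 0) < real k0" using k0(2) Y12 by simp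
      show "D 0 \<in> {0}" by (simp add: D_def h hi)
      fix k :: nat assume k: "0 < k" "k < k0"
      have "mcf k (\<lambda>p. h p ** hi p) p = mcf k hi p + mcf k h p ** mcf 0 hi p"
        unfolding mcf_mm[OF h(1) hi(1)] using k h by (intro mcf_convolution_left) auto
      then show "mcf k D p = 0"
        using k h hi by (simp add: D_def[abs_def] mcf_diff hhi mcf_const)
    next
      fix p
      have "mE D p = mE h p ** hi p + h p ** mE hi p"
        by (simp add: D_def[abs_def] mE_diff hhi mE_mm h(1) hi(1))
      also have "\<dots> = Y1 p ** D p - D p ** Y1 p"
        using h(4) hi(4) by (simp add: D_def mring)
      finally show "mE D p = Y1 p ** D p - D p ** Y1 p" .
    next
      fix p
      \<comment> \<open>Straight lines are good enough as curves, because every multiplication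
        preserves \<open>{0}\<close>.\<close>
      have v: "((\<lambda>t. mat 1 + t *\<^sub>R X) has_vector_derivative X) (at 0)" for X :: "'n cmat"
        by (auto intro!: derivative_eq_intros)
      show "\<exists>cX cY. cX 0 = mat 1 \<and> cY 0 = mat 1 \<and>
          (cX has_vector_derivative Y1 p) (at (0::real)) \<and> (cY has_vector_derivative - Y1 p) (at (0::real)) \<and>
          (\<forall>d. \<forall>k\<in>{0}. cX d ** k ** cY d \<in> {0})"
        by (intro exI[of _ "\<lambda>t. mat 1 + t *\<^sub>R Y1 p"] exI[of _ "\<lambda>t. mat 1 + t *\<^sub>R - Y1 p"] conjI v) auto
    qed
    then have "D p = 0" by simp
    then show ?thesis by (simp add: D_def)
  qed
  have "h p \<in> H" for p
  proof (rule alg_group_closed[OF H])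
    show "infdist (h p) H = 0"
      by (rule orbit_solution_infdist[OF h(1) Y k0 _ _ _ lie_algebra_curves[OF H L]])
        (use h H in \<open>auto simp: alg_group_one\<close>)
    show "invertible (h p)" using inv by (auto simp: invertible_right_inverse)
  qed
  then show ?thesis using that h hi inv by blast
qed

text \<open>\<open>W\<close> is an intersection of kernels of functionals, and taking coefficients
  commutes with complex-linear ones. The real inner product with \<open>y\<close> is therefore
  completed to the complex functional \<open>l\<close>; it also vanishes on \<open>W\<close>, as
  \<open>W\<close> is closed under multiplication by \<open>\<i>\<close>.\<close>

lemma mcf_in_subspace:
  fixes F :: "complex^3 \<Rightarrow> 'n::finite cmat"
  assumes F: "hmat F" and W: "subspace W" "\<And>c X. X \<in> W \<Longrightarrow> c *\<^sub>C X \<in> W" and FW: "\<And>p. F p \<in> W"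
  shows "mcf k F p \<in> W"
proof -
  have "mcf k F p \<in> orthogonal_comp (orthogonal_comp W)"
    unfolding orthogonal_comp_def[of "orthogonal_comp W"]
  proof (intro CollectI ballI)
    fix y assume "y \<in> orthogonal_comp W"
    then have y: "X \<bullet> y = 0" if "X \<in> W" for X
      using that by (auto simp: orthogonal_comp_def orthogonal_def)
    define l where "l X = (\<Sum>i\<in>UNIV. \<Sum>j\<in>UNIV. cnj (y $ i $ j) * X $ i $ j)" for X :: "'n cmat"
    have Re: "Re (l X) = X \<bullet> y" for X
      by (simp add: l_def inner_vec_def inner_complex_def algebra_simps)
    have "l X = 0" if "X \<in> W" for X
    proof -
      have "l (\<i> *\<^sub>C X) = \<i> * l X" by (simp add: l_def sum_distrib_left mult_ac)
      then have "Re (\<i> * l X) = 0" using Re[of "\<i> *\<^sub>C X"] y[OF W(2)[OF that]] by simp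
      then show ?thesis using Re[of X] y[OF that] by (simp add: complex_eq_iff)
    qed
    then have "l (F q) = 0" for q using FW by blast
    then have "cf k (\<lambda>q. l (F q)) p = 0" by (simp add: cf_const)
    moreover have "cf k (\<lambda>q. l (F q)) p = l (mcf k F p)"
      unfolding l_def mcf_nth
      by (simp add: cf_sum cf_cmult hol_sum hol_mult hmat_entry[OF F])
    ultimately show "orthogonal y (mcf k F p)"
      using Re[of "mcf k F p"] by (simp add: orthogonal_def inner_commute)
  qed
  then show ?thesis by (simp add: orthogonal_comp_self W)
qed

lemma mcf_in_lie_algebra:
  assumes "algebraic_group H" "hmat F" "\<And>p. F p \<in> lie_algebra H"
  shows "mcf k F p \<in> lie_algebra H"
  by (rule mcf_in_subspace[OF assms(2)])
    (auto simp: subspace_def assms lie_algebra_0 lie_algebra_add lie_algebra_scaleR lie_algebra_cscale)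

text \<open>Nilpotency is required at one vector \<open>x\<close> only, since
  \<open>k - ad X0\<close> is nilpotent merely on its generalised kernel. In the induction
  \<open>a x\<close> needs one power of \<open>a\<close> less and no more powers of
  \<open>b\<close>, and symmetrically for \<open>b x\<close>.\<close>

lemma commuting_nilpotent_diff:
  fixes a b :: "'v::ab_group_add \<Rightarrow> 'v"
  assumes a: "\<And>x y. a (x - y) = a x - a y" and b: "\<And>x y. b (x - y) = b x - b y"
    and ab: "\<And>x. a (b x) = b (a x)"
  shows "(a ^^ i) x = 0 \<Longrightarrow> (b ^^ j) x = 0 \<Longrightarrow> ((\<lambda>x. a x - b x) ^^ (i + j)) x = 0"
proof (induction "i + j" arbitrary: i j x)
  case 0
  then show ?case by simp
next
  case (Suc n)
  let ?c = "\<lambda>x. a x - b x"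
  have a0: "a 0 = 0" and b0: "b 0 = 0" using a[of 0 0] b[of 0 0] by simp_all
  have c: "?c (x - y) = ?c x - ?c y" for x y by (simp add: a b algebra_simps)
  have cn: "(?c ^^ k) (x - y) = (?c ^^ k) x - (?c ^^ k) y" for k x y
    by (induction k arbitrary: x y) (simp_all only: funpow_Suc_right comp_apply funpow_0 c)
  have c0: "(?c ^^ k) 0 = 0" for k using cn[of k 0 0] by simp
  have an: "(a ^^ k) (b x) = b ((a ^^ k) x)" for k x by (induction k) (simp_all add: ab)
  have bn: "(b ^^ k) (a x) = a ((b ^^ k) x)" for k x by (induction k) (simp_all add: ab)
  show ?case
  proof (cases "i = 0 \<or> j = 0")
    case True
    then have "x = 0" using Suc.prems by auto
    then show ?thesis by (simp only: c0)
  next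
    case False
    then obtain i' j' where ij: "i = Suc i'" "j = Suc j'" by (meson not0_implies_Suc)
    have "(b ^^ j) (a x) = 0" "(a ^^ i) (b x) = 0"
      by (simp_all add: an bn Suc.prems a0 b0)
    moreover have "(a ^^ i') (a x) = 0" "(b ^^ j') (b x) = 0"
      using Suc.prems unfolding ij by (simp_all only: funpow_Suc_right comp_apply)
    moreover have n: "n = i' + j" "n = i + j'" using Suc.hyps(2) ij by auto
    ultimately have "(?c ^^ (i' + j)) (a x) = 0" "(?c ^^ (i + j')) (b x) = 0"
      using Suc.hyps(1)[OF n(1), of "a x"] Suc.hyps(1)[OF n(2), of "b x"] by blast+
    with n have "(?c ^^ n) (?c x) = 0" by (simp only: cn) simp
    then show ?thesis unfolding Suc.hyps(2)[symmetric] by (simp only: funpow_Suc_right comp_apply)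
  qed
qed

lemma ad_nilpotent:
  fixes N :: "'n::finite cmat"
  assumes "((**) N ^^ m) (mat 1) = 0"
  shows "((\<lambda>Z. Z ** N - N ** Z) ^^ (m + m)) Z = 0" "((\<lambda>Z. N ** Z - Z ** N) ^^ (m + m)) Z = 0"
proof -
  have l: "((**) N ^^ m) Z = 0" using assms by (subst funpow_mm) simp
  have "((\<lambda>Z. Z ** N) ^^ k) Z = Z ** ((**) N ^^ k) (mat 1)" for k
    by (induction k) (simp_all add: mring, metis funpow_mm funpow_swap1 matrix_mul_assoc matrix_mul_rid)
  then have r: "((\<lambda>Z. Z ** N) ^^ m) Z = 0" using assms by simp
  show "((\<lambda>Z. Z ** N - N ** Z) ^^ (m + m)) Z = 0"
    by (rule commuting_nilpotent_diff[OF _ _ _ r l]) (simp_all add: mring)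
  show "((\<lambda>Z. N ** Z - Z ** N) ^^ (m + m)) Z = 0"
    by (rule commuting_nilpotent_diff[OF _ _ _ l r]) (simp_all add: mring)
qed

text \<open>In eigencoordinates of \<open>S\<close> the operator multiplies the entry
  \<open>(i, j)\<close> by \<open>a - (d i - d j)\<close>, so its generalised kernel is its
  kernel.\<close>

lemma semisimple_kernel:
  fixes S P Q :: "'n::finite cmat"
  assumes PQ: "P ** Q = mat 1" "Q ** P = mat 1" and S: "S = Q ** diagm d ** P"
    and T: "((\<lambda>Z. a *\<^sub>C Z - (S ** Z - Z ** S)) ^^ m) Z = 0"
  shows "a *\<^sub>C Z - (S ** Z - Z ** S) = 0"
proof -
  let ?T = "\<lambda>Z. a *\<^sub>C Z - (S ** Z - Z ** S)"
  have PS: "P ** S = diagm d ** P" and SQ: "S ** Q = Q ** diagm d"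
    by (simp_all add: S matrix_mul_assoc PQ) (simp add: mring PQ)
  have e: "(P ** ?T Z ** Q) $ i $ j = (a - (d i - d j)) * (P ** Z ** Q) $ i $ j" for Z i j
  proof -
    have "P ** ?T Z ** Q = a *\<^sub>C (P ** Z ** Q) - ((P ** S) ** Z ** Q - P ** Z ** (S ** Q))"
      by (simp add: mring)
    also have "\<dots> = a *\<^sub>C (P ** Z ** Q) - (diagm d ** (P ** Z ** Q) - (P ** Z ** Q) ** diagm d)"
      by (simp only: PS SQ) (simp add: mring)
    finally have "(P ** ?T Z ** Q) $ i $ j = (a *\<^sub>C (P ** Z ** Q)
        - (diagm d ** (P ** Z ** Q) - (P ** Z ** Q) ** diagm d)) $ i $ j" by (rule arg_cong)
    also have "\<dots> = (a - (d i - d j)) * (P ** Z ** Q) $ i $ j"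
      by (simp only: vector_minus_component cscale_nth diagm_mult_left diagm_mult_right) algebra
    finally show ?thesis .
  qed
  have en: "(P ** (?T ^^ m) Z ** Q) $ i $ j = (a - (d i - d j)) ^ m * (P ** Z ** Q) $ i $ j" for m i j
    by (induction m) (simp_all add: e del: vector_minus_component)
  have "(P ** ?T Z ** Q) $ i $ j = 0" for i j
    using en[of m i j] unfolding T by (auto simp: e)
  then have "P ** ?T Z ** Q = 0" by (simp add: vec_eq_iff)
  then have "(Q ** P) ** ?T Z ** (Q ** P) = 0"
    by (metis matrix_mul_assoc mm.zero_left mm.zero_right)
  then show ?thesis by (simp add: PQ)
qed


text \<open>The inverse \<open>hi\<close> is carried along so that its holomorphy is part of the
  data. The condition \<open>h 0 = mat 1\<close> keeps the value of the \<open>E\<close>-component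
  at the origin, where \<open>E\<close> vanishes.\<close>

definition gauge :: "('n::finite cmat) set \<Rightarrow> (complex^3 \<Rightarrow> 'n cmat) \<Rightarrow> (complex^3 \<Rightarrow> 'n cmat) \<Rightarrow> bool" where
  "gauge H h hi \<longleftrightarrow> hmat h \<and> hmat hi \<and> h 0 = mat 1 \<and>
     (\<forall>p. h p \<in> H \<and> h p ** hi p = mat 1 \<and> hi p ** h p = mat 1)"

text \<open>The \<open>E\<close>-component of the gauge transformed connection form.\<close>

definition gE :: "(complex^3 \<Rightarrow> 'n::finite cmat) \<Rightarrow> (complex^3 \<Rightarrow> 'n cmat) \<Rightarrow> (complex^3 \<Rightarrow> 'n cmat)
    \<Rightarrow> complex^3 \<Rightarrow> 'n cmat" where
  "gE h hi A p = h p ** A p ** hi p + mE h p ** hi p"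

lemma gauge_comp:
  assumes "algebraic_group H" "gauge H h hi" "gauge H k ki"
  shows "gauge H (\<lambda>p. k p ** h p) (\<lambda>p. hi p ** ki p)"
proof -
  have "(k p ** h p) ** (hi p ** ki p) = k p ** (h p ** hi p) ** ki p"
    "(hi p ** ki p) ** (k p ** h p) = hi p ** (ki p ** k p) ** h p" for p
    by (simp_all only: matrix_mul_assoc)
  then show ?thesis
    using assms by (auto simp: gauge_def intro: hmat_mm alg_group_mult)
qed

lemma gE_comp:
  assumes "gauge H h hi" "gauge H k ki"
  shows "gE (\<lambda>p. k p ** h p) (\<lambda>p. hi p ** ki p) A p = gE k ki (gE h hi A) p"
proof -
  have "hmat h" "hmat k" "h p ** hi p = mat 1" using assms by (auto simp: gauge_def)
  moreover have "mE k p ** h p ** (hi p ** ki p) = mE k p ** (h p ** hi p) ** ki p"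
    by (simp only: matrix_mul_assoc)
  ultimately show ?thesis by (simp add: gE_def mE_mm mring)
qed

definition graded :: "'n::finite cmat \<Rightarrow> (complex^3 \<Rightarrow> 'n cmat) \<Rightarrow> nat \<Rightarrow> bool" where
  "graded S F k \<longleftrightarrow> (\<forall>p. S ** mcf k F p - mcf k F p ** S = of_nat k *\<^sub>C mcf k F p)"

text \<open>Adding an element of the image of \<open>T = k - ad X0\<close> moves any \<open>Z\<close> into the generalised kernel
  of \<open>T\<close>: write an annihilating polynomial of \<open>T\<close> as \<open>x^m q\<close> with \<open>q = c + x r\<close>, \<open>c \<noteq> 0\<close>;
  then \<open>Z + T (r(T) Z / c)\<close> is \<open>q(T) Z / c\<close>.\<close>

lemma generalised_kernel_correction:
  fixes T :: "'n::finite cmat \<Rightarrow> 'n cmat"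
  assumes T: "clin T"
  obtains c r m where "\<And>Z. (T ^^ m) (Z + T (c *\<^sub>C pact r T Z)) = 0"
proof -
  obtain p where p: "p \<noteq> 0" "\<And>Z. pact p T Z = 0" using annihilator[OF T] by blast
  obtain q where q: "p = [:-0, 1:] ^ Polynomial.order 0 p * q" "\<not> [:-0, 1:] dvd q"
    using order_decomp[OF p(1)] by blast
  define m where "m = Polynomial.order 0 p"
  obtain a r where ar: "q = pCons a r" by (cases q) auto
  have "[:-0, 1:] dvd pCons 0 r" by (rule dvdI[of _ _ r]) simp
  then have a: "a \<noteq> 0" using q(2) ar by auto
  have "(T ^^ m) (pact q T Z) = 0" for Z
  proof -
    have "pact p T Z = pact ([:-0, 1:] ^ m) T (pact q T Z)"
      unfolding m_def by (subst q(1)) (rule pact_mult[OF T])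
    also have "[:-0, 1:] ^ m = monom (1::complex) m"
      by (simp add: monom_altdef)
    finally show ?thesis using p(2)[of Z] by (simp add: pact_monom[OF T])
  qed
  then have "(T ^^ m) ((1 / a) *\<^sub>C pact q T Z) = 0" for Z
    by (simp add: clinD[OF clin_funpow[OF T]])
  moreover have "(1 / a) *\<^sub>C pact q T Z = Z + T ((1 / a) *\<^sub>C pact r T Z)" for Z
    using a by (simp add: ar pact_pCons[OF T] cscale_distrib clinD[OF T])
  ultimately show ?thesis using that by metis
qed

text \<open>A gauge transformation \<open>1 + X + ...\<close> with \<open>X\<close> homogeneous of
  weight \<open>k\<close> leaves the lower coefficients alone and adds \<open>T X\<close> to the
  coefficient of weight \<open>k\<close>. \<open>X\<close> is chosen by
  \<open>generalised_kernel_correction\<close>, and it stays in the Lie algebra because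
  \<open>R\<close> is a polynomial in \<open>T\<close>. The new coefficient lies in the generalised
  kernel of \<open>k - ad (A 0)\<close>.\<close>

lemma resonance_step:
  fixes A :: "complex^3 \<Rightarrow> 'n::finite cmat" and S N P Q :: "'n cmat"
  assumes H: "algebraic_group H" and A: "hmat A" "\<And>p. A p \<in> lie_algebra H" and k: "k > 0"
    and S: "A 0 = S + N" "S ** N = N ** S" "nilpotent_matrix N"
      "Q ** P = mat 1" "P ** Q = mat 1" "S = Q ** diagm d ** P"
  shows "\<exists>h hi. gauge H h hi \<and> hmat (gE h hi A) \<and> (\<forall>p. gE h hi A p \<in> lie_algebra H) \<and>
    (\<forall>p. \<forall>j<k. mcf j (gE h hi A) p = mcf j A p) \<and> graded S (gE h hi A) k"
proof -
  define X0 where "X0 = A 0"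
  define T where "T Z = of_nat k *\<^sub>C Z - (X0 ** Z - Z ** X0)" for Z
  have T: "clin T" unfolding T_def by (intro clin_diff clin_cscale clin_mult_left clin_mult_right)
  obtain c r m where cr: "\<And>Z. (T ^^ m) (Z + T (c *\<^sub>C pact r T Z)) = 0"
    using generalised_kernel_correction[OF T] by metis
  define R where "R Z = c *\<^sub>C pact r T Z" for Z
  have R: "clin R"
    unfolding R_def using pact_clin[OF T, of r]
    by (intro clinI) (simp_all add: clinD cscale_distrib mult.commute)
  have TL: "T Z \<in> lie_algebra H" if "Z \<in> lie_algebra H" for Z
    unfolding T_def X0_def using that A(2)[of 0]
    by (intro lie_algebra_diff lie_algebra_commutator lie_algebra_cscale H)
  have RL: "R Z \<in> lie_algebra H" if "Z \<in> lie_algebra H" for Z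
    unfolding R_def
    by (intro lie_algebra_cscale H pact_in[OF T that] TL)
      (auto intro: lie_algebra_0 lie_algebra_add lie_algebra_cscale H)
  define X where "X p = R (mcf k A p)" for p
  have X: "hmat X" unfolding X_def by (rule hmat_clin[OF R hmat_mcf[OF A(1)]])
  have XL: "X p \<in> lie_algebra H" for p
    unfolding X_def by (intro RL mcf_in_lie_algebra[OF H A])
  have Xc: "mcf j X p = (if j = k then X p else 0)" for j p
    unfolding X_def by (simp add: mcf_clin[OF R hmat_mcf[OF A(1)]] mcf_mcf[OF A(1)] clinD[OF R])
  have X00: "X 0 = 0" using Xc[of 0 0] k by simp
  define Y where "Y p = of_nat k *\<^sub>C X p" for p
  have Y: "hmat Y" unfolding Y_def by (intro hmat_cscale X) simp
  have YL: "Y p \<in> lie_algebra H" for p unfolding Y_def by (intro lie_algebra_cscale H XL)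
  have Yc: "mcf j Y p = (if j = k then Y p else 0)" for j p
    using mcf_clin[OF clin_cscale X, of j "of_nat k" p] by (simp add: Y_def[abs_def] Xc)
  \<comment> \<open>The solution is the exponential of \<open>X\<close>, since
    \<open>E X = k X\<close>; as a solution of the transport equation with \<open>Y2 = 0\<close> it
    has values in \<open>H\<close>.\<close>
  obtain h hi where h: "hmat h" "hmat hi" "\<forall>p. h p ** hi p = mat 1" "\<forall>p. h p \<in> H" "h 0 = mat 1"
    and hc: "\<forall>j p. 0 < j \<longrightarrow> j < k \<longrightarrow> mcf j h p = 0" and ode: "\<forall>p. mE h p = Y p ** h p - h p ** 0"
  proof (rule orbit_solution_in_group[OF H Y hmat_const YL lie_algebra_0[OF H] k])
    show "norm (Y 0) + norm (0 :: 'n cmat) < real k" using k by (simp add: Y_def X00)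
    show "mcf j Y p = mcf j (\<lambda>p. 0) p" if "j < k" for j p
      using that by (simp add: Yc mcf_const)
  qed
  have hih: "hi p ** h p = mat 1" for p using h(3) matrix_left_right_inverse by blast
  have g: "gauge H h hi" using h hih by (simp add: gauge_def)
  define A' where "A' = gE h hi A"
  have A': "A' p = h p ** A p ** hi p + Y p" for p
    using ode h(3) by (simp add: A'_def gE_def mring)
  have hA': "hmat A'"
    by (subst ext[OF A', of "\<lambda>p. p"]) (intro hmat_add hmat_mm h A Y)
  have A'L: "A' p \<in> lie_algebra H" for p
  proof -
    have "hi p = matrix_inv (h p)" using h(3) matrix_inv_unique by metis
    then show ?thesis
      unfolding A' using h(4) by (intro lie_algebra_add[OF H] YL) (auto intro: lie_algebra_Ad[OF H A(2)])
  qed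
  \<comment> \<open>Multiplying by \<open>h\<close> on the right removes \<open>hi\<close>, so only
    coefficients of \<open>h\<close> enter the comparison.\<close>
  have eq: "(\<lambda>p. A' p ** h p) = (\<lambda>p. h p ** A p + Y p ** h p)"
  proof
    fix p
    have "h p ** A p ** hi p ** h p = h p ** A p ** (hi p ** h p)" by (simp only: matrix_mul_assoc)
    then show "A' p ** h p = h p ** A p + Y p ** h p" by (simp add: A' matrix_add_rdistrib' hih)
  qed
  have conv: "(\<Sum>i\<le>j. mcf i A' p ** mcf (j - i) h p)
      = (\<Sum>i\<le>j. mcf i h p ** mcf (j - i) A p) + (\<Sum>i\<le>j. mcf i Y p ** mcf (j - i) h p)" for j p
    using arg_cong[OF eq, of "\<lambda>F. mcf j F p"]
    by (simp add: mcf_mm mcf_add hmat_mm hA' h A Y)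
  have left: "(\<Sum>i\<le>j. mcf i h p ** f (j - i)) = f j + mcf j h p ** f 0"
    and right: "(\<Sum>i\<le>j. f i ** mcf (j - i) h p) = f j + f 0 ** mcf j h p"
    if "0 < j" "j \<le> k" for j p f
    using that h(5) hc
    by (auto intro!: mcf_convolution_left[where g="\<lambda>i. mcf i h p"]
        mcf_convolution_right[where g="\<lambda>i. mcf i h p"])
  have A'0: "A' 0 = A 0" using h(3) spec[OF h(3), of 0] by (simp add: A' h(5) Y_def X00)
  have low: "mcf j A' p = mcf j A p" if "j < k" for j p
  proof (cases "j = 0")
    case True
    then show ?thesis by (simp add: A'0)
  next
    case False
    then show ?thesis
      using conv[where j=j and p=p] left[where j=j and p=p and f="\<lambda>i. mcf i A p"] right[where j=j and p=p and f="\<lambda>i. mcf i A' p"]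
        right[where j=j and p=p and f="\<lambda>i. mcf i Y p"] that hc by (simp add: Yc X00)
  qed
  have hk: "mcf k h p = X p" for p
  proof -
    have "mcf k (mE h) p = mcf k (\<lambda>p. Y p ** h p) p"
      using ode by (intro arg_cong[where f="\<lambda>F. mcf k F p"] ext) simp
    then have "of_nat k *\<^sub>C mcf k h p = of_nat k *\<^sub>C X p"
      using right[where j=k and p=p and f="\<lambda>i. mcf i Y p"] k
      by (simp add: mcf_mE h mcf_mm Y Yc, simp add: Y_def X00)
    then have "of_nat k *\<^sub>C (mcf k h p - X p) = 0" by (simp add: cscale_distrib)
    then show ?thesis using k by simp
  qed
  have Ak: "mcf k A' p = mcf k A p + T (X p)" for p
    using conv[where j=k and p=p] left[where j=k and p=p and f="\<lambda>i. mcf i A p"] right[where j=k and p=p and f="\<lambda>i. mcf i A' p"]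
      right[where j=k and p=p and f="\<lambda>i. mcf i Y p"] k
    by (simp add: Yc hk A'0 T_def X0_def) (simp add: Y_def X00 algebra_simps)
  have "graded S A' k"
    unfolding graded_def
  proof
    fix p
    define Z where "Z = mcf k A' p"
    have "(T ^^ m) Z = 0" using cr[of "mcf k A p"] by (simp add: Z_def Ak X_def R_def)
    moreover obtain l where l: "((**) N ^^ l) (mat 1) = 0"
      using S(3) by (auto simp: nilpotent_matrix_def)
    have "((\<lambda>Z. Z ** N - N ** Z) ^^ (l + l)) Z = 0" by (rule ad_nilpotent(1)[OF l])
    \<comment> \<open>Adding the commuting nilpotent operator \<open>ad N\<close> back turns
      \<open>k - ad (S + N)\<close> into \<open>k - ad S\<close>, whose generalised kernel is its
      kernel.\<close>
    ultimately have Z0: "((\<lambda>Z. T Z - (Z ** N - N ** Z)) ^^ (m + (l + l))) Z = 0"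
    proof (rule commuting_nilpotent_diff[rotated 3])
      fix Z :: "'n cmat"
      have "Z ** S ** N = Z ** N ** S" by (simp only: matrix_mul_assoc[symmetric] S(2))
      moreover have "N ** S ** Z = S ** N ** Z" by (simp only: S(2))
      ultimately show "T (Z ** N - N ** Z) = T Z ** N - N ** T Z"
        by (simp add: T_def X0_def S(1) mring cscale_distrib)
    qed (simp_all add: clinD[OF T] mring)
    have "(\<lambda>Z. T Z - (Z ** N - N ** Z)) = (\<lambda>Z. of_nat k *\<^sub>C Z - (S ** Z - Z ** S))"
      by (simp add: fun_eq_iff T_def X0_def S(1) mring)
    from Z0[unfolded this] have "of_nat k *\<^sub>C Z - (S ** Z - Z ** S) = 0"
      by (rule semisimple_kernel[OF S(5,4,6)])
    then show "S ** mcf k A' p - mcf k A' p ** S = of_nat k *\<^sub>C mcf k A' p"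
      by (simp add: Z_def algebra_simps)
  qed
  then show ?thesis using g hA' A'L low unfolding A'_def by blast
qed

section \<open>The normal form of the \<open>E\<close>-component\<close>

lemma resonance_removal:
  fixes A :: "complex^3 \<Rightarrow> 'n::finite cmat" and S N P Q :: "'n cmat"
  assumes H: "algebraic_group H" and A: "hmat A" "\<And>p. A p \<in> lie_algebra H"
    and S: "A 0 = S + N" "S ** N = N ** S" "nilpotent_matrix N"
      "Q ** P = mat 1" "P ** Q = mat 1" "S = Q ** diagm d ** P"
  shows "\<exists>h hi. gauge H h hi \<and> hmat (gE h hi A) \<and> (\<forall>p. gE h hi A p \<in> lie_algebra H) \<and>
    gE h hi A 0 = A 0 \<and> (\<forall>j. 0 < j \<and> j \<le> k \<longrightarrow> graded S (gE h hi A) j)"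
proof (induction k)
  case 0
  have "gauge H (\<lambda>p. mat 1) (\<lambda>p. mat 1)"
    using H by (auto simp: gauge_def alg_group_one)
  moreover have "gE (\<lambda>p. mat 1) (\<lambda>p. mat 1) A = A"
    by (simp add: gE_def fun_eq_iff)
  ultimately show ?case
    using A by (intro exI[of _ "\<lambda>p. mat 1"]) auto
next
  case (Suc k)
  then obtain h hi where h: "gauge H h hi" "hmat (gE h hi A)" "\<And>p. gE h hi A p \<in> lie_algebra H"
    "gE h hi A 0 = A 0" "\<And>j. 0 < j \<Longrightarrow> j \<le> k \<Longrightarrow> graded S (gE h hi A) j"
    by blast
  define A1 where "A1 = gE h hi A"
  have A1: "A1 0 = S + N" using h(4) S(1) by (simp add: A1_def)
  obtain g gi where g: "gauge H g gi" "hmat (gE g gi A1)" "\<And>p. gE g gi A1 p \<in> lie_algebra H"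
    "\<And>p j. j < Suc k \<Longrightarrow> mcf j (gE g gi A1) p = mcf j A1 p" "graded S (gE g gi A1) (Suc k)"
    using resonance_step[OF H h(2,3) zero_less_Suc, folded A1_def, OF A1 S(2-6)] by blast
  have e: "gE (\<lambda>p. g p ** h p) (\<lambda>p. hi p ** gi p) A = gE g gi A1"
    using gE_comp[OF h(1) g(1)] by (simp add: fun_eq_iff A1_def)
  have "graded S (gE g gi A1) j" if "0 < j" "j \<le> Suc k" for j
  proof (cases "j = Suc k")
    case False
    then have "j < Suc k" "graded S A1 j" using that h(5) by (auto simp: A1_def)
    then show ?thesis by (simp add: graded_def g(4))
  qed (use g in simp)
  moreover have "gE g gi A1 0 = A 0"
    using g(4)[of 0 0] A1 S(1) by simp
  ultimately show ?case
    using gauge_comp[OF H h(1) g(1)] g(2,3) e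
    by (intro exI[of _ "\<lambda>p. g p ** h p"] exI[of _ "\<lambda>p. hi p ** gi p"]) simp
qed

section \<open>Nilpotency of graded families, by invariance of determinants along orbits\<close>

lemma hol_prod: "(\<And>i. i \<in> I \<Longrightarrow> hol (f i)) \<Longrightarrow> hol (\<lambda>p. \<Prod>i\<in>I. f i p)"
  by (induction I rule: infinite_finite_induct) (auto intro: hol_mult)

lemma hol_det: "hmat F \<Longrightarrow> hol (\<lambda>p. det (F p))"
  unfolding det_def by (intro hol_sum hol_mult hol_prod hol_const hmat_entry)

lemma nilpotent_eigenvector:
  fixes N :: "'n::finite cmat"
  assumes "nilpotent_matrix N" "N *v v = x *s v" "x \<noteq> 0"
  shows "v = 0"
proof -
  obtain m where m: "((**) N ^^ m) (mat 1) = 0" using assms(1) by (auto simp: nilpotent_matrix_def)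
  have "((**) N ^^ k) (mat 1) *v v = x ^ k *s v" for k
  proof (induction k)
    case (Suc k)
    have "((**) N ^^ Suc k) (mat 1) *v v = N *v (x ^ k *s v)"
      by (simp add: Suc flip: matrix_vector_mul_assoc)
    also have "\<dots> = x ^ k *s (N *v v)"
      by (simp add: vec_eq_iff matrix_vector_mult_def sum_distrib_left mult_ac)
    finally show ?case by (simp add: assms(2) mult.commute)
  qed simp
  from this[of m] m have "x ^ m *s v = 0" by simp
  then show ?thesis using assms(3) by (simp add: vec_eq_iff)
qed

lemma det_shift_eq_0_iff:
  fixes N :: "'n::finite cmat"
  shows "det (N - x *\<^sub>C mat 1) = 0 \<longleftrightarrow> (\<exists>v. v \<noteq> 0 \<and> N *v v = x *s v)"
proof -
  have "det (N - x *\<^sub>C mat 1) \<noteq> 0 \<longleftrightarrow> (\<forall>v. (N - x *\<^sub>C mat 1) *v v = 0 \<longrightarrow> v = 0)"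
    by (simp only: invertible_det_nz[symmetric] invertible_left_inverse matrix_left_invertible_ker)
  then show ?thesis
    by (auto simp: matrix_vector_mult_diff_rdistrib cscale_mult_vec)
qed

text \<open>A family with \<open>E N = [S, N]\<close> is moved along the orbits of \<open>E\<close> by conjugation, so all its
  values have the characteristic polynomial of \<open>N 0\<close>.\<close>

lemma graded_nilpotent:
  fixes N :: "complex^3 \<Rightarrow> 'n::finite cmat" and P Q S :: "'n cmat"
  assumes N: "hmat N" and E: "\<And>p. mE N p = S ** N p - N p ** S" and 0: "nilpotent_matrix (N 0)"
    and S: "Q ** P = mat 1" "P ** Q = mat 1" "S = Q ** diagm d ** P"
  shows "((**) (N p) ^^ (DIM('n cmat) * DIM('n cmat))) (mat 1) = 0"
proof (rule nilpotent_bound)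
  fix x v assume x: "x \<noteq> 0" and v: "N p *v v = x *s v"
  define n where "n p = P ** N p ** Q" for p
  have n: "hmat n" unfolding n_def by (intro hmat_mm hmat_const N)
  have PS: "P ** S = diagm d ** P" and SQ: "S ** Q = Q ** diagm d"
    by (simp_all add: S matrix_mul_assoc) (simp add: mring S(2))
  have "mE n p = P ** mE N p ** Q" for p
    unfolding n_def[abs_def] by (simp add: mE_mm hmat_mm N)
  also have "P ** mE N p ** Q = (P ** S) ** N p ** Q - P ** N p ** (S ** Q)" for p
    by (simp add: E mring)
  finally have En: "mE n p = diagm d ** n p - n p ** diagm d" for p
    by (simp only: PS SQ n_def) (simp add: mring)
  \<comment> \<open>In eigencoordinates of \<open>S\<close> the entry \<open>(i, j)\<close> is
    homogeneous of the single weight \<open>d i - d j\<close>, and zero if that is not a natural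
    number.\<close>
  have cn: "of_nat k * cf k (\<lambda>p. n p $ i $ j) p = (d i - d j) * cf k (\<lambda>p. n p $ i $ j) p" for k i j
  proof -
    have "cf k (Ef (\<lambda>p. n p $ i $ j)) p = cf k (\<lambda>p. (d i - d j) * n p $ i $ j) p"
    proof (intro arg_cong[where f="\<lambda>f. cf k f p"] ext)
      fix q
      have "Ef (\<lambda>p. n p $ i $ j) q = (diagm d ** n q - n q ** diagm d) $ i $ j"
        by (simp only: mE_nth[symmetric] En)
      then show "Ef (\<lambda>p. n p $ i $ j) q = (d i - d j) * n q $ i $ j"
        by (simp add: diagm_mult_left diagm_mult_right algebra_simps)
    qed
    then show ?thesis by (simp add: cf_Ef cf_cmult hmat_entry[OF n])
  qed
  have ne: "n (dil (exp s) p) $ i $ j = exp (s * d i) * n p $ i $ j * exp (- (s * d j))" for s i j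
  proof -
    have "cf k (\<lambda>p. n p $ i $ j) p * exp s ^ k = exp (s * (d i - d j)) * (cf k (\<lambda>p. n p $ i $ j) p * 1 ^ k)"
      for k
    proof (cases "cf k (\<lambda>p. n p $ i $ j) p = 0")
      case False
      then have "of_nat k = d i - d j" using cn[of k i j] by simp
      then show ?thesis by (simp add: exp_of_nat_mult[symmetric] mult.commute)
    qed simp
    then have "(\<lambda>k. exp (s * (d i - d j)) * (cf k (\<lambda>p. n p $ i $ j) p * 1 ^ k))
        sums (n (dil (exp s) p) $ i $ j)"
      using cf_sums[OF hmat_entry[OF n], of i j p "exp s"] by (simp only:)
    from sums_unique2[OF this sums_mult[OF cf_sums[OF hmat_entry[OF n]]]]
    have "n (dil (exp s) p) $ i $ j = exp (s * (d i - d j)) * n (dil 1 p) $ i $ j" .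
    then show ?thesis by (simp add: right_diff_distrib exp_diff exp_minus field_simps)
  qed
  define D where "D s = diagm (\<lambda>i. exp (s * d i))" for s
  have DD: "D s ** D (- s) = mat 1" for s
    unfolding D_def diagm_mult by (simp add: exp_minus diagm_1)
  have nD: "n (dil (exp s) p) = D s ** n p ** D (- s)" for s
    by (simp add: vec_eq_iff ne D_def diagm_mult_left diagm_mult_right)
  define f where "f p = det (n p - x *\<^sub>C mat 1)" for p
  have hf: "hol f" unfolding f_def by (intro hol_det hmat_diff n hmat_const)
  have conj: "det (A ** M ** B - x *\<^sub>C mat 1) = det (M - x *\<^sub>C mat 1)" if "A ** B = mat 1" for A B M :: "'n cmat"
  proof -
    have "A ** M ** B - x *\<^sub>C mat 1 = A ** (M - x *\<^sub>C mat 1) ** B"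
      by (simp add: mring that)
    moreover have "det A * det B = 1" using that by (metis det_I det_mul)
    ultimately show ?thesis by (simp add: det_mul mult_ac)
  qed
  have "f (dil (exp s) p) = f p" for s
    unfolding f_def nD by (rule conj[OF DD])
  then have const: "f (dil (of_real t) p) = f p" if "t > 0" for t :: real
    using that by (metis exp_ln exp_of_real)
  \<comment> \<open>\<open>f\<close> is constant along the orbit for \<open>t > 0\<close>, and the
    orbit runs into the origin, so \<open>f p = f 0\<close>.\<close>
  have "((\<lambda>t. f (dil (complex_of_real t) p)) \<longlongrightarrow> f (dil (of_real 0) p)) (at_right 0)"
    by (intro continuous_on_tendsto_compose[OF hol_continuous[OF hf, of UNIV]]
        continuous_on_tendsto_compose[of UNIV "\<lambda>t. dil (complex_of_real t) p"] continuous_intros tendsto_intros) auto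
  moreover have "((\<lambda>t. f (dil (complex_of_real t) p)) \<longlongrightarrow> f p) (at_right 0)"
    by (rule tendsto_eventually) (auto simp: eventually_at_right_field const intro!: exI[of _ 1])
  ultimately have "f 0 = f p" using tendsto_unique[of "at_right (0::real)"] by fastforce
  moreover have "f 0 \<noteq> 0"
    unfolding f_def n_def conj[OF S(2)] det_shift_eq_0_iff using nilpotent_eigenvector[OF 0] x by blast
  ultimately have "det (N p - x *\<^sub>C mat 1) \<noteq> 0"
    unfolding f_def n_def conj[OF S(2)] by simp
  then show "v = 0" unfolding det_shift_eq_0_iff using v by blast
qed

text \<open>After the resonances below \<open>k0\<close> are removed, the remaining coefficients are
  removed all at once: a solution of \<open>E g = Y g - g A1\<close> is exactly a gauge
  transformation from \<open>A1\<close> to its truncation \<open>Y\<close>. All weights of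
  \<open>Y\<close> lie in eigenspaces of \<open>ad S\<close>, whence the equation for
  \<open>N = Y - S\<close>.\<close>

lemma normal_form:
  fixes A :: "complex^3 \<Rightarrow> 'n::finite cmat"
  assumes H: "algebraic_group H" and A: "hmat A" "\<And>p. A p \<in> lie_algebra H"
  obtains h hi S N and Q P :: "'n cmat" and d m where "gauge H h hi" "\<forall>p. gE h hi A p = S + N p"
    "Q ** P = mat 1" "P ** Q = mat 1" "S = Q ** diagm d ** P" "S \<in> lie_algebra H"
    "hmat N" "\<forall>p. N p \<in> lie_algebra H" "\<forall>p. mE N p = S ** N p - N p ** S"
    "\<forall>p. ((**) (N p) ^^ m) (mat 1) = 0"
proof -
  obtain S N0 and Q P :: "'n cmat" and d where S: "A 0 = S + N0" "S ** N0 = N0 ** S"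
    "nilpotent_matrix N0" "Q ** P = mat 1" "P ** Q = mat 1" "S = Q ** diagm d ** P"
    and sub: "\<forall>z w. z *\<^sub>C S + w *\<^sub>C N0 \<in> lie_algebra H"
    using lie_algebra_Jordan[OF H A(2)[of 0]] by metis
  have SL: "S \<in> lie_algebra H" using sub[rule_format, of 1 0] by simp
  \<comment> \<open>\<open>A 0\<close> occurs twice because \<open>Y\<close> and \<open>A1\<close>
    both take this value at the origin.\<close>
  obtain k0 :: nat where k0: "norm (A 0) + norm (A 0) < real k0" using reals_Archimedean2 by blast
  have k0': "k0 > 0" using k0 by (cases k0) (auto simp: not_less[symmetric])
  obtain h hi where h: "gauge H h hi" "hmat (gE h hi A)" "\<And>p. gE h hi A p \<in> lie_algebra H"
    "gE h hi A 0 = A 0" "\<And>j. 0 < j \<Longrightarrow> j \<le> k0 \<Longrightarrow> graded S (gE h hi A) j"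
    using resonance_removal[OF H A S, of k0] by blast
  define A1 where "A1 = gE h hi A"
  note A1 = h(2-5)[folded A1_def]
  define Y where "Y p = (\<Sum>j<k0. mcf j A1 p)" for p
  have Y: "hmat Y" unfolding Y_def by (intro hmat_sum hmat_mcf A1)
  have Yc: "mcf j Y p = (if j < k0 then mcf j A1 p else 0)" for j p
  proof -
    have "mcf j Y p = (\<Sum>i<k0. mcf j (mcf i A1) p)"
      unfolding Y_def[abs_def] by (rule mcf_sum) (intro hmat_mcf A1)
    then show ?thesis by (simp add: mcf_mcf A1 sum.delta)
  qed
  have YL: "Y p \<in> lie_algebra H" for p
    unfolding Y_def
    by (rule subspace_sum, force simp: subspace_def lie_algebra_0 lie_algebra_add lie_algebra_scaleR H)
      (rule mcf_in_lie_algebra[OF H A1(1,2)])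
  have Y0: "Y 0 = A 0" using Yc[of 0 0] k0' A1(3) by simp
  obtain g gi where g: "hmat g" "hmat gi" "\<forall>p. g p ** gi p = mat 1" "\<forall>p. g p \<in> H" "g 0 = mat 1"
    and ode: "\<forall>p. mE g p = Y p ** g p - g p ** A1 p"
  proof (rule orbit_solution_in_group[OF H Y A1(1) YL A1(2) k0'])
    show "norm (Y 0) + norm (A1 0) < real k0" using k0 by (simp add: Y0 A1)
    show "mcf k Y p = mcf k A1 p" if "k < k0" for k p using that by (simp add: Yc)
  qed
  have gig: "gi p ** g p = mat 1" for p using g(3) matrix_left_right_inverse by blast
  have gg: "gauge H g gi" using g gig by (simp add: gauge_def)
  have "gE g gi A1 p = Y p" for p
    using ode g(3) by (simp add: gE_def mring)
  then have gEY: "gE (\<lambda>p. g p ** h p) (\<lambda>p. hi p ** gi p) A p = Y p" for p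
    using gE_comp[OF h(1) gg, of A p] by (simp add: A1_def)
  define N where "N p = Y p - S" for p
  have N: "hmat N" unfolding N_def by (intro hmat_diff Y hmat_const)
  have EN: "mE N p = S ** N p - N p ** S" for p
  proof (rule mcf_ext[OF hmat_mE[OF N] hmat_diff[OF hmat_mm[OF hmat_const N] hmat_mm[OF N hmat_const]]])
    fix k
    have "mcf k (\<lambda>p. S ** N p - N p ** S) p = S ** mcf k N p - mcf k N p ** S"
      by (rule mcf_clin[OF clin_diff[OF clin_mult_left clin_mult_right] N])
    also have "\<dots> = of_nat k *\<^sub>C mcf k N p"
    proof (cases "k = 0")
      case True
      then show ?thesis by (simp add: N_def Y0 S(1,2))
    next
      case False
      have "mcf k N p = mcf k Y p"
        using False by (simp add: N_def[abs_def] mcf_diff Y mcf_const)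
      then show ?thesis
        using A1(4)[of k] False by (simp add: Yc graded_def)
    qed
    finally show "mcf k (mE N) p = mcf k (\<lambda>p. S ** N p - N p ** S) p"
      by (simp add: mcf_mE N)
  qed
  have "nilpotent_matrix (N 0)" by (simp add: N_def Y0 S)
  from graded_nilpotent[OF N EN this S(4-6)]
  have nil: "\<forall>p. ((**) (N p) ^^ (DIM('n cmat) * DIM('n cmat))) (mat 1) = 0" by blast
  show ?thesis
    by (rule that[of "\<lambda>p. g p ** h p" "\<lambda>p. hi p ** gi p" S N Q P d, OF gauge_comp[OF H h(1) gg] _
          S(4-6) SL N _ _ nil])
      (use EN in \<open>auto simp: gEY N_def intro: lie_algebra_diff[OF H YL SL]\<close>)
qed

section \<open>Logarithmic fields and forms\<close>

lemma holomorphic_into_iff: "holomorphic_into T F \<longleftrightarrow> (\<forall>p. F p \<in> T) \<and> hmat F"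
proof (intro iffI conjI)
  assume F: "holomorphic_into T F"
  then show "\<forall>p. F p \<in> T" by (simp add: holomorphic_into_def)
  show "hmat F"
    unfolding hmat_def
  proof (intro allI holI)
    fix i j p
    obtain f' where f': "(F has_derivative f') (at p)" "\<And>c v. f' (c *s v) = c *\<^sub>C f' v"
      using F unfolding holomorphic_into_def by blast
    have "((\<lambda>p. F p $ i $ j) has_derivative (\<lambda>v. f' v $ i $ j)) (at p)"
      by (intro bounded_linear.has_derivative[OF bounded_linear_vec_nth] f')
    then show "\<exists>f'. ((\<lambda>p. F p $ i $ j) has_derivative f') (at p) \<and> (\<forall>c v. f' (c *s v) = c * f' v)"
      by (intro exI[of _ "\<lambda>v. f' v $ i $ j"]) (simp add: f')
  qed
next
  assume F: "(\<forall>p. F p \<in> T) \<and> hmat F"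
  then have "mpd (c *s v) F p = c *\<^sub>C mpd v F p" for c v p
    by (simp add: vec_eq_iff mpd_nth pd_scale hmat_entry)
  then show "holomorphic_into T F"
    unfolding holomorphic_into_def using F hmat_has_derivative by blast
qed

section \<open>Derivatives along vector fields and their Lie brackets\<close>

definition mD :: "(complex^3 \<Rightarrow> complex^3) \<Rightarrow> (complex^3 \<Rightarrow> 'n cmat) \<Rightarrow> complex^3 \<Rightarrow> 'n::finite cmat" where
  "mD Z F p = mpd (Z p) F p"

lemma mE_eq_mD: "mE F p = mD E_vf F p"
  by (simp add: mE_def mD_def)

lemma deriv_along_eq: "hmat F \<Longrightarrow> deriv_along Z F p = mD Z F p"
  unfolding deriv_along_def mD_def
  using frechet_derivative_at[OF hmat_has_derivative, of F p] by metis

lemma mpd_add_left: "hmat F \<Longrightarrow> mpd (u + v) F p = mpd u F p + mpd v F p"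
  and mpd_scale_left: "hmat F \<Longrightarrow> mpd (c *s v) F p = c *\<^sub>C mpd v F p"
  by (simp_all add: vec_eq_iff mpd_nth pd_add pd_scale hmat_entry)

lemma mpd_diff_left: "hmat F \<Longrightarrow> mpd (u - v) F p = mpd u F p - mpd v F p"
  using mpd_add_left[of F "u - v" v p] by (simp add: algebra_simps)

lemmas mD_rules = mpd_add mpd_diff mpd_cscale mpd_const mpd_mm

lemma hmat_mD:
  assumes "hmat F" "\<And>i. hol (\<lambda>p. Z p $ i)"
  shows "hmat (mD Z F)"
  unfolding hmat_def mD_def mpd_nth using assms by (intro allI hol_pd_field hmat_entry)

text \<open>The derivative of the components of \<open>Z\<close>; the bracket of two fields is
  \<open>jac (Z p) W p - jac (W p) Z p\<close>.\<close>

definition jac :: "complex^3 \<Rightarrow> (complex^3 \<Rightarrow> complex^3) \<Rightarrow> complex^3 \<Rightarrow> complex^3" where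
  "jac u Z p = (\<chi> i. pd u (\<lambda>q. Z q $ i) p)"

lemma pd_field:
  assumes f: "hol f" and Z: "\<And>i. hol (\<lambda>q. Z q $ i)"
  shows "pd u (\<lambda>q. pd (Z q) f q) p = pd (jac u Z p) f p + pd u (pd (Z p) f) p"
proof -
  have e: "pd u (\<lambda>q. pd (W q) f q) p = pd (jac u W p) f p
      + (\<Sum>i\<in>UNIV. W p $ i * pd u (pd (axis i 1) f) p)" if W: "\<And>i. hol (\<lambda>q. W q $ i)" for W
  proof -
    have "pd u (\<lambda>q. pd (W q) f q) p = pd u (\<lambda>q. \<Sum>i\<in>UNIV. W q $ i * pd (axis i 1) f q) p"
      by (rule arg_cong[where f="\<lambda>g. pd u g p"]) (rule ext, rule pd_expand[OF f])
    also have "\<dots> = (\<Sum>i\<in>UNIV. pd u (\<lambda>q. W q $ i) p * pd (axis i 1) f p)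
        + (\<Sum>i\<in>UNIV. W p $ i * pd u (pd (axis i 1) f) p)"
      using f W by (simp add: pd_sum pd_mult hol_mult hol_pd sum.distrib)
    also have "(\<Sum>i\<in>UNIV. pd u (\<lambda>q. W q $ i) p * pd (axis i 1) f p) = pd (jac u W p) f p"
      by (subst pd_expand[OF f, of "jac u W p"]) (simp add: jac_def)
    finally show ?thesis .
  qed
  have "pd (jac u (\<lambda>q. Z p) p) f p = 0" by (simp add: jac_def zero_vec_def[symmetric])
  with e[of Z] e[of "\<lambda>q. Z p"] Z show ?thesis by simp
qed

text \<open>The second derivatives cancel by \<open>pd_commute\<close>, and only the derivatives of
  the two fields are left.\<close>

lemma mD_commutator:
  assumes F: "hmat F" and Z: "\<And>i. hol (\<lambda>q. Z q $ i)" and W: "\<And>i. hol (\<lambda>q. W q $ i)"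
  shows "mD Z (mD W F) p - mD W (mD Z F) p = mpd (jac (Z p) W p - jac (W p) Z p) F p"
proof -
  have "mD Z (mD W F) p $ i $ j - mD W (mD Z F) p $ i $ j
      = mpd (jac (Z p) W p - jac (W p) Z p) F p $ i $ j" for i j
  proof -
    let ?f = "\<lambda>q. F q $ i $ j"
    have f: "hol ?f" by (rule hmat_entry[OF F])
    have "mD Z (mD W F) p $ i $ j = pd (jac (Z p) W p) ?f p + pd (Z p) (pd (W p) ?f) p"
      "mD W (mD Z F) p $ i $ j = pd (jac (W p) Z p) ?f p + pd (W p) (pd (Z p) ?f) p"
      unfolding mD_def mpd_nth by (rule pd_field[OF f W], rule pd_field[OF f Z])
    then show ?thesis
      by (simp add: mpd_diff_left[OF F] mpd_nth pd_commute[OF f, of "Z p"])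
  qed
  then show ?thesis by (simp add: vec_eq_iff)
qed

lemma V_vf_nth [simp]: "V_vf p $ 1 = 2 * p$2" "V_vf p $ 2 = - 24 * p$1 * p$2 + 2 * p$3"
    "V_vf p $ 3 = - 2 * (p$2)^2 - 32 * p$1 * p$3"
  and W_vf_nth [simp]: "W_vf p $ 1 = 3 * p$3" "W_vf p $ 2 = - 9 * (p$2)^2"
    "W_vf p $ 3 = - 12 * p$2 * p$3"
  by (simp_all add: V_vf_def W_vf_def)

lemma hol_V_vf: "hol (\<lambda>p. V_vf p $ i)" and hol_W_vf: "hol (\<lambda>p. W_vf p $ i)"
proof -
  have "hol (\<lambda>p. V_vf p $ i)" "hol (\<lambda>p. W_vf p $ i)" if "i = 1 \<or> i = 2 \<or> i = 3"
    using that
    by (elim disjE; simp only: V_vf_nth W_vf_nth;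
        intro hol_add hol_diff hol_mult hol_power hol_const hol_coord)+
  then show "hol (\<lambda>p. V_vf p $ i)" "hol (\<lambda>p. W_vf p $ i)" using exhaust_3[of i] by auto
qed

lemma pd_power: "hol f \<Longrightarrow> pd v (\<lambda>p. (f p)^2) p = 2 * f p * pd v f p"
  by (simp add: power2_eq_square pd_mult)

lemma pd_minus: "hol f \<Longrightarrow> pd v (\<lambda>p. - f p) p = - pd v f p"
  using pd_diff[OF hol_const, of f v 0 p] by simp

lemma jac_E: "jac u E_vf p = vector [u$1, 2 * u$2, 3 * u$3]"
  and jac_V: "jac u V_vf p = vector [2 * u$2, - 24 * (u$1 * p$2 + p$1 * u$2) + 2 * u$3,
    - 4 * p$2 * u$2 - 32 * (u$1 * p$3 + p$1 * u$3)]"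
  and jac_W: "jac u W_vf p = vector [3 * u$3, - 18 * p$2 * u$2, - 12 * (u$2 * p$3 + p$2 * u$3)]"
  by (simp_all add: vec_eq_iff forall_3 jac_def pd_plus pd_diff pd_mult pd_power pd_minus hol_add
      hol_diff hol_mult hol_power hol_minus algebra_simps)

lemma bracket_EV: "jac (E_vf p) V_vf p - jac (V_vf p) E_vf p = V_vf p"
  and bracket_EW: "jac (E_vf p) W_vf p - jac (W_vf p) E_vf p = 2 *s W_vf p"
  and bracket_VW: "jac (V_vf p) W_vf p - jac (W_vf p) V_vf p
    = (24 * p$3) *s E_vf p + (6 * p$2) *s V_vf p - (40 * p$1) *s W_vf p"
  by (simp_all add: vec_eq_iff forall_3 jac_E jac_V jac_W algebra_simps power2_eq_square)

text \<open>\<open>F_B5\<close> is monic of degree 3 in the third coordinate, so each line in that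
  direction meets the divisor in finitely many points, and continuity fills them in. The polynomial
  \<open>q\<close> is the expansion of \<open>F_B5\<close> along such a line.\<close>

lemma hol_eq_0_off_divisor:
  assumes f: "hol f" and z: "\<And>p. p \<notin> divisor \<Longrightarrow> f p = 0"
  shows "f p = 0"
proof -
  define e :: "complex^3" where "e = axis 3 1"
  have e: "e $ 1 = 0" "e $ 2 = 0" "e $ 3 = 1" by (simp_all add: e_def axis_def)
  define q where "q = [:p$1 * (p$2)^4 + (p$2)^3 * p$3 + (p$3)^3, (p$2)^3 + 3 * (p$3)^2, 3 * p$3, 1:]"
  have q: "F_B5 (p + t *s e) = poly q t" for t
    by (simp add: F_B5_def e q_def algebra_simps power2_eq_square power3_eq_cube)
  have "finite {t. poly q t = 0}" by (rule poly_roots_finite) (simp add: q_def)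
  then have "eventually (\<lambda>t. t \<notin> {t. poly q t = 0}) (at 0)"
    using islimpt_finite islimpt_iff_eventually by blast
  then have "eventually (\<lambda>t. f (p + t *s e) = 0) (at 0)"
    by eventually_elim (auto intro: z simp: divisor_def q)
  then have "((\<lambda>t. f (p + t *s e)) \<longlongrightarrow> 0) (at 0)" by (rule tendsto_eventually)
  moreover have "continuous_on UNIV (\<lambda>t. f (p + t *s e))"
    by (intro hol_continuous_compose[OF f] continuous_intros)
  then have "((\<lambda>t. f (p + t *s e)) \<longlongrightarrow> f (p + 0 *s e)) (at 0)"
    unfolding continuous_on_def by (metis UNIV_I)
  ultimately show ?thesis
    using tendsto_unique[of "at (0::complex)"] by fastforce
qed

lemma hmat_eq_off_divisor:
  assumes "hmat F" "hmat G" "\<And>p. p \<notin> divisor \<Longrightarrow> F p = G p"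
  shows "F p = G p"
proof -
  have "F p $ i $ j - G p $ i $ j = 0" for i j
    by (rule hol_eq_0_off_divisor[where f="\<lambda>p. F p $ i $ j - G p $ i $ j"])
      (use assms in \<open>auto intro!: hol_diff hmat_entry\<close>)
  then show ?thesis by (simp add: vec_eq_iff)
qed

lemma hol_F_B5: "hol F_B5"
  unfolding F_B5_def[abs_def]
  by (intro hol_add hol_mult hol_power hol_coord)

lemma closed_divisor: "closed divisor"
proof -
  have "divisor = F_B5 -` {0}" by (auto simp: divisor_def)
  then show ?thesis
    using closed_vimage[OF closed_singleton hol_continuous[OF hol_F_B5]] by metis
qed

lemma log_frame_nth: "log_frame p $ i $ j = (if j = 1 then E_vf p $ i else if j = 2 then V_vf p $ i else W_vf p $ i)"
  using exhaust_3[of j] by (auto simp: log_frame_def transpose_def)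

lemma hmat_log_frame: "hmat log_frame"
proof -
  have "hol (\<lambda>p. log_frame p $ i $ j)" for i j
    unfolding log_frame_nth by (cases "j = 1"; cases "j = 2") (simp_all add: hol_E_vf hol_V_vf hol_W_vf)
  then show ?thesis by (simp add: hmat_def)
qed

lemma log_frame_inv:
  assumes "p \<notin> divisor"
  shows "log_frame p ** matrix_inv (log_frame p) = mat 1"
  using assms by (intro matrix_inv_mult) (simp add: invertible_det_nz det_log_frame divisor_def)

lemma log_frame_expand:
  assumes "p \<notin> divisor"
  shows "u = alpha p u *s E_vf p + beta p u *s V_vf p + gamma p u *s W_vf p"
proof -
  have "u = log_frame p *v (matrix_inv (log_frame p) *v u)"
    using log_frame_inv[OF assms] by (simp add: matrix_vector_mul_assoc)
  moreover have "log_frame p *v x = x $ 1 *s E_vf p + x $ 2 *s V_vf p + x $ 3 *s W_vf p" for x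
    by (simp add: vec_eq_iff matrix_vector_mult_def sum_3 log_frame_nth mult.commute)
  ultimately show ?thesis
    unfolding alpha_def beta_def gamma_def by metis
qed

text \<open>Off the divisor Cramer's rule writes each coordinate as a quotient of holomorphic
  functions with denominator \<open>- 18 * F_B5\<close>.\<close>

lemma matrix_inv_log_frame_differentiable:
  assumes p: "p \<notin> divisor"
  shows "(\<lambda>q. (matrix_inv (log_frame q) *v u) $ k) differentiable (at p)"
proof -
  define M where "M q = (\<chi> i j. if j = k then u $ i else log_frame q $ i $ j)" for q :: "complex^3"
  have M: "hmat M"
    unfolding hmat_def
  proof (intro allI)
    fix i j
    show "hol (\<lambda>q. M q $ i $ j)"
      by (cases "j = k") (simp_all add: M_def hmat_entry[OF hmat_log_frame])
  qed
  have "(\<lambda>q. det (M q) / (- 18 * F_B5 q)) differentiable (at p)"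
  proof (intro derivative_intros)
    show "(\<lambda>q. det (M q)) differentiable (at p)" "F_B5 differentiable (at p)"
      using hol_has_derivative[OF hol_det[OF M]] hol_has_derivative[OF hol_F_B5]
      by (auto simp: differentiable_def)
  qed (use p in \<open>auto simp: divisor_def\<close>)
  then obtain d where d: "((\<lambda>q. det (M q) / (- 18 * F_B5 q)) has_derivative d) (at p)"
    by (auto simp: differentiable_def)
  have "((\<lambda>q. (matrix_inv (log_frame q) *v u) $ k) has_derivative d) (at p)"
  proof (rule has_derivative_transform_within_open[OF d, of "- divisor"])
    show "open (- divisor)" using closed_divisor by (rule open_Compl)
    fix q assume "q \<in> - divisor"
    then have q: "det (log_frame q) \<noteq> 0" "log_frame q *v (matrix_inv (log_frame q) *v u) = u"
      using log_frame_inv[of q] by (auto simp: det_log_frame divisor_def matrix_vector_mul_assoc)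
    show "det (M q) / (- 18 * F_B5 q) = (matrix_inv (log_frame q) *v u) $ k"
      using arg_cong[OF iffD1[OF cramer[OF q(1)] q(2)], of "\<lambda>x. x $ k"]
      by (simp add: M_def det_log_frame)
  qed (use p in auto)
  then show ?thesis by (auto simp: differentiable_def)
qed

lemma bounded_bilinear_cscale: "bounded_bilinear (\<lambda>c (M :: 'n::finite cmat). c *\<^sub>C M)"
  by (rule bounded_bilinear.intro)
    (auto simp: cscale_distrib cscale_scaleR vec_eq_iff intro!: exI[of _ 1])

lemma log_form_differentiable:
  fixes A B C :: "complex^3 \<Rightarrow> 'n::finite cmat"
  assumes p: "p \<notin> divisor" and ABC: "hmat A" "hmat B" "hmat C"
  shows "(\<lambda>q. log_form A B C q u) differentiable (at p)"
proof -
  have m: "(\<lambda>q. c q *\<^sub>C F q) differentiable (at p)"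
    if c: "c differentiable (at p)" and F: "hmat F" for c and F :: "complex^3 \<Rightarrow> 'n cmat"
  proof -
    obtain c' where "(c has_derivative c') (at p)"
      using c unfolding differentiable_def by blast
    from bounded_bilinear.FDERIV[OF bounded_bilinear_cscale this hmat_has_derivative[OF F]]
    show ?thesis by (auto simp: differentiable_def)
  qed
  show ?thesis
    unfolding log_form_def alpha_def beta_def gamma_def
    by (intro differentiable_add m matrix_inv_log_frame_differentiable p ABC)
qed

section \<open>Flatness in the logarithmic frame\<close>

text \<open>The curvature on the pairs \<open>(E, V)\<close>, \<open>(E, W)\<close>,
  \<open>(V, W)\<close>, expressed through the holomorphic coefficients. In this form it makes sense
  on the divisor too, where the forms have no values.\<close>

definition flat_at :: "complex^3 \<Rightarrow> (complex^3 \<Rightarrow> 'n::finite cmat) \<Rightarrow> (complex^3 \<Rightarrow> 'n cmat)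
    \<Rightarrow> (complex^3 \<Rightarrow> 'n cmat) \<Rightarrow> bool" where
  "flat_at p A B C \<longleftrightarrow>
     mD E_vf B p - mD V_vf A p - (A p ** B p - B p ** A p) = B p \<and>
     mD E_vf C p - mD W_vf A p - (A p ** C p - C p ** A p) = 2 *\<^sub>C C p \<and>
     mD V_vf C p - mD W_vf B p - (B p ** C p - C p ** B p)
       = (24 * p$3) *\<^sub>C A p + (6 * p$2) *\<^sub>C B p - (40 * p$1) *\<^sub>C C p"

lemma log_form_linear:
  "log_form A B C q (u + v) = log_form A B C q u + log_form A B C q v"
  "log_form A B C q (c *s u) = c *\<^sub>C log_form A B C q u"
  "log_form A B C q (u - v) = log_form A B C q u - log_form A B C q v"
proof -
  have l: "matrix_inv M *v (c *s u) = c *s (matrix_inv M *v u)" for M :: "3 cmat" and u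
    by (simp add: vec_eq_iff matrix_vector_mult_def sum_distrib_left mult_ac)
  show "log_form A B C q (u + v) = log_form A B C q u + log_form A B C q v"
    "log_form A B C q (c *s u) = c *\<^sub>C log_form A B C q u"
    "log_form A B C q (u - v) = log_form A B C q u - log_form A B C q v"
    by (simp_all add: log_form_def alpha_def beta_def gamma_def matrix_vector_right_distrib
        matrix_vector_mult_diff_distrib l cscale_distrib algebra_simps)
qed

lemma log_form_sum: "log_form A B C q (\<Sum>i\<in>I. f i) = (\<Sum>i\<in>I. log_form A B C q (f i))"
proof (induction I rule: infinite_finite_induct)
  case empty
  then show ?case using log_form_linear(2)[of A B C q 0 0] by simp
next
  case (infinite I)
  then show ?case using log_form_linear(2)[of A B C q 0 0] by simp
qed (simp add: log_form_linear)

lemma log_form_frame: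
  assumes "p \<notin> divisor"
  shows "log_form A B C p (E_vf p) = A p" "log_form A B C p (V_vf p) = B p"
    "log_form A B C p (W_vf p) = C p"
  using dual_basis[OF assms] by (simp_all add: log_form_def)

text \<open>The product rule for the value of the form on a varying field. \<open>F\<close> stands
  for the holomorphic extension of that value across the divisor.\<close>

lemma log_form_derivative_along:
  fixes A B C F :: "complex^3 \<Rightarrow> 'n::finite cmat"
  assumes p: "p \<notin> divisor" and ABC: "hmat A" "hmat B" "hmat C"
    and F: "hmat F" "\<And>q. q \<notin> divisor \<Longrightarrow> F q = log_form A B C q (Z q)"
    and Z: "\<And>i. hol (\<lambda>q. Z q $ i)"
  shows "mpd v F p = log_form A B C p (jac v Z p)
    + frechet_derivative (\<lambda>q. log_form A B C q (Z p)) (at p) v"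
proof -
  define D where "D u = frechet_derivative (\<lambda>q. log_form A B C q u) (at p)" for u
  have D: "((\<lambda>q. log_form A B C q u) has_derivative D u) (at p)" for u
    unfolding D_def using log_form_differentiable[OF p ABC] frechet_derivative_works by blast
  have e: "log_form A B C q u = (\<Sum>i\<in>UNIV. u $ i *\<^sub>C log_form A B C q (axis i 1))" for q u
  proof -
    have "log_form A B C q u = log_form A B C q (\<Sum>i\<in>UNIV. u $ i *s axis i 1)"
      by (simp only: basis_expansion)
    then show ?thesis by (simp only: log_form_sum log_form_linear)
  qed
  have Du: "D u v = (\<Sum>i\<in>UNIV. u $ i *\<^sub>C D (axis i 1) v)" for u
  proof -
    have "((\<lambda>q. \<Sum>i\<in>UNIV. u $ i *\<^sub>C log_form A B C q (axis i 1)) has_derivative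
        (\<lambda>v. \<Sum>i\<in>UNIV. u $ i *\<^sub>C D (axis i 1) v)) (at p)"
      by (intro has_derivative_sum bounded_linear.has_derivative[OF
          bounded_bilinear.bounded_linear_right[OF bounded_bilinear_cscale]] D)
    then have "((\<lambda>q. log_form A B C q u) has_derivative
        (\<lambda>v. \<Sum>i\<in>UNIV. u $ i *\<^sub>C D (axis i 1) v)) (at p)"
      by (simp only: e[symmetric])
    from has_derivative_unique[OF D this] show ?thesis by metis
  qed
  have "((\<lambda>q. \<Sum>i\<in>UNIV. Z q $ i *\<^sub>C log_form A B C q (axis i 1)) has_derivative
      (\<lambda>v. \<Sum>i\<in>UNIV. Z p $ i *\<^sub>C D (axis i 1) v + pd v (\<lambda>q. Z q $ i) p *\<^sub>C log_form A B C p (axis i 1)))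
      (at p)"
    by (intro has_derivative_sum bounded_bilinear.FDERIV[OF bounded_bilinear_cscale]
        hol_has_derivative Z D)
  moreover have "(\<lambda>q. \<Sum>i\<in>UNIV. Z q $ i *\<^sub>C log_form A B C q (axis i 1)) = (\<lambda>q. log_form A B C q (Z q))"
    by (simp only: e[symmetric])
  ultimately have G: "((\<lambda>q. log_form A B C q (Z q)) has_derivative
      (\<lambda>v. \<Sum>i\<in>UNIV. Z p $ i *\<^sub>C D (axis i 1) v + pd v (\<lambda>q. Z q $ i) p *\<^sub>C log_form A B C p (axis i 1)))
      (at p)"
    by simp
  have "(F has_derivative
      (\<lambda>v. \<Sum>i\<in>UNIV. Z p $ i *\<^sub>C D (axis i 1) v + pd v (\<lambda>q. Z q $ i) p *\<^sub>C log_form A B C p (axis i 1)))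
      (at p)"
    by (rule has_derivative_transform_within_open[OF G open_Compl[OF closed_divisor]])
      (use p F(2) in auto)
  from has_derivative_unique[OF hmat_has_derivative[OF F(1)] this]
  have "mpd v F p = (\<Sum>i\<in>UNIV. Z p $ i *\<^sub>C D (axis i 1) v)
      + (\<Sum>i\<in>UNIV. pd v (\<lambda>q. Z q $ i) p *\<^sub>C log_form A B C p (axis i 1))"
    by (simp only: sum.distrib[symmetric]) metis
  also have "(\<Sum>i\<in>UNIV. pd v (\<lambda>q. Z q $ i) p *\<^sub>C log_form A B C p (axis i 1)) = log_form A B C p (jac v Z p)"
    unfolding e[of p "jac v Z p"] by (simp add: jac_def)
  finally have "mpd v F p = D (Z p) v + log_form A B C p (jac v Z p)"
    by (simp only: Du[of "Z p"])
  then show ?thesis by (simp only: D_def add.commute)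
qed

text \<open>Off the divisor this is Cartan's formula: the exterior derivative on two fields is the
  difference of the crosswise derivatives minus the value on their bracket. The sign convention of
  \<open>bracket\<close> makes the quadratic term minus the matrix commutator. Both sides of each
  equation are holomorphic, so the equations extend.\<close>

lemma flat_connection_imp_flat_at:
  fixes A B C :: "complex^3 \<Rightarrow> 'n::finite cmat"
  assumes ABC: "hmat A" "hmat B" "hmat C" and \<omega>: "same_form \<omega> (log_form A B C)"
    and fl: "flat_connection \<omega>"
  shows "flat_at p A B C"
proof -
  let ?w = "log_form A B C"
  have ext: "ext_deriv ?w p u v = ?w p u ** ?w p v - ?w p v ** ?w p u" if p: "p \<notin> divisor" for p u v
  proof -
    have eq: "\<omega> q = ?w q" if "q \<notin> divisor" for q using \<omega> that by (simp add: same_form_def)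
    have "frechet_derivative (\<lambda>q. \<omega> q u) (at p) = frechet_derivative (\<lambda>q. ?w q u) (at p)" for u
    proof (rule frechet_derivative_at[symmetric])
      show "((\<lambda>q. \<omega> q u) has_derivative frechet_derivative (\<lambda>q. ?w q u) (at p)) (at p)"
        by (rule has_derivative_transform_within_open[OF
              iffD1[OF frechet_derivative_works log_form_differentiable[OF p ABC]]
              open_Compl[OF closed_divisor]])
          (use p eq in auto)
    qed
    then have "ext_deriv \<omega> p u v = ext_deriv ?w p u v" by (simp add: ext_deriv_def)
    moreover have "(1/2) *\<^sub>C form_bracket \<omega> \<omega> p u v = ?w p v ** ?w p u - ?w p u ** ?w p v"
    proof -
      have "form_bracket \<omega> \<omega> p u v = 2 *\<^sub>C (?w p v ** ?w p u - ?w p u ** ?w p v)"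
        by (simp add: form_bracket_def bracket_def eq[OF p] vec_eq_iff)
      then show ?thesis by simp
    qed
    moreover have "ext_deriv \<omega> p u v + (1/2) *\<^sub>C form_bracket \<omega> \<omega> p u v = 0"
      using fl p by (simp add: flat_connection_def)
    ultimately have "ext_deriv ?w p u v + (?w p v ** ?w p u - ?w p u ** ?w p v) = 0"
      by (simp only:)
    then show ?thesis by (simp add: add_eq_0_iff2)
  qed
  have main: "mD Z1 F2 p - mD Z2 F1 p - (F1 p ** F2 p - F2 p ** F1 p)
      = ?w p (jac (Z1 p) Z2 p - jac (Z2 p) Z1 p)"
    if p: "p \<notin> divisor" and F: "hmat F1" "hmat F2"
      and w: "\<And>q. q \<notin> divisor \<Longrightarrow> F1 q = ?w q (Z1 q)" "\<And>q. q \<notin> divisor \<Longrightarrow> F2 q = ?w q (Z2 q)"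
      and Z: "\<And>i. hol (\<lambda>q. Z1 q $ i)" "\<And>i. hol (\<lambda>q. Z2 q $ i)" for p F1 F2 Z1 Z2
    using ext[OF p, of "Z1 p" "Z2 p"]
      log_form_derivative_along[OF p ABC F(1) w(1) Z(1), of "Z2 p"]
      log_form_derivative_along[OF p ABC F(2) w(2) Z(2), of "Z1 p"]
    by (simp add: mD_def ext_deriv_def log_form_linear w(1,2)[OF p] algebra_simps)
  note fr = log_form_frame[of _ A B C, symmetric]
  have off: "flat_at p A B C" if p: "p \<notin> divisor" for p
    unfolding flat_at_def
    using main[OF p ABC(1,2) fr(1,2) hol_E_vf hol_V_vf] main[OF p ABC(1,3) fr(1,3) hol_E_vf hol_W_vf]
      main[OF p ABC(2,3) fr(2,3) hol_V_vf hol_W_vf]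
    by (simp add: bracket_EV bracket_EW bracket_VW log_form_linear log_form_frame[OF p])
  have h: "hmat (\<lambda>p. mD Z F p - mD Y G p - (K p ** L p - M p ** J p))"
    if "hmat F" "hmat G" "hmat K" "hmat L" "hmat M" "hmat J" "\<And>i. hol (\<lambda>q. Z q $ i)" "\<And>i. hol (\<lambda>q. Y q $ i)"
    for Z Y and F G K L M J :: "complex^3 \<Rightarrow> 'n cmat"
    using that by (intro hmat_diff hmat_mm hmat_mD)
  have c: "hol (\<lambda>p. a * p $ i :: complex)" for a and i :: 3 by (intro hol_mult hol_const hol_coord)
  show ?thesis
    unfolding flat_at_def
  proof (intro conjI)
    show "mD E_vf B p - mD V_vf A p - (A p ** B p - B p ** A p) = B p"
      by (rule hmat_eq_off_divisor[OF h]) (use ABC off hol_E_vf hol_V_vf in \<open>auto simp: flat_at_def\<close>)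
    show "mD E_vf C p - mD W_vf A p - (A p ** C p - C p ** A p) = 2 *\<^sub>C C p"
      by (rule hmat_eq_off_divisor[OF h hmat_cscale])
        (use ABC off hol_E_vf hol_W_vf in \<open>auto simp: flat_at_def\<close>)
    show "mD V_vf C p - mD W_vf B p - (B p ** C p - C p ** B p)
       = (24 * p$3) *\<^sub>C A p + (6 * p$2) *\<^sub>C B p - (40 * p$1) *\<^sub>C C p"
      by (rule hmat_eq_off_divisor[OF h hmat_diff[OF hmat_add[OF hmat_cscale hmat_cscale] hmat_cscale]])
        (use ABC off hol_V_vf hol_W_vf c in \<open>auto simp: flat_at_def\<close>)
  qed
qed

section \<open>Gauge transformation of components and of the curvature\<close>

definition gZ :: "(complex^3 \<Rightarrow> complex^3) \<Rightarrow> (complex^3 \<Rightarrow> 'n::finite cmat) \<Rightarrow> (complex^3 \<Rightarrow> 'n cmat)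
    \<Rightarrow> (complex^3 \<Rightarrow> 'n cmat) \<Rightarrow> complex^3 \<Rightarrow> 'n cmat" where
  "gZ Z h hi F p = h p ** F p ** hi p + mD Z h p ** hi p"

lemma gE_eq_gZ: "gE h hi A p = gZ E_vf h hi A p"
  by (simp add: gE_def gZ_def mE_eq_mD)

lemma hmat_gZ: "gauge H h hi \<Longrightarrow> hmat F \<Longrightarrow> (\<And>i. hol (\<lambda>q. Z q $ i)) \<Longrightarrow> hmat (gZ Z h hi F)"
  unfolding gZ_def[abs_def] gauge_def by (intro hmat_add hmat_mm hmat_mD) auto

text \<open>The term with the derivative of \<open>h\<close> is the velocity of the curve
  \<open>h (p + t v) hi p\<close>, which runs in \<open>H\<close> and starts at the
  identity.\<close>

lemma gZ_in_lie_algebra: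
  assumes H: "algebraic_group H" and g: "gauge H h hi" and F: "F p \<in> lie_algebra H"
  shows "gZ Z h hi F p \<in> lie_algebra H"
proof -
  have h: "hmat h" "h q \<in> H" "h p ** hi p = mat 1" for q using g by (auto simp: gauge_def)
  have inv: "hi p = matrix_inv (h p)" using matrix_inv_unique[OF h(3)] by simp
  have "mpd v h p ** hi p \<in> lie_algebra H" for v
  proof (rule lie_algebraI[OF H, of "\<lambda>t. h (p + t *\<^sub>R v) ** hi p"])
    show "h (p + t *\<^sub>R v) ** hi p \<in> H" for t
      unfolding inv by (intro alg_group_mult alg_group_inv H h)
    show "h (p + 0 *\<^sub>R v) ** hi p = mat 1" by (simp add: h)
    have "((\<lambda>t. p + t *\<^sub>R v) has_derivative (\<lambda>t. t *\<^sub>R v)) (at 0)"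
      by (auto intro!: derivative_eq_intros)
    from has_derivative_compose[OF this, of h "\<lambda>v. mpd v h p"] hmat_has_derivative[OF h(1), of p]
    have "((\<lambda>t. h (p + t *\<^sub>R v)) has_derivative (\<lambda>t. mpd (t *\<^sub>R v) h p)) (at 0)" by simp
    moreover have "mpd (t *\<^sub>R v) h p = t *\<^sub>R mpd v h p" for t
      by (rule linear_cmul[OF has_derivative_linear[OF hmat_has_derivative[OF h(1)]]])
    ultimately have "((\<lambda>t. h (p + t *\<^sub>R v)) has_vector_derivative mpd v h p) (at 0)"
      by (simp add: has_vector_derivative_def)
    then show "((\<lambda>t. h (p + t *\<^sub>R v) ** hi p) has_vector_derivative mpd v h p ** hi p) (at 0)"
      by (rule bounded_linear.has_vector_derivative[OF mm.bounded_linear_left])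
  qed
  then show ?thesis
    unfolding gZ_def mD_def inv[symmetric] using h F
    by (intro lie_algebra_add[OF H]) (simp_all add: inv lie_algebra_Ad[OF H F])
qed

text \<open>The relations \<open>G h = h F + Z h\<close> are differentiated instead of the formula
  for \<open>G\<close>, so that no derivative of \<open>hi\<close> occurs. The second derivatives of
  \<open>h\<close> remain as a commutator of derivations.\<close>

lemma gauge_curvature:
  fixes F1 F2 :: "complex^3 \<Rightarrow> 'n::finite cmat"
  assumes g: "gauge H h hi" and F: "hmat F1" "hmat F2"
    and Z: "\<And>i. hol (\<lambda>q. Z1 q $ i)" "\<And>i. hol (\<lambda>q. Z2 q $ i)"
  defines "G1 \<equiv> gZ Z1 h hi F1" and "G2 \<equiv> gZ Z2 h hi F2"
  shows "mD Z1 G2 p - mD Z2 G1 p - (G1 p ** G2 p - G2 p ** G1 p)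
    = h p ** (mD Z1 F2 p - mD Z2 F1 p - (F1 p ** F2 p - F2 p ** F1 p)) ** hi p
      + mpd (jac (Z1 p) Z2 p - jac (Z2 p) Z1 p) h p ** hi p"
proof -
  have h: "hmat h" "\<And>q. h q ** hi q = mat 1" "\<And>q. hi q ** h q = mat 1" using g by (auto simp: gauge_def)
  have G: "hmat G1" "hmat G2" unfolding G1_def G2_def by (intro hmat_gZ[OF g] F Z)+
  have e: "G1 q ** h q = h q ** F1 q + mD Z1 h q" "G2 q ** h q = h q ** F2 q + mD Z2 h q" for q
    by (simp_all add: G1_def G2_def gZ_def mring h)
  have d: "mD Y G p ** h p + G p ** mD Y h p = mD Y h p ** F p + h p ** mD Y F p + mD Y (mD Z h) p"
    if "hmat G" "hmat F" "\<And>q. G q ** h q = h q ** F q + mD Z h q" "\<And>i. hol (\<lambda>q. Z q $ i)"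
    for Y Z and F G :: "complex^3 \<Rightarrow> 'n cmat"
  proof -
    have "mpd (Y p) G p ** h p + G p ** mpd (Y p) h p = mpd (Y p) (\<lambda>q. G q ** h q) p"
      by (rule mpd_mm[OF that(1) h(1), symmetric])
    also have "\<dots> = mpd (Y p) (\<lambda>q. h q ** F q + mD Z h q) p"
      by (simp only: that(3))
    also have "\<dots> = mpd (Y p) h p ** F p + h p ** mpd (Y p) F p + mpd (Y p) (mD Z h) p"
      by (simp add: mpd_add mpd_mm hmat_mm hmat_mD h(1) that(2,4))
    finally show ?thesis by (simp only: mD_def[of Y])
  qed
  have d1: "mD Z1 G2 p ** h p + G2 p ** mD Z1 h p
      = mD Z1 h p ** F2 p + h p ** mD Z1 F2 p + mD Z1 (mD Z2 h) p"
    by (rule d[OF G(2) F(2) e(2) Z(2)])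
  have d2: "mD Z2 G1 p ** h p + G1 p ** mD Z2 h p
      = mD Z2 h p ** F1 p + h p ** mD Z2 F1 p + mD Z2 (mD Z1 h) p"
    by (rule d[OF G(1) F(1) e(1) Z(1)])
  have m: "mD Z1 h p = G1 p ** h p - h p ** F1 p" "mD Z2 h p = G2 p ** h p - h p ** F2 p"
    by (simp_all add: e)
  have "(mD Z1 G2 p - mD Z2 G1 p - (G1 p ** G2 p - G2 p ** G1 p)) ** h p
    = h p ** (mD Z1 F2 p - mD Z2 F1 p - (F1 p ** F2 p - F2 p ** F1 p))
      + (mD Z1 (mD Z2 h) p - mD Z2 (mD Z1 h) p)"
  proof -
    have x: "mD Z1 G2 p ** h p = mD Z1 h p ** F2 p + h p ** mD Z1 F2 p + mD Z1 (mD Z2 h) p - G2 p ** mD Z1 h p"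
      "mD Z2 G1 p ** h p = mD Z2 h p ** F1 p + h p ** mD Z2 F1 p + mD Z2 (mD Z1 h) p - G1 p ** mD Z2 h p"
      using d1 d2 by (simp_all add: algebra_simps)
    show ?thesis
      unfolding matrix_sub_rdistrib x unfolding m by (simp add: mring)
  qed
  then have "(mD Z1 G2 p - mD Z2 G1 p - (G1 p ** G2 p - G2 p ** G1 p)) ** h p ** hi p
    = (h p ** (mD Z1 F2 p - mD Z2 F1 p - (F1 p ** F2 p - F2 p ** F1 p))
      + (mD Z1 (mD Z2 h) p - mD Z2 (mD Z1 h) p)) ** hi p"
    by (rule arg_cong)
  moreover have "X ** h p ** hi p = X" for X :: "'n cmat"
    by (simp add: h flip: matrix_mul_assoc)
  ultimately show ?thesis
    by (simp only: mD_commutator[OF h(1) Z(1) Z(2)] matrix_add_rdistrib')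
qed

text \<open>The extra term of \<open>gauge_curvature\<close> is linear in the bracket of the fields,
  which has the same structure functions as the right-hand sides of \<open>flat_at\<close>. Together
  they form the gauge transforms of the coefficients.\<close>

lemma gauge_flat:
  fixes A B C :: "complex^3 \<Rightarrow> 'n::finite cmat"
  assumes g: "gauge H h hi" and ABC: "hmat A" "hmat B" "hmat C" and fl: "\<And>p. flat_at p A B C"
  shows "flat_at p (gZ E_vf h hi A) (gZ V_vf h hi B) (gZ W_vf h hi C)"
proof -
  have h: "hmat h" using g by (simp add: gauge_def)
  have f: "mD E_vf B p - mD V_vf A p - (A p ** B p - B p ** A p) = B p"
    "mD E_vf C p - mD W_vf A p - (A p ** C p - C p ** A p) = 2 *\<^sub>C C p"
    "mD V_vf C p - mD W_vf B p - (B p ** C p - C p ** B p)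
       = (24 * p$3) *\<^sub>C A p + (6 * p$2) *\<^sub>C B p - (40 * p$1) *\<^sub>C C p"
    using fl[of p] by (simp_all only: flat_at_def)
  show ?thesis
    unfolding flat_at_def
      gauge_curvature[OF g ABC(1,2) hol_E_vf hol_V_vf] gauge_curvature[OF g ABC(1,3) hol_E_vf hol_W_vf]
      gauge_curvature[OF g ABC(2,3) hol_V_vf hol_W_vf] f bracket_EV bracket_EW bracket_VW
    by (simp add: mpd_diff_left[OF h] mpd_add_left[OF h] mpd_scale_left[OF h] gZ_def mD_def[of _ h]
        mring cscale_distrib)
qed

text \<open>For \<open>T f = E f - w f - [S, f]\<close> and \<open>g = T B\<close> one has \<open>T g = [N, g]\<close>, and \<open>ad N\<close> is nilpotent
  and commutes with \<open>T\<close>. As \<open>T\<close> acts semisimply on weighted Taylor coefficients, \<open>T g = 0\<close>, and then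
  \<open>T (T B) = 0\<close> forces \<open>T B = 0\<close>.\<close>

lemma weight_equation_splits:
  fixes B N :: "complex^3 \<Rightarrow> 'n::finite cmat" and S P Q :: "'n cmat"
  assumes B: "hmat B" and N: "hmat N" and v: "hmat v"
    and S: "P ** Q = mat 1" "Q ** P = mat 1" "S = Q ** diagm d ** P"
    and nil: "\<And>p. ((**) (N p) ^^ m) (mat 1) = 0"
    and EN: "\<And>p. mE N p = S ** N p - N p ** S"
    and Ev: "\<And>p. mE v p = w *\<^sub>C v p + (S ** v p - v p ** S)"
    and EB: "\<And>p. mE B p - w *\<^sub>C B p - (S ** B p - B p ** S) = v p + (N p ** B p - B p ** N p)"
  shows "mE B p = w *\<^sub>C B p + (S ** B p - B p ** S)" "v p = B p ** N p - N p ** B p"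
proof -
  define T where "T F = (\<lambda>p. mE F p - w *\<^sub>C F p - (S ** F p - F p ** S))" for F :: "complex^3 \<Rightarrow> 'n cmat"
  define n where "n F = (\<lambda>p. N p ** F p - F p ** N p)" for F :: "complex^3 \<Rightarrow> 'n cmat"
  have hT: "hmat (T F)" if "hmat F" for F
    unfolding T_def by (intro hmat_diff hmat_mE hmat_cscale hmat_mm hmat_const hol_const that)
  have hn: "hmat (n F)" if "hmat F" for F
    unfolding n_def by (intro hmat_diff hmat_mm N that)
  have mT: "mcf k (T F) p = (of_nat k - w) *\<^sub>C mcf k F p - (S ** mcf k F p - mcf k F p ** S)"
    if F: "hmat F" for F k p
  proof -
    have c: "clin (\<lambda>Z. w *\<^sub>C Z + (S ** Z - Z ** S))"
      by (intro clinI) (simp_all add: mring cscale_distrib mult.commute)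
    have "T F = (\<lambda>p. mE F p - (w *\<^sub>C F p + (S ** F p - F p ** S)))"
      by (simp add: T_def fun_eq_iff algebra_simps)
    then have "mcf k (T F) p = mcf k (mE F) p - mcf k (\<lambda>p. w *\<^sub>C F p + (S ** F p - F p ** S)) p"
      using F by (simp only:) (intro mcf_diff hmat_mE hmat_clin[OF c])
    then show ?thesis
      by (simp only: mcf_clin[OF c F] mcf_mE[OF F] cscale_distrib) (simp add: algebra_simps)
  qed
  have kern: "T F = (\<lambda>p. 0)" if F: "hmat F" and Tm: "(T ^^ k) F = (\<lambda>p. 0)" for F k
  proof
    fix p
    have "mcf j (T F) p = 0" for j
    proof -
      let ?o = "\<lambda>Z. (of_nat j - w) *\<^sub>C Z - (S ** Z - Z ** S)"
      have "hmat ((T ^^ k) F) \<and> mcf j ((T ^^ k) F) p = (?o ^^ k) (mcf j F p)" for k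
        by (induction k) (simp_all add: F hT mT)
      then have "(?o ^^ k) (mcf j F p) = 0" using Tm by (metis mcf_const)
      then show ?thesis unfolding mT[OF F] by (rule semisimple_kernel[OF S])
    qed
    then show "T F p = 0"
      by (intro mcf_ext[OF hT[OF F] hmat_const]) (simp add: mcf_const)
  qed
  \<comment> \<open>By \<open>EN\<close> the derivation \<open>mE - ad S\<close> kills
    \<open>N\<close>, and so it commutes with \<open>ad N\<close>.\<close>
  have Tn: "T (n F) = n (T F)" if F: "hmat F" for F
  proof
    fix p
    have "mE (n F) p = mE N p ** F p + N p ** mE F p - (mE F p ** N p + F p ** mE N p)"
      unfolding n_def by (simp add: mE_diff mE_mm hmat_mm N F)
    then show "T (n F) p = n (T F) p"
      by (simp add: T_def n_def EN mring cscale_distrib)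
  qed
  define g where "g = T B"
  have g: "g = (\<lambda>p. v p + n B p)" unfolding g_def using EB by (simp add: T_def n_def fun_eq_iff)
  have hg: "hmat g" unfolding g_def by (rule hT[OF B])
  have Tg: "T g = n g"
  proof
    fix p
    have "mE g p = mE v p + mE (n B) p"
      unfolding g using v hn[OF B] by (simp add: mE_eq_mD mD_def mpd_add)
    then have "T g p = T v p + T (n B) p"
      unfolding T_def g by (simp add: mring cscale_distrib)
    also have "T v p = 0" by (simp add: T_def Ev)
    also have "T (n B) p = n g p" unfolding Tn[OF B] g_def ..
    finally show "T g p = n g p" by simp
  qed
  have hnk: "hmat ((n ^^ k) g)" for k by (induction k) (simp_all add: hg hn)
  have Tnk: "T ((n ^^ k) g) = (n ^^ Suc k) g" for k
    by (induction k) (simp_all add: Tg Tn hnk)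
  \<comment> \<open>\<open>T\<close> acts on the iterates of \<open>n\<close> at \<open>g\<close> as
    \<open>n\<close> itself, so nilpotency of \<open>ad N\<close> becomes nilpotency of
    \<open>T\<close> at \<open>g\<close>.\<close>
  have TN: "(T ^^ k) g = (n ^^ k) g" for k
    by (induction k) (simp_all add: Tnk)
  have "(n ^^ k) F p = ((\<lambda>Z. N p ** Z - Z ** N p) ^^ k) (F p)" for k F p
    by (induction k) (simp_all add: n_def)
  moreover have "((\<lambda>Z. N p ** Z - Z ** N p) ^^ (m + m)) Z = 0" for p Z
    by (rule ad_nilpotent(2)[OF nil])
  ultimately have "(T ^^ (m + m)) g = (\<lambda>p. 0)" by (simp add: TN fun_eq_iff)
  then have "T g = (\<lambda>p. 0)" by (rule kern[OF hg])
  then have "(T ^^ 2) B = (\<lambda>p. 0)" by (simp add: numeral_2_eq_2 g_def)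
  then have g0: "g = (\<lambda>p. 0)" unfolding g_def by (rule kern[OF B])
  then have "T B p = 0" by (simp add: g_def)
  then show "mE B p = w *\<^sub>C B p + (S ** B p - B p ** S)" by (simp add: T_def algebra_simps)
  have "v p + n B p = 0" using g0 g by metis
  then show "v p = B p ** N p - N p ** B p" by (simp add: n_def add_eq_0_iff2)
qed

lemma gauge_action_log_form:
  assumes g: "gauge H h hi" and p: "p \<notin> divisor"
    and w: "\<omega> p = log_form A B C p"
  shows "gauge_action h \<omega> p u = log_form (gZ E_vf h hi A) (gZ V_vf h hi B) (gZ W_vf h hi C) p u"
proof -
  have h: "hmat h" "h p ** hi p = mat 1" using g by (auto simp: gauge_def)
  have hi: "matrix_inv (h p) = hi p" by (rule matrix_inv_unique[OF h(2)])
  have "frechet_derivative h (at p) u = mpd u h p"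
    using frechet_derivative_at[OF hmat_has_derivative[OF h(1)], of p] by metis
  also have "\<dots> = mpd (alpha p u *s E_vf p + beta p u *s V_vf p + gamma p u *s W_vf p) h p"
    using log_frame_expand[OF p, of u] by simp
  also have "\<dots> = alpha p u *\<^sub>C mD E_vf h p + beta p u *\<^sub>C mD V_vf h p + gamma p u *\<^sub>C mD W_vf h p"
    by (simp add: mpd_add_left mpd_scale_left h(1) mD_def)
  finally show ?thesis
    by (simp add: gauge_action_def w hi log_form_def gZ_def mring cscale_distrib)
qed

theorem theorem1p1:
  fixes H :: "(complex^'n^'n) set" and \<omega> :: "(complex^'n^'n) form1"
  assumes "connected_reductive_group H"
    and "log_connection H \<omega>"
    and "flat_connection \<omega>"
  shows "\<exists>h S N B C.
    holomorphic_into H h \<and>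
    S \<in> lie_algebra H \<and> semisimple_matrix S \<and>
    holomorphic_into (lie_algebra H) N \<and> (\<forall>p. nilpotent_matrix (N p)) \<and>
    holomorphic_into (lie_algebra H) B \<and>
    holomorphic_into (lie_algebra H) C \<and>
    same_form (gauge_action h \<omega>)
      (log_form (\<lambda>p. S + N p)
                (\<lambda>p. B p - (32/3 * p$1) *\<^sub>C N p)
                (\<lambda>p. C p - (4 * p$2) *\<^sub>C N p)) \<and>
    (\<forall>p. deriv_along E_vf B p = B p + bracket (B p) S) \<and>
    (\<forall>p. deriv_along E_vf C p = 2 *\<^sub>C C p + bracket (C p) S) \<and>
    (\<forall>p. deriv_along E_vf N p = bracket (N p) S) \<and>
    (\<forall>p. deriv_along V_vf N p = bracket (N p) (B p)) \<and>
    (\<forall>p. deriv_along W_vf N p = bracket (N p) (C p)) \<and>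
    (\<forall>p. deriv_along V_vf C p - deriv_along W_vf B p =
       (24 * p$3) *\<^sub>C S + (6 * p$2) *\<^sub>C B p - (40 * p$1) *\<^sub>C C p - bracket (B p) (C p))"
proof -
  have H: "algebraic_group H" using assms(1) by (simp add: connected_reductive_group_def)
  obtain A B0 C0 where ABC: "hmat A" "hmat B0" "hmat C0"
    and L: "\<And>p. A p \<in> lie_algebra H" "\<And>p. B0 p \<in> lie_algebra H" "\<And>p. C0 p \<in> lie_algebra H"
    and \<omega>: "same_form \<omega> (log_form A B0 C0)"
    using assms(2) unfolding log_connection_def holomorphic_into_iff by blast
  obtain h hi S N and Q P :: "'n cmat" and d m where g: "gauge H h hi"
    and A': "\<forall>p. gE h hi A p = S + N p" and S: "Q ** P = mat 1" "P ** Q = mat 1" "S = Q ** diagm d ** P"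
    and SL: "S \<in> lie_algebra H" and N: "hmat N" and NL: "\<forall>p. N p \<in> lie_algebra H"
    and EN: "\<forall>p. mE N p = S ** N p - N p ** S" and nil: "\<forall>p. ((**) (N p) ^^ m) (mat 1) = 0"
    by (rule normal_form[OF H ABC(1) L(1)])
  define B1 where "B1 = gZ V_vf h hi B0"
  define C1 where "C1 = gZ W_vf h hi C0"
  have hB1: "hmat B1" and hC1: "hmat C1"
    unfolding B1_def C1_def by (intro hmat_gZ[OF g] ABC hol_V_vf hol_W_vf)+
  have BL1: "B1 p \<in> lie_algebra H" and CL1: "C1 p \<in> lie_algebra H" for p
    unfolding B1_def C1_def by (intro gZ_in_lie_algebra[OF H g] L)+
  have A'': "gZ E_vf h hi A = (\<lambda>p. S + N p)"
    using A' by (simp add: fun_eq_iff gE_eq_gZ)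
  have fl: "flat_at p (\<lambda>p. S + N p) B1 C1" for p
    unfolding A''[symmetric] B1_def C1_def
    by (rule gauge_flat[OF g ABC flat_connection_imp_flat_at[OF ABC \<omega> assms(3)]])
  have dSN: "mD Z (\<lambda>p. S + N p) p = mD Z N p" for Z p
    by (simp add: mD_def mpd_add N mpd_const)
  have V: "hmat (mD V_vf N)" and W: "hmat (mD W_vf N)"
    by (intro hmat_mD N hol_V_vf hol_W_vf)+
  \<comment> \<open>Differentiating \<open>E N = S N - N S\<close> along \<open>Z\<close> and
    exchanging the derivatives shows that \<open>V(N)\<close> and \<open>W(N)\<close> have weights 1
    and 2, the condition \<open>Ev\<close> of \<open>weight_equation_splits\<close>.\<close>
  have EZ: "mE (mD Z N) p = mpd (jac (E_vf p) Z p - jac (Z p) E_vf p) N p + (S ** mD Z N p - mD Z N p ** S)"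
    if Z: "\<And>i. hol (\<lambda>q. Z q $ i)" for Z p
  proof -
    have "mE N = (\<lambda>p. S ** N p - N p ** S)" using EN by (simp add: fun_eq_iff)
    then have "mD Z (mE N) p = mpd (Z p) (\<lambda>p. S ** N p - N p ** S) p"
      by (simp only: mD_def)
    also have "\<dots> = S ** mD Z N p - mD Z N p ** S"
      by (simp add: mD_rules N hmat_mm mD_def)
    finally have "mD Z (mE N) p = S ** mD Z N p - mD Z N p ** S" .
    moreover have "mD Z (mE N) p = mD Z (mD E_vf N) p" by (simp add: mE_eq_mD[abs_def])
    ultimately show ?thesis
      using mD_commutator[OF N hol_E_vf Z, of p] by (simp add: mE_eq_mD algebra_simps)
  qed
  have EV: "mE (mD V_vf N) p = 1 *\<^sub>C mD V_vf N p + (S ** mD V_vf N p - mD V_vf N p ** S)" for p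
    by (simp add: EZ hol_V_vf bracket_EV mD_def)
  have EW: "mE (mD W_vf N) p = 2 *\<^sub>C mD W_vf N p + (S ** mD W_vf N p - mD W_vf N p ** S)" for p
    by (simp add: EZ hol_W_vf bracket_EW mD_def mpd_scale_left[OF N])
  have EB0: "mE B1 p - 1 *\<^sub>C B1 p - (S ** B1 p - B1 p ** S) = mD V_vf N p + (N p ** B1 p - B1 p ** N p)" for p
    using fl[of p] by (simp add: flat_at_def dSN mE_eq_mD mring algebra_simps)
  have EC0: "mE C1 p - 2 *\<^sub>C C1 p - (S ** C1 p - C1 p ** S) = mD W_vf N p + (N p ** C1 p - C1 p ** N p)" for p
    using fl[of p] by (simp add: flat_at_def dSN mE_eq_mD mring algebra_simps)
  note splitB = weight_equation_splits[OF hB1 N V S(2,1,3) spec[OF nil] spec[OF EN] EV EB0]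
  note splitC = weight_equation_splits[OF hC1 N W S(2,1,3) spec[OF nil] spec[OF EN] EW EC0]
  have VC: "mD V_vf C1 p - mD W_vf B1 p - (B1 p ** C1 p - C1 p ** B1 p)
      = (24 * p$3) *\<^sub>C (S + N p) + (6 * p$2) *\<^sub>C B1 p - (40 * p$1) *\<^sub>C C1 p" for p
    using fl[of p] by (simp only: flat_at_def)
  \<comment> \<open>For added terms \<open>a x N\<close> and \<open>b y N\<close>, with
    \<open>V(y) = - 24 x y + 2 z\<close> and \<open>W(x) = 3 z\<close>, the multiples of
    \<open>N\<close> itself in the third flatness equation cancel exactly if
    \<open>24 + 2 b - 3 a = 0\<close> and \<open>16 b - 6 a = 0\<close>, that is for
    \<open>a = 32/3\<close> and \<open>b = 4\<close>.\<close>
  define B where "B p = B1 p + (32/3 * p$1) *\<^sub>C N p" for p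
  define C where "C p = C1 p + (4 * p$2) *\<^sub>C N p" for p
  have hx: "hol (\<lambda>p :: complex^3. 32/3 * p$1)" "hol (\<lambda>p :: complex^3. 4 * p$2)"
    by (intro hol_mult hol_const hol_coord)+
  have hB: "hmat B" and hC: "hmat C"
    unfolding B_def C_def by (intro hmat_add hmat_cscale hx hB1 hC1 N)+
  have dB: "mD Z B p = mD Z B1 p + (32/3 * Z p $ 1) *\<^sub>C N p + (32/3 * p$1) *\<^sub>C mD Z N p"
    and dC: "mD Z C p = mD Z C1 p + (4 * Z p $ 2) *\<^sub>C N p + (4 * p$2) *\<^sub>C mD Z N p" for Z p
    unfolding B_def[abs_def] C_def[abs_def] mD_def
    by (simp_all only: mpd_add[OF hB1 hmat_cscale[OF hx(1) N]] mpd_add[OF hC1 hmat_cscale[OF hx(2) N]]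
        mpd_cscale[OF hx(1) N] mpd_cscale[OF hx(2) N] pd_mult[OF hol_const hol_coord] pd_const pd_coord)
      (simp_all add: add.assoc)
  \<comment> \<open>The coordinates \<open>x\<close> and \<open>y\<close> have weights 1 and 2, so
    the added terms obey the same weight equations as \<open>B1\<close> and
    \<open>C1\<close>.\<close>
  have 1: "mD E_vf B p = B p + bracket (B p) S" for p
    using splitB(1)[of p] EN
    by (simp add: dB B_def bracket_def mE_eq_mD[symmetric] mring cscale_distrib)
  have 2: "mD E_vf C p = 2 *\<^sub>C C p + bracket (C p) S" for p
    using splitC(1)[of p] EN
    by (simp add: dC C_def bracket_def mE_eq_mD[symmetric] mring cscale_distrib)
  have 3: "mD E_vf N p = bracket (N p) S" for p
    using EN by (simp add: bracket_def mE_eq_mD[symmetric])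
  have 4: "mD V_vf N p = bracket (N p) (B p)" for p
    unfolding splitB(2)[of p] by (simp add: B_def bracket_def mring)
  have 5: "mD W_vf N p = bracket (N p) (C p)" for p
    unfolding splitC(2)[of p] by (simp add: C_def bracket_def mring)
  have 6: "mD V_vf C p - mD W_vf B p =
       (24 * p$3) *\<^sub>C S + (6 * p$2) *\<^sub>C B p - (40 * p$1) *\<^sub>C C p - bracket (B p) (C p)" for p
  proof -
    have "mD V_vf C p - mD W_vf B p = (mD V_vf C1 p - mD W_vf B1 p)
      + (4 * V_vf p $ 2 - 32/3 * W_vf p $ 1) *\<^sub>C N p
      + (4 * p$2) *\<^sub>C mD V_vf N p - (32/3 * p$1) *\<^sub>C mD W_vf N p"
      by (simp add: dB dC cscale_distrib del: V_vf_nth W_vf_nth)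
    also have "mD V_vf C1 p - mD W_vf B1 p = (B1 p ** C1 p - C1 p ** B1 p)
      + ((24 * p$3) *\<^sub>C (S + N p) + (6 * p$2) *\<^sub>C B1 p - (40 * p$1) *\<^sub>C C1 p)"
      using VC[of p] by (simp add: algebra_simps)
    \<comment> \<open>The derivatives of \<open>N\<close> become commutators and complete the
      commutator of \<open>B1\<close> and \<open>C1\<close> to that of \<open>B\<close> and
      \<open>C\<close>.\<close>
    also note splitB(2)[of p]
    also note splitC(2)[of p]
    also have "(B1 p ** C1 p - C1 p ** B1 p)
      + ((24 * p$3) *\<^sub>C (S + N p) + (6 * p$2) *\<^sub>C B1 p - (40 * p$1) *\<^sub>C C1 p)
      + (4 * V_vf p $ 2 - 32/3 * W_vf p $ 1) *\<^sub>C N p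
      + (4 * p$2) *\<^sub>C (B1 p ** N p - N p ** B1 p) - (32/3 * p$1) *\<^sub>C (C1 p ** N p - N p ** C1 p)
      = (24 * p$3) *\<^sub>C S + (6 * p$2) *\<^sub>C B p - (40 * p$1) *\<^sub>C C p - bracket (B p) (C p)"
      by (simp add: B_def C_def bracket_def mring cscale_distrib) (simp add: vec_eq_iff algebra_simps)
    finally show ?thesis .
  qed
  have "semisimple_matrix S"
    unfolding semisimple_matrix_def
  proof (intro exI[of _ P] conjI allI impI)
    show "invertible P" using S by (auto simp: invertible_def)
    have "P ** S ** matrix_inv P = (P ** Q) ** diagm d ** (P ** Q)"
      by (simp only: matrix_inv_unique[OF S(2)] S(3) matrix_mul_assoc)
    then show "(P ** S ** matrix_inv P) $ i $ j = 0" if "i \<noteq> j" for i j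
      using that by (simp add: S diagm_def)
  qed
  moreover have "same_form (gauge_action h \<omega>)
      (log_form (\<lambda>p. S + N p) (\<lambda>p. B p - (32/3 * p$1) *\<^sub>C N p) (\<lambda>p. C p - (4 * p$2) *\<^sub>C N p))"
  proof -
    have "gauge_action h \<omega> p u = log_form (\<lambda>p. S + N p) B1 C1 p u" if "p \<notin> divisor" for p u
      using gauge_action_log_form[OF g that, of \<omega> A B0 C0 u] \<omega> that
      by (simp add: same_form_def A'' B1_def C1_def)
    then show ?thesis
      by (simp add: same_form_def fun_eq_iff B_def C_def)
  qed
  moreover have "B p \<in> lie_algebra H" "C p \<in> lie_algebra H" for p
    unfolding B_def C_def using NL
    by (auto intro!: lie_algebra_add[OF H] lie_algebra_cscale[OF H] BL1 CL1)
  moreover have "nilpotent_matrix (N p)" for p using nil by (auto simp: nilpotent_matrix_def)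
  moreover have "hmat h" "\<And>p. h p \<in> H" using g by (auto simp: gauge_def)
  ultimately show ?thesis
    using SL N NL hB hC 1 2 3 4 5 6
    by (intro exI[of _ h] exI[of _ S] exI[of _ N] exI[of _ B] exI[of _ C])
      (simp add: holomorphic_into_iff deriv_along_eq)
qed

end
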